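(* Let $\left(\{\mathcal H_{X,x}\}_{x\in X},\ i_{a,X}:a\to\prod_{x\in X}\mathcal H_{X,x}\right)$ and $\left(\{\mathcal H_{Y,y}\}_{y\in Y},\ i_{b,Y}:b\to\prod_{y\in Y}\mathcal H_{Y,y}\right)$ be two networks of hybrid open systems. A morphism of networks $((\varphi,\Phi),z):(\mathcal H_X,i_{a,X})\to(\mathcal H_Y,i_{b,Y})$ induces a 1-morphism $$\begin{array}{ccc}\prod_{y\in Y}\mathrm{dCrl}(\mathcal H_{Y,y})&\xrightarrow{\ \mathrm{dCrl}(\Phi)\ }&\prod_{x\in X}\mathrm{dCrl}(\mathcal H_{X,x})\\ {\scriptstyle \mathrm{dCrl}(i_{b,Y})\circ\mathscr P_Y}\downarrow& \Downarrow &\downarrow{\scriptstyle \mathrm{dCrl}(i_{a,X})\circ\mathscr P_X}\\ \mathrm{dCrl}(b)&\xrightarrow{\ \mathrm{dCrl}(z)\ }&\mathrm{dCrl}(a)\end{array}$$ in $\mathsf{Set}^\square$ (horizontal arrows are relations, vertical arrows are functions), where $$\mathrm{dCrl}(\Phi)=\Big\{\big((w_y)_{y\in Y},(v_x)_{x\in X}\big)\in\prod_{y\in Y}\mathrm{dCrl}(\mathcal H_{Y,y})\times\prod_{x\in X}\mathrm{dCrl}(\mathcal H_{X,x}) : (w_{\varphi(x)},v_x)\in\mathrm{dCrl}(\Phi_x)\ \forall x\in X\Big\}.$$ That is, whenever $w_{\varphi(x)}$ and $v_x$ are $\Phi_x$-related for all $x\in X$, the pair $$\Big(\mathrm{dCrl}(i_{b,Y})\big(\mathscr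 P_Y((w_y)_{y\in Y})\big),\ \mathrm{dCrl}(i_{a,X})\big(\mathscr P_X((v_x)_{x\in X})\big)\Big)$$ is $z$-related.
   Context: $\mathsf{Man}$ is the category of smooth manifolds with corners and smooth maps; $T$ is the tangent functor and $\tau_M:TM\to M$ the projection. Hybrid phase spaces. A hybrid phase space $a$ is a functor of double categories from a small category $\mathbb S^a$ (viewed as a discrete double category) to the double category of manifolds, smooth maps and relations. Concretely: $a$ assigns a manifold $a(s)$ to each object (node) $s$ of $\mathbb S^a$ and a relation $a(\gamma)\subseteq a(s)\times a(s')$ to each morphism (edge) $\gamma:s\to s'$, with $a(\mathrm{id}_s)$ the diagonal and $a(\gamma'\circ\gamma)=a(\gamma')\circ a(\gamma)$ (composition of relations). A morphism $f=(\varphi,\mathfrak f):a\to b$ is a functor $\varphi:\mathbb S^a\to\mathbb S^b$ with smooth maps $\mathfrak f_s:a(s)\to b(\varphi(s))$ such that $(\mathfrak f_s\times\mathfrak f_{s'})(a(\gamma))\subseteq b(\varphi(\gamma))$ for every edge $\gamma:s\to s'$. This is the category $\mathsf{HyPh}$. The functor $\mathbb U:\mathsf{HyPh}\to\mathsf{Man}$ sends $a$ to $\mathbb U a=\bigsqcup_{s}a(s)$ (taken to be an object of $\mathsf{Man}$), with $\mathbb U f$ given by $\mathfrak f_s$ on the $s$-component. Products: $\mathbb S^{a\times b}=\mathbb S^a\times\mathbb S^b$, $(a\times b)(s,s')=a(s)\times b(s')$, and $(a\times b)(\gamma,\gamma')$ is $a(\gamma)\times b(\gamma')$ after reordering factors;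 similarly for finite products. Hybrid surjective submersions. A hybrid surjective submersion $a$ is a morphism $p_a:a_{tot}\to a_{st}$ in $\mathsf{HyPh}$ such that $\mathbb U p_a$ is a surjective submersion. A morphism $f:a\to b$ is a pair $f_{tot}:a_{tot}\to b_{tot}$, $f_{st}:a_{st}\to b_{st}$ of morphisms in $\mathsf{HyPh}$ with $p_b\circ f_{tot}=f_{st}\circ p_a$. This is the category $\mathsf{HySSub}$; finite products are taken componentwise on $tot$ and $st$. A morphism $f$ is an interconnection if $f_{st}$ is an isomorphism in $\mathsf{HyPh}$. Deterministic control. $\mathrm{dCrl}(a)$ is the set of pairs $(X,\rho)$ where $X:\mathbb U a_{tot}\to T\mathbb U a_{st}$ is smooth with $\tau_{\mathbb U a_{st}}\circ X=\mathbb U p_a$, and $\rho:\mathbb U a_{tot}\to\mathbb U a_{st}$ is a map of sets such that for every $x\in\mathbb U a_{tot}$ there is an edge $\gamma_x$ of $\mathbb S^{a_{st}}$ with $(\mathbb U p_a(x),\rho(x))\in a_{st}(\gamma_x)$. For a morphism $f:a\to b$, $(X,\rho)\in\mathrm{dCrl}(a)$ and $(Y,\sigma)\in\mathrm{dCrl}(b)$ are $f$-related if $T\mathbb U f_{st}\circ X=Y\circ\mathbb U f_{tot}$ and $\mathbb U f_{st}\circ\rho=\sigma\circ\mathbb U f_{tot}$; the relation $\mathrm{dCrl}(f)\subseteq\mathrm{dCrl}(a)\times\mathrm{dCrl}(b)$ is the set of $f$-related pairs. If $i:a\to b$ is an interconnection, $\mathrm{dCrl}(i)$ also denotes the function $\mathrm{dCrl}(b)\to\mathrm{dCrl}(a)$,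 $(Y,\sigma)\mapsto\big(T(\mathbb U i_{st})^{-1}\circ Y\circ\mathbb U i_{tot},\ (\mathbb U i_{st})^{-1}\circ\sigma\circ\mathbb U i_{tot}\big)$ (used for the vertical arrows). Products of control. For a finite family $(a_x)_{x\in X}$ in $\mathsf{HySSub}$ let $\gamma_{tot},\gamma_{st}$ be the canonical isomorphisms $\mathbb U(\prod_x a_{x,\bullet})\cong\prod_x\mathbb U a_{x,\bullet}$. Then $\mathscr P_X:\prod_x\mathrm{dCrl}(a_x)\to\mathrm{dCrl}(\prod_x a_x)$ sends $(X_x,\rho_x)_x$ to $\big(T\gamma_{st}^{-1}\circ(\prod_x X_x)\circ\gamma_{tot},\ \gamma_{st}^{-1}\circ(\prod_x\rho_x)\circ\gamma_{tot}\big)$, identifying $T$ of a product with the product of tangent bundles. Networks. A network of hybrid open systems is a pair consisting of a family $\{\mathcal H_{X,x}\}_{x\in X}$ of hybrid surjective submersions indexed by a finite set $X$ and an interconnection $i_{a,X}:a\to\prod_{x\in X}\mathcal H_{X,x}$. A morphism $((\varphi,\Phi),z):(\mathcal H_X,i_{a,X})\to(\mathcal H_Y,i_{b,Y})$ consists of a map of sets $\varphi:X\to Y$, morphisms $\Phi_x:\mathcal H_{Y,\varphi(x)}\to\mathcal H_{X,x}$ in $\mathsf{HySSub}$ for each $x\in X$, and a morphism $z:b\to a$ in $\mathsf{HySSub}$ with $i_{a,X}\circ z=\Pi(\varphi,\Phi)\circ i_{b,Y}$, where $\Pi(\varphi,\Phi):\prod_{y}\mathcal H_{Y,y}\to\prod_x\mathcal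 H_{X,x}$ is the unique morphism with $\mathrm{pr}_x\circ\Pi(\varphi,\Phi)=\Phi_x\circ\mathrm{pr}_{\varphi(x)}$ for all $x$. $\mathsf{Set}^\square$ is the double category of sets, with functions as vertical arrows and relations as horizontal arrows; a 1-morphism from $R\subseteq A\times B$ to $R'\subseteq A'\times B'$ along functions $g:A\to A'$, $h:B\to B'$ is the inclusion $(g\times h)(R)\subseteq R'$. *)

theory Defs
  imports "HOL-Analysis.Analysis"
begin

section \<open>Smooth maps between subsets of Euclidean spaces\<close>

text \<open>
  Dimensions vary from chart to chart, so \<open>\<real>\<^sup>n\<close> is the library's
  \<^const>\<open>Euclidean_space\<close> \<open>n\<close>, i.e. the sequences vanishing from index \<open>n\<close> on, for
  arbitrary \<open>n\<close> (including \<open>0\<close>).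
\<close>

text \<open>
  \<open>i\<close>-th partial derivative relative to \<open>S\<close>. For \<open>S\<close> open it is the usual one; at a boundary
  point of a quadrant it is one-sided, hence equal to that of any differentiable extension.
\<close>

definition part_deriv :: "(nat \<Rightarrow> real) set \<Rightarrow> nat \<Rightarrow> ((nat \<Rightarrow> real) \<Rightarrow> real) \<Rightarrow> (nat \<Rightarrow> real) \<Rightarrow> real" where
  "part_deriv S i f x =
     vector_derivative (\<lambda>t. f (x(i := t))) (at (x i) within {t. x(i := t) \<in> S})"

primrec Ck_on :: "nat \<Rightarrow> nat \<Rightarrow> (nat \<Rightarrow> real) set \<Rightarrow> ((nat \<Rightarrow> real) \<Rightarrow> real) \<Rightarrow> bool" where
  "Ck_on 0 n W f \<longleftrightarrow> continuous_map (subtopology (Euclidean_space n) W) euclideanreal f"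
| "Ck_on (Suc k) n W f \<longleftrightarrow>
     continuous_map (subtopology (Euclidean_space n) W) euclideanreal f \<and>
     (\<forall>i<n. (\<forall>x\<in>W. (\<lambda>t. f (x(i := t))) differentiable (at (x i) within {t. x(i := t) \<in> W})) \<and>
            Ck_on k n W (part_deriv W i f))"

text \<open>Smoothness on an arbitrary subset: local extendability to open sets of \<open>\<real>\<^sup>n\<close>.\<close>

definition smooth_on :: "nat \<Rightarrow> nat \<Rightarrow> (nat \<Rightarrow> real) set \<Rightarrow> ((nat \<Rightarrow> real) \<Rightarrow> nat \<Rightarrow> real) \<Rightarrow> bool" where
  "smooth_on n m S f \<longleftrightarrow>
     S \<subseteq> topspace (Euclidean_space n) \<and> f \<in> S \<rightarrow> topspace (Euclidean_space m) \<and>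
     (\<forall>x\<in>S. \<exists>W h. openin (Euclidean_space n) W \<and> x \<in> W \<and>
        (\<forall>j<m. \<forall>k. Ck_on k n W (\<lambda>y. h y j)) \<and> (\<forall>y\<in>W \<inter> S. h y = f y))"

definition jacobian ::
    "nat \<Rightarrow> nat \<Rightarrow> (nat \<Rightarrow> real) set \<Rightarrow> ((nat \<Rightarrow> real) \<Rightarrow> nat \<Rightarrow> real) \<Rightarrow> (nat \<Rightarrow> real)
      \<Rightarrow> (nat \<Rightarrow> real) \<Rightarrow> nat \<Rightarrow> real" where
  "jacobian n m S f x v =
     (\<lambda>j. if j < m then (\<Sum>i<n. part_deriv S i (\<lambda>y. f y j) x * v i) else 0)"


section \<open>Manifolds with corners\<close>

record 'p chart =
  cdom :: "'p set"
  cdim :: nat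
  cmap :: "'p \<Rightarrow> nat \<Rightarrow> real"

record 'p mfd =
  mtop :: "'p topology"
  atlas :: "'p chart set"

definition points :: "'p mfd \<Rightarrow> 'p set" where
  "points M = topspace (mtop M)"

definition cinv :: "'p chart \<Rightarrow> (nat \<Rightarrow> real) \<Rightarrow> 'p" where
  "cinv c = inv_into (cdom c) (cmap c)"

definition loc_dom :: "'p chart \<Rightarrow> ('p \<Rightarrow> 'q) \<Rightarrow> 'q chart \<Rightarrow> (nat \<Rightarrow> real) set" where
  "loc_dom c f d = cmap c ` {p \<in> cdom c. f p \<in> cdom d}"

definition loc_rep :: "'p chart \<Rightarrow> ('p \<Rightarrow> 'q) \<Rightarrow> 'q chart \<Rightarrow> (nat \<Rightarrow> real) \<Rightarrow> nat \<Rightarrow> real" where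
  "loc_rep c f d = (\<lambda>z. cmap d (f (cinv c z)))"

definition quadrant :: "nat \<Rightarrow> nat set \<Rightarrow> (nat \<Rightarrow> real) set" where
  "quadrant n K = {x \<in> topspace (Euclidean_space n). \<forall>i\<in>K. 0 \<le> x i}"

text \<open>
  Any set \<open>K\<close> of coordinates may be constrained to be nonnegative (rather than an initial
  segment), so that products of charts are charts without sorting coordinates.
\<close>

definition corner_chart :: "'p topology \<Rightarrow> 'p chart \<Rightarrow> bool" where
  "corner_chart T c \<longleftrightarrow>
     openin T (cdom c) \<and>
     (\<exists>K\<subseteq>{..<cdim c}. openin (subtopology (Euclidean_space (cdim c)) (quadrant (cdim c) K)) (cmap c ` cdom c)) \<and>
     homeomorphic_map (subtopology T (cdom c))
       (subtopology (Euclidean_space (cdim c)) (cmap c ` cdom c)) (cmap c)"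

text \<open>
  The smooth structure is presented by an atlas, which need not be maximal. The dimension is only
  locally constant, since the coproduct of manifolds of different dimensions is to be a manifold.
\<close>

definition manifold :: "'p mfd \<Rightarrow> bool" where
  "manifold M \<longleftrightarrow>
     Hausdorff_space (mtop M) \<and> second_countable (mtop M) \<and>
     (\<forall>c\<in>atlas M. corner_chart (mtop M) c) \<and>
     points M = (\<Union>c\<in>atlas M. cdom c) \<and>
     (\<forall>c\<in>atlas M. \<forall>d\<in>atlas M.
        smooth_on (cdim c) (cdim d) (loc_dom c (\<lambda>p. p) d) (loc_rep c (\<lambda>p. p) d))"

definition smooth_map :: "'p mfd \<Rightarrow> 'q mfd \<Rightarrow> ('p \<Rightarrow> 'q) \<Rightarrow> bool" where
  "smooth_map M N f \<longleftrightarrow>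
     continuous_map (mtop M) (mtop N) f \<and>
     (\<forall>c\<in>atlas M. \<forall>d\<in>atlas N. smooth_on (cdim c) (cdim d) (loc_dom c f d) (loc_rep c f d))"


subsection \<open>Tangent functor\<close>

definition charts_at :: "'p mfd \<Rightarrow> 'p \<Rightarrow> 'p chart set" where
  "charts_at M p = {c \<in> atlas M. p \<in> cdom c}"

text \<open>
  A tangent vector at \<open>p\<close> is its family of coordinate vectors in the charts around \<open>p\<close>,
  transforming by the derivatives of the coordinate changes.
\<close>

definition tangent_space :: "'p mfd \<Rightarrow> 'p \<Rightarrow> ('p chart \<Rightarrow> nat \<Rightarrow> real) set" where
  "tangent_space M p =
     {v \<in> (\<Pi>\<^sub>E c\<in>charts_at M p. topspace (Euclidean_space (cdim c))).
        \<forall>c\<in>charts_at M p. \<forall>d\<in>charts_at M p.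
          v d = jacobian (cdim c) (cdim d) (loc_dom c (\<lambda>p. p) d) (loc_rep c (\<lambda>p. p) d) (cmap c p) (v c)}"

type_synonym 'p tvec = "'p \<times> ('p chart \<Rightarrow> nat \<Rightarrow> real)"

definition tchart :: "'p mfd \<Rightarrow> 'p chart \<Rightarrow> 'p tvec chart" where
  "tchart M c =
     \<lparr> cdom = Sigma (cdom c) (tangent_space M),
       cdim = 2 * cdim c,
       cmap = (\<lambda>(p, v) i. if i < cdim c then cmap c p i else v c (i - cdim c)) \<rparr>"

definition tangent_bundle :: "'p mfd \<Rightarrow> 'p tvec mfd" where
  "tangent_bundle M =
     \<lparr> mtop = topology_generated_by
         {{u \<in> cdom (tchart M c). cmap (tchart M c) u \<in> V} | c V.
            c \<in> atlas M \<and> openin (Euclidean_space (2 * cdim c)) V},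
       atlas = tchart M ` atlas M \<rparr>"

definition tangent_map :: "'p mfd \<Rightarrow> 'q mfd \<Rightarrow> ('p \<Rightarrow> 'q) \<Rightarrow> 'p tvec \<Rightarrow> 'q tvec" where
  "tangent_map M N f = (\<lambda>(p, v).
     (f p, \<lambda>d\<in>charts_at N (f p).
        (let c = (SOME c. c \<in> charts_at M p)
         in jacobian (cdim c) (cdim d) (loc_dom c f d) (loc_rep c f d) (cmap c p) (v c))))"

definition surj_submersion :: "'p mfd \<Rightarrow> 'q mfd \<Rightarrow> ('p \<Rightarrow> 'q) \<Rightarrow> bool" where
  "surj_submersion M N f \<longleftrightarrow>
     smooth_map M N f \<and> f ` points M = points N \<and>
     (\<forall>p\<in>points M. tangent_map M N f ` ({p} \<times> tangent_space M p) = {f p} \<times> tangent_space N (f p))"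


subsection \<open>Coproducts and finite products\<close>

definition mfd_sum :: "'s set \<Rightarrow> ('s \<Rightarrow> 'p mfd) \<Rightarrow> ('s \<times> 'p) mfd" where
  "mfd_sum S M =
     \<lparr> mtop = sum_topology (\<lambda>s. mtop (M s)) S,
       atlas = {\<lparr> cdom = {s} \<times> cdom c, cdim = cdim c, cmap = (\<lambda>(_, p). cmap c p) \<rparr> | s c.
                  s \<in> S \<and> c \<in> atlas (M s)} \<rparr>"

text \<open>
  Charts of a product: the coordinates of the factors, enumerated in any order \<open>e\<close>.
\<close>

definition mfd_prod :: "'i set \<Rightarrow> ('i \<Rightarrow> 'p mfd) \<Rightarrow> ('i \<Rightarrow> 'p) mfd" where
  "mfd_prod X M =
     \<lparr> mtop = product_topology (\<lambda>x. mtop (M x)) X,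
       atlas = {\<lparr> cdom = (\<Pi>\<^sub>E x\<in>X. cdom (c x)), cdim = N,
                  cmap = (\<lambda>p j. if j < N then (case e j of (x, i) \<Rightarrow> cmap (c x) (p x) i) else 0) \<rparr> | c N e.
                  c \<in> (\<Pi>\<^sub>E x\<in>X. atlas (M x)) \<and> bij_betw e {..<N} (SIGMA x:X. {..<cdim (c x)})} \<rparr>"

text \<open>The identification \<open>\<Prod>\<^sub>x T M\<^sub>x \<cong> T (\<Prod>\<^sub>x M\<^sub>x)\<close>, inverse to the tuple of the \<open>T pr\<^sub>x\<close>.\<close>

definition prod_tangent :: "'i set \<Rightarrow> ('i \<Rightarrow> 'p mfd) \<Rightarrow> ('i \<Rightarrow> 'p tvec) \<Rightarrow> ('i \<Rightarrow> 'p) tvec" where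
  "prod_tangent X M =
     inv_into (points (tangent_bundle (mfd_prod X M)))
       (\<lambda>u. \<lambda>x\<in>X. tangent_map (mfd_prod X M) (M x) (\<lambda>p. p x) u)"


section \<open>Hybrid phase spaces\<close>

record ('s, 'e) cat =
  Ob :: "'s set"
  Ar :: "'e set"
  Src :: "'e \<Rightarrow> 's"
  Tgt :: "'e \<Rightarrow> 's"
  Idn :: "'s \<Rightarrow> 'e"
  Cmp :: "'e \<Rightarrow> 'e \<Rightarrow> 'e"

text \<open>\<open>Cmp C h g\<close> is \<open>h \<circ> g\<close>.\<close>

definition category :: "('s, 'e) cat \<Rightarrow> bool" where
  "category C \<longleftrightarrow>
     Src C \<in> Ar C \<rightarrow> Ob C \<and> Tgt C \<in> Ar C \<rightarrow> Ob C \<and>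
     (\<forall>s\<in>Ob C. Idn C s \<in> Ar C \<and> Src C (Idn C s) = s \<and> Tgt C (Idn C s) = s) \<and>
     (\<forall>g\<in>Ar C. \<forall>h\<in>Ar C. Tgt C g = Src C h \<longrightarrow>
        Cmp C h g \<in> Ar C \<and> Src C (Cmp C h g) = Src C g \<and> Tgt C (Cmp C h g) = Tgt C h) \<and>
     (\<forall>g\<in>Ar C. Cmp C g (Idn C (Src C g)) = g \<and> Cmp C (Idn C (Tgt C g)) g = g) \<and>
     (\<forall>g\<in>Ar C. \<forall>h\<in>Ar C. \<forall>k\<in>Ar C. Tgt C g = Src C h \<longrightarrow> Tgt C h = Src C k \<longrightarrow>
        Cmp C k (Cmp C h g) = Cmp C (Cmp C k h) g)"

record ('s, 'e, 'p) hyph =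
  base :: "('s, 'e) cat"
  space :: "'s \<Rightarrow> 'p mfd"
  rel :: "'e \<Rightarrow> ('p \<times> 'p) set"

definition UU :: "('s, 'e, 'p) hyph \<Rightarrow> ('s \<times> 'p) mfd" where
  "UU a = mfd_sum (Ob (base a)) (space a)"

definition hybrid_phase_space :: "('s, 'e, 'p) hyph \<Rightarrow> bool" where
  "hybrid_phase_space a \<longleftrightarrow>
     category (base a) \<and>
     (\<forall>s\<in>Ob (base a). manifold (space a s)) \<and>
     (\<forall>g\<in>Ar (base a). rel a g \<subseteq> points (space a (Src (base a) g)) \<times> points (space a (Tgt (base a) g))) \<and>
     (\<forall>s\<in>Ob (base a). rel a (Idn (base a) s) = Id_on (points (space a s))) \<and>
     (\<forall>g\<in>Ar (base a). \<forall>h\<in>Ar (base a). Tgt (base a) g = Src (base a) h \<longrightarrow>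
        rel a (Cmp (base a) h g) = rel a g O rel a h) \<and>
     manifold (UU a)"

record ('s, 'e, 'p, 't, 'g, 'q) hymap =
  onob :: "'s \<Rightarrow> 't"
  onar :: "'e \<Rightarrow> 'g"
  onpt :: "'s \<Rightarrow> 'p \<Rightarrow> 'q"

definition is_functor ::
    "('s, 'e) cat \<Rightarrow> ('t, 'g) cat \<Rightarrow> ('s \<Rightarrow> 't) \<Rightarrow> ('e \<Rightarrow> 'g) \<Rightarrow> bool" where
  "is_functor C D fo fa \<longleftrightarrow>
     fo \<in> Ob C \<rightarrow> Ob D \<and> fa \<in> Ar C \<rightarrow> Ar D \<and>
     (\<forall>g\<in>Ar C. Src D (fa g) = fo (Src C g) \<and> Tgt D (fa g) = fo (Tgt C g)) \<and>
     (\<forall>s\<in>Ob C. fa (Idn C s) = Idn D (fo s)) \<and>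
     (\<forall>g\<in>Ar C. \<forall>h\<in>Ar C. Tgt C g = Src C h \<longrightarrow> fa (Cmp C h g) = Cmp D (fa h) (fa g))"

definition hyph_mor ::
    "('s, 'e, 'p) hyph \<Rightarrow> ('t, 'g, 'q) hyph \<Rightarrow> ('s, 'e, 'p, 't, 'g, 'q) hymap \<Rightarrow> bool" where
  "hyph_mor a b f \<longleftrightarrow>
     is_functor (base a) (base b) (onob f) (onar f) \<and>
     (\<forall>s\<in>Ob (base a). smooth_map (space a s) (space b (onob f s)) (onpt f s)) \<and>
     (\<forall>g\<in>Ar (base a). map_prod (onpt f (Src (base a) g)) (onpt f (Tgt (base a) g)) ` rel a g
        \<subseteq> rel b (onar f g))"

text \<open>
  Equality of morphisms with source \<open>a\<close>: HOL functions representing them may differ off their domains.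
\<close>

definition hyph_eq ::
    "('s, 'e, 'p) hyph \<Rightarrow> ('s, 'e, 'p, 't, 'g, 'q) hymap \<Rightarrow> ('s, 'e, 'p, 't, 'g, 'q) hymap \<Rightarrow> bool" where
  "hyph_eq a f f' \<longleftrightarrow>
     (\<forall>s\<in>Ob (base a). onob f s = onob f' s \<and> (\<forall>p\<in>points (space a s). onpt f s p = onpt f' s p)) \<and>
     (\<forall>g\<in>Ar (base a). onar f g = onar f' g)"

definition hyph_id :: "('s, 'e, 'p, 's, 'e, 'p) hymap" where
  "hyph_id = \<lparr> onob = (\<lambda>s. s), onar = (\<lambda>g. g), onpt = (\<lambda>s p. p) \<rparr>"

definition hyph_comp ::
    "('t, 'g, 'q, 'u, 'h, 'r) hymap \<Rightarrow> ('s, 'e, 'p, 't, 'g, 'q) hymap \<Rightarrow> ('s, 'e, 'p, 'u, 'h, 'r) hymap" where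
  "hyph_comp f' f =
     \<lparr> onob = (\<lambda>s. onob f' (onob f s)), onar = (\<lambda>g. onar f' (onar f g)),
       onpt = (\<lambda>s p. onpt f' (onob f s) (onpt f s p)) \<rparr>"

definition hyph_iso ::
    "('s, 'e, 'p) hyph \<Rightarrow> ('t, 'g, 'q) hyph \<Rightarrow> ('s, 'e, 'p, 't, 'g, 'q) hymap \<Rightarrow> bool" where
  "hyph_iso a b f \<longleftrightarrow>
     hyph_mor a b f \<and>
     (\<exists>f'. hyph_mor b a f' \<and> hyph_eq a (hyph_comp f' f) hyph_id \<and> hyph_eq b (hyph_comp f f') hyph_id)"

definition UU_map :: "('s, 'e, 'p, 't, 'g, 'q) hymap \<Rightarrow> 's \<times> 'p \<Rightarrow> 't \<times> 'q" where
  "UU_map f = (\<lambda>(s, p). (onob f s, onpt f s p))"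


subsection \<open>Finite products\<close>

definition cat_prod :: "'i set \<Rightarrow> ('i \<Rightarrow> ('s, 'e) cat) \<Rightarrow> ('i \<Rightarrow> 's, 'i \<Rightarrow> 'e) cat" where
  "cat_prod X C =
     \<lparr> Ob = (\<Pi>\<^sub>E x\<in>X. Ob (C x)), Ar = (\<Pi>\<^sub>E x\<in>X. Ar (C x)),
       Src = (\<lambda>g. \<lambda>x\<in>X. Src (C x) (g x)), Tgt = (\<lambda>g. \<lambda>x\<in>X. Tgt (C x) (g x)),
       Idn = (\<lambda>s. \<lambda>x\<in>X. Idn (C x) (s x)), Cmp = (\<lambda>h g. \<lambda>x\<in>X. Cmp (C x) (h x) (g x)) \<rparr>"

definition hyph_prod ::
    "'i set \<Rightarrow> ('i \<Rightarrow> ('s, 'e, 'p) hyph) \<Rightarrow> ('i \<Rightarrow> 's, 'i \<Rightarrow> 'e, 'i \<Rightarrow> 'p) hyph" where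
  "hyph_prod X a =
     \<lparr> base = cat_prod X (\<lambda>x. base (a x)),
       space = (\<lambda>s. mfd_prod X (\<lambda>x. space (a x) (s x))),
       rel = (\<lambda>g. {(p, q). p \<in> extensional X \<and> q \<in> extensional X \<and>
                            (\<forall>x\<in>X. (p x, q x) \<in> rel (a x) (g x))}) \<rparr>"

definition hyph_pr :: "'i \<Rightarrow> ('i \<Rightarrow> 's, 'i \<Rightarrow> 'e, 'i \<Rightarrow> 'p, 's, 'e, 'p) hymap" where
  "hyph_pr x = \<lparr> onob = (\<lambda>s. s x), onar = (\<lambda>g. g x), onpt = (\<lambda>s p. p x) \<rparr>"

definition hyph_tuple ::
    "'i set \<Rightarrow> ('i \<Rightarrow> ('s, 'e, 'p, 't, 'g, 'q) hymap)
      \<Rightarrow> ('s, 'e, 'p, 'i \<Rightarrow> 't, 'i \<Rightarrow> 'g, 'i \<Rightarrow> 'q) hymap" where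
  "hyph_tuple X f =
     \<lparr> onob = (\<lambda>s. \<lambda>x\<in>X. onob (f x) s), onar = (\<lambda>g. \<lambda>x\<in>X. onar (f x) g),
       onpt = (\<lambda>s p. \<lambda>x\<in>X. onpt (f x) s p) \<rparr>"


section \<open>Hybrid surjective submersions\<close>

record ('s, 'e, 'p, 't, 'g, 'q) hss =
  tot :: "('s, 'e, 'p) hyph"
  st :: "('t, 'g, 'q) hyph"
  prj :: "('s, 'e, 'p, 't, 'g, 'q) hymap"

definition hybrid_surj_submersion :: "('s, 'e, 'p, 't, 'g, 'q) hss \<Rightarrow> bool" where
  "hybrid_surj_submersion a \<longleftrightarrow>
     hybrid_phase_space (tot a) \<and> hybrid_phase_space (st a) \<and> hyph_mor (tot a) (st a) (prj a) \<and>
     surj_submersion (UU (tot a)) (UU (st a)) (UU_map (prj a))"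

record ('s, 'e, 'p, 't, 'g, 'q, 's1, 'e1, 'p1, 't1, 'g1, 'q1) hssmap =
  mtot :: "('s, 'e, 'p, 's1, 'e1, 'p1) hymap"
  mst :: "('t, 'g, 'q, 't1, 'g1, 'q1) hymap"

definition hss_mor ::
    "('s, 'e, 'p, 't, 'g, 'q) hss \<Rightarrow> ('s1, 'e1, 'p1, 't1, 'g1, 'q1) hss
      \<Rightarrow> ('s, 'e, 'p, 't, 'g, 'q, 's1, 'e1, 'p1, 't1, 'g1, 'q1) hssmap \<Rightarrow> bool" where
  "hss_mor a b f \<longleftrightarrow>
     hyph_mor (tot a) (tot b) (mtot f) \<and> hyph_mor (st a) (st b) (mst f) \<and>
     hyph_eq (tot a) (hyph_comp (prj b) (mtot f)) (hyph_comp (mst f) (prj a))"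

definition hss_eq ::
    "('s, 'e, 'p, 't, 'g, 'q) hss
      \<Rightarrow> ('s, 'e, 'p, 't, 'g, 'q, 's1, 'e1, 'p1, 't1, 'g1, 'q1) hssmap
      \<Rightarrow> ('s, 'e, 'p, 't, 'g, 'q, 's1, 'e1, 'p1, 't1, 'g1, 'q1) hssmap \<Rightarrow> bool" where
  "hss_eq a f f' \<longleftrightarrow> hyph_eq (tot a) (mtot f) (mtot f') \<and> hyph_eq (st a) (mst f) (mst f')"

definition hss_comp ::
    "('s1, 'e1, 'p1, 't1, 'g1, 'q1, 's2, 'e2, 'p2, 't2, 'g2, 'q2) hssmap
      \<Rightarrow> ('s, 'e, 'p, 't, 'g, 'q, 's1, 'e1, 'p1, 't1, 'g1, 'q1) hssmap
      \<Rightarrow> ('s, 'e, 'p, 't, 'g, 'q, 's2, 'e2, 'p2, 't2, 'g2, 'q2) hssmap" where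
  "hss_comp f' f = \<lparr> mtot = hyph_comp (mtot f') (mtot f), mst = hyph_comp (mst f') (mst f) \<rparr>"

definition interconnection ::
    "('s, 'e, 'p, 't, 'g, 'q) hss \<Rightarrow> ('s1, 'e1, 'p1, 't1, 'g1, 'q1) hss
      \<Rightarrow> ('s, 'e, 'p, 't, 'g, 'q, 's1, 'e1, 'p1, 't1, 'g1, 'q1) hssmap \<Rightarrow> bool" where
  "interconnection a b i \<longleftrightarrow> hss_mor a b i \<and> hyph_iso (st a) (st b) (mst i)"

definition hss_prod ::
    "'i set \<Rightarrow> ('i \<Rightarrow> ('s, 'e, 'p, 't, 'g, 'q) hss)
      \<Rightarrow> ('i \<Rightarrow> 's, 'i \<Rightarrow> 'e, 'i \<Rightarrow> 'p, 'i \<Rightarrow> 't, 'i \<Rightarrow> 'g, 'i \<Rightarrow> 'q) hss" where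
  "hss_prod X a =
     \<lparr> tot = hyph_prod X (\<lambda>x. tot (a x)), st = hyph_prod X (\<lambda>x. st (a x)),
       prj = hyph_tuple X (\<lambda>x. hyph_comp (prj (a x)) (hyph_pr x)) \<rparr>"

definition hss_pr ::
    "'i \<Rightarrow> ('i \<Rightarrow> 's, 'i \<Rightarrow> 'e, 'i \<Rightarrow> 'p, 'i \<Rightarrow> 't, 'i \<Rightarrow> 'g, 'i \<Rightarrow> 'q, 's, 'e, 'p, 't, 'g, 'q) hssmap" where
  "hss_pr x = \<lparr> mtot = hyph_pr x, mst = hyph_pr x \<rparr>"

definition hss_tuple ::
    "'i set \<Rightarrow> ('i \<Rightarrow> ('s, 'e, 'p, 't, 'g, 'q, 's1, 'e1, 'p1, 't1, 'g1, 'q1) hssmap)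
      \<Rightarrow> ('s, 'e, 'p, 't, 'g, 'q, 'i \<Rightarrow> 's1, 'i \<Rightarrow> 'e1, 'i \<Rightarrow> 'p1, 'i \<Rightarrow> 't1, 'i \<Rightarrow> 'g1, 'i \<Rightarrow> 'q1) hssmap" where
  "hss_tuple X f = \<lparr> mtot = hyph_tuple X (\<lambda>x. mtot (f x)), mst = hyph_tuple X (\<lambda>x. mst (f x)) \<rparr>"


section \<open>Deterministic control\<close>

text \<open>
  Points of \<open>UU a\<close> carry their node, so \<open>(x, y) \<in> a(\<gamma>)\<close> for points \<open>x\<close>, \<open>y\<close> of \<open>UU a\<close>
  includes that \<open>\<gamma>\<close> is an edge from the node of \<open>x\<close> to the node of \<open>y\<close>. Elements of \<open>dCrl a\<close>
  are extensional, so that they are maps on \<open>UU (tot a)\<close> and nothing else.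
\<close>

definition dCrl :: "('s, 'e, 'p, 't, 'g, 'q) hss \<Rightarrow> (('s \<times> 'p \<Rightarrow> ('t \<times> 'q) tvec) \<times> ('s \<times> 'p \<Rightarrow> 't \<times> 'q)) set" where
  "dCrl a =
     {(V, \<rho>).
        V \<in> extensional (points (UU (tot a))) \<and>
        smooth_map (UU (tot a)) (tangent_bundle (UU (st a))) V \<and>
        (\<forall>x\<in>points (UU (tot a)). fst (V x) = UU_map (prj a) x) \<and>
        \<rho> \<in> points (UU (tot a)) \<rightarrow>\<^sub>E points (UU (st a)) \<and>
        (\<forall>x\<in>points (UU (tot a)). \<exists>g\<in>Ar (base (st a)).
           Src (base (st a)) g = fst (UU_map (prj a) x) \<and> Tgt (base (st a)) g = fst (\<rho> x) \<and>
           (snd (UU_map (prj a) x), snd (\<rho> x)) \<in> rel (st a) g)}"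

definition dCrl_rel ::
    "('s, 'e, 'p, 't, 'g, 'q) hss \<Rightarrow> ('s1, 'e1, 'p1, 't1, 'g1, 'q1) hss
      \<Rightarrow> ('s, 'e, 'p, 't, 'g, 'q, 's1, 'e1, 'p1, 't1, 'g1, 'q1) hssmap
      \<Rightarrow> ((('s \<times> 'p \<Rightarrow> ('t \<times> 'q) tvec) \<times> ('s \<times> 'p \<Rightarrow> 't \<times> 'q)) \<times>
          (('s1 \<times> 'p1 \<Rightarrow> ('t1 \<times> 'q1) tvec) \<times> ('s1 \<times> 'p1 \<Rightarrow> 't1 \<times> 'q1))) set" where
  "dCrl_rel a b f =
     {((V, \<rho>), (W, \<sigma>)). (V, \<rho>) \<in> dCrl a \<and> (W, \<sigma>) \<in> dCrl b \<and>
        (\<forall>x\<in>points (UU (tot a)).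
           tangent_map (UU (st a)) (UU (st b)) (UU_map (mst f)) (V x) = W (UU_map (mtot f) x) \<and>
           UU_map (mst f) (\<rho> x) = \<sigma> (UU_map (mtot f) x))}"

definition dCrl_pullback ::
    "('s, 'e, 'p, 't, 'g, 'q) hss \<Rightarrow> ('s1, 'e1, 'p1, 't1, 'g1, 'q1) hss
      \<Rightarrow> ('s, 'e, 'p, 't, 'g, 'q, 's1, 'e1, 'p1, 't1, 'g1, 'q1) hssmap
      \<Rightarrow> ('s1 \<times> 'p1 \<Rightarrow> ('t1 \<times> 'q1) tvec) \<times> ('s1 \<times> 'p1 \<Rightarrow> 't1 \<times> 'q1)
      \<Rightarrow> ('s \<times> 'p \<Rightarrow> ('t \<times> 'q) tvec) \<times> ('s \<times> 'p \<Rightarrow> 't \<times> 'q)" where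
  "dCrl_pullback a b i = (\<lambda>(W, \<sigma>).
     (\<lambda>x\<in>points (UU (tot a)).
        inv_into (points (tangent_bundle (UU (st a))))
          (tangent_map (UU (st a)) (UU (st b)) (UU_map (mst i))) (W (UU_map (mtot i) x)),
      \<lambda>x\<in>points (UU (tot a)).
        inv_into (points (UU (st a))) (UU_map (mst i)) (\<sigma> (UU_map (mtot i) x))))"

text \<open>The canonical map \<open>UU (\<Prod>\<^sub>x a\<^sub>x) \<rightarrow> \<Prod>\<^sub>x UU a\<^sub>x\<close>.\<close>

definition canon :: "'i set \<Rightarrow> ('i \<Rightarrow> 's) \<times> ('i \<Rightarrow> 'p) \<Rightarrow> 'i \<Rightarrow> 's \<times> 'p" where
  "canon X = (\<lambda>(s, p). \<lambda>x\<in>X. (s x, p x))"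

definition dCrl_prod ::
    "'i set \<Rightarrow> ('i \<Rightarrow> ('s, 'e, 'p, 't, 'g, 'q) hss)
      \<Rightarrow> ('i \<Rightarrow> ('s \<times> 'p \<Rightarrow> ('t \<times> 'q) tvec) \<times> ('s \<times> 'p \<Rightarrow> 't \<times> 'q))
      \<Rightarrow> (('i \<Rightarrow> 's) \<times> ('i \<Rightarrow> 'p) \<Rightarrow> (('i \<Rightarrow> 't) \<times> ('i \<Rightarrow> 'q)) tvec) \<times>
         (('i \<Rightarrow> 's) \<times> ('i \<Rightarrow> 'p) \<Rightarrow> ('i \<Rightarrow> 't) \<times> ('i \<Rightarrow> 'q))" where
  "dCrl_prod X a w =
     (\<lambda>u\<in>points (UU (tot (hss_prod X a))).
        inv_into (points (tangent_bundle (UU (st (hss_prod X a)))))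
          (tangent_map (UU (st (hss_prod X a))) (mfd_prod X (\<lambda>x. UU (st (a x)))) (canon X))
          (prod_tangent X (\<lambda>x. UU (st (a x))) (\<lambda>x\<in>X. fst (w x) (canon X u x))),
      \<lambda>u\<in>points (UU (tot (hss_prod X a))).
        inv_into (points (UU (st (hss_prod X a)))) (canon X) (\<lambda>x\<in>X. snd (w x) (canon X u x)))"


section \<open>Networks\<close>

definition network ::
    "'i set \<Rightarrow> ('i \<Rightarrow> ('s1, 'e1, 'p1, 't1, 'g1, 'q1) hss) \<Rightarrow> ('s, 'e, 'p, 't, 'g, 'q) hss
      \<Rightarrow> ('s, 'e, 'p, 't, 'g, 'q, 'i \<Rightarrow> 's1, 'i \<Rightarrow> 'e1, 'i \<Rightarrow> 'p1, 'i \<Rightarrow> 't1, 'i \<Rightarrow> 'g1, 'i \<Rightarrow> 'q1) hssmap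
      \<Rightarrow> bool" where
  "network X H a i \<longleftrightarrow>
     finite X \<and> (\<forall>x\<in>X. hybrid_surj_submersion (H x)) \<and> hybrid_surj_submersion a \<and>
     interconnection a (hss_prod X H) i"

text \<open>
  \<open>\<Pi>(\<phi>, \<Phi>)\<close>; the two lemmas below state its defining property and that it is determined by it.
\<close>

definition hss_Pi ::
    "'i set \<Rightarrow> ('i \<Rightarrow> 'j) \<Rightarrow> ('i \<Rightarrow> ('s, 'e, 'p, 't, 'g, 'q, 's1, 'e1, 'p1, 't1, 'g1, 'q1) hssmap)
      \<Rightarrow> ('j \<Rightarrow> 's, 'j \<Rightarrow> 'e, 'j \<Rightarrow> 'p, 'j \<Rightarrow> 't, 'j \<Rightarrow> 'g, 'j \<Rightarrow> 'q,
          'i \<Rightarrow> 's1, 'i \<Rightarrow> 'e1, 'i \<Rightarrow> 'p1, 'i \<Rightarrow> 't1, 'i \<Rightarrow> 'g1, 'i \<Rightarrow> 'q1) hssmap" where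
  "hss_Pi X \<phi> \<Phi> = hss_tuple X (\<lambda>x. hss_comp (\<Phi> x) (hss_pr (\<phi> x)))"

lemma hss_pr_hss_Pi:
  assumes "x \<in> X"
  shows "hss_eq a (hss_comp (hss_pr x) (hss_Pi X \<phi> \<Phi>)) (hss_comp (\<Phi> x) (hss_pr (\<phi> x)))"
  using assms
  by (simp add: hss_eq_def hyph_eq_def hss_comp_def hyph_comp_def hss_pr_def hyph_pr_def
      hss_Pi_def hss_tuple_def hyph_tuple_def)

lemma points_mfd_prod: "points (mfd_prod X M) = (\<Pi>\<^sub>E x\<in>X. points (M x))"
  by (simp add: points_def mfd_prod_def)

lemma hyph_tuple_unique:
  assumes "hyph_mor a (hyph_prod X b) P"
    and "\<And>x. x \<in> X \<Longrightarrow> hyph_eq a (hyph_comp (hyph_pr x) P) (f x)"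
  shows "hyph_eq a P (hyph_tuple X f)"
proof -
  have ob: "onob P s \<in> extensional X" if "s \<in> Ob (base a)" for s
    using assms(1) that
    by (force simp: hyph_mor_def is_functor_def hyph_prod_def cat_prod_def PiE_def)
  have ar: "onar P g \<in> extensional X" if "g \<in> Ar (base a)" for g
    using assms(1) that
    by (force simp: hyph_mor_def is_functor_def hyph_prod_def cat_prod_def PiE_def)
  have pt: "onpt P s p \<in> extensional X" if "s \<in> Ob (base a)" "p \<in> points (space a s)" for s p
  proof -
    have "continuous_map (mtop (space a s)) (mtop (space (hyph_prod X b) (onob P s))) (onpt P s)"
      using assms(1) that(1) by (simp add: hyph_mor_def smooth_map_def)
    then have "onpt P s p \<in> points (space (hyph_prod X b) (onob P s))"
      using that(2) by (auto simp: points_def continuous_map_def)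
    then show ?thesis
      by (auto simp: hyph_prod_def points_mfd_prod PiE_def)
  qed
  show ?thesis
    unfolding hyph_eq_def
  proof (intro conjI ballI)
    fix s assume s: "s \<in> Ob (base a)"
    show "onob P s = onob (hyph_tuple X f) s"
      using assms(2) s by (intro extensionalityI[OF ob[OF s]])
        (auto simp: hyph_tuple_def hyph_eq_def hyph_comp_def hyph_pr_def)
    show "onpt P s p = onpt (hyph_tuple X f) s p" if "p \<in> points (space a s)" for p
      using assms(2) s that by (intro extensionalityI[OF pt[OF s that]])
        (auto simp: hyph_tuple_def hyph_eq_def hyph_comp_def hyph_pr_def)
  next
    fix g assume g: "g \<in> Ar (base a)"
    show "onar P g = onar (hyph_tuple X f) g"
      using assms(2) g by (intro extensionalityI[OF ar[OF g]])
        (auto simp: hyph_tuple_def hyph_eq_def hyph_comp_def hyph_pr_def)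
  qed
qed

lemma hss_Pi_unique:
  assumes "hss_mor a (hss_prod X b) P"
    and "\<And>x. x \<in> X \<Longrightarrow> hss_eq a (hss_comp (hss_pr x) P) (hss_comp (\<Phi> x) (hss_pr (\<phi> x)))"
  shows "hss_eq a P (hss_Pi X \<phi> \<Phi>)"
  unfolding hss_eq_def hss_Pi_def hss_tuple_def
  using assms
  by (auto simp: hss_mor_def hss_prod_def hss_eq_def hss_comp_def hss_pr_def
      intro!: hyph_tuple_unique)

definition network_mor where
  "network_mor X HX a ia Y HY b ib \<phi> \<Phi> z \<longleftrightarrow>
     \<phi> \<in> X \<rightarrow> Y \<and> (\<forall>x\<in>X. hss_mor (HY (\<phi> x)) (HX x) (\<Phi> x)) \<and> hss_mor b a z \<and>
     hss_eq b (hss_comp ia z) (hss_comp (hss_Pi X \<phi> \<Phi>) ib)"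

definition dCrl_family_rel where
  "dCrl_family_rel X HX Y HY \<phi> \<Phi> =
     {(w, v). w \<in> (\<Pi>\<^sub>E y\<in>Y. dCrl (HY y)) \<and> v \<in> (\<Pi>\<^sub>E x\<in>X. dCrl (HX x)) \<and>
        (\<forall>x\<in>X. (w (\<phi> x), v x) \<in> dCrl_rel (HY (\<phi> x)) (HX x) (\<Phi> x))}"

text \<open>
  \<open>g\<close> and \<open>h\<close> are functions \<open>A \<rightarrow> A'\<close>, \<open>B \<rightarrow> B'\<close> and the vertical sides of a 1-morphism from the
  relation \<open>R \<subseteq> A \<times> B\<close> to the relation \<open>R' \<subseteq> A' \<times> B'\<close>.
\<close>

definition set_square_mor ::
    "'a set \<Rightarrow> 'b set \<Rightarrow> ('a \<times> 'b) set \<Rightarrow> 'c set \<Rightarrow> 'd set \<Rightarrow> ('c \<times> 'd) set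
      \<Rightarrow> ('a \<Rightarrow> 'c) \<Rightarrow> ('b \<Rightarrow> 'd) \<Rightarrow> bool" where
  "set_square_mor A B R A' B' R' g h \<longleftrightarrow>
     R \<subseteq> A \<times> B \<and> R' \<subseteq> A' \<times> B' \<and> g \<in> A \<rightarrow> A' \<and> h \<in> B \<rightarrow> B' \<and> map_prod g h ` R \<subseteq> R'"

end

theory Submission
  imports Defs
begin

text \<open>
  For a network with interconnection \<open>i\<close> into the product of the \<open>H x\<close>, let \<open>q x\<close> be the
  composite of \<open>U i\<^sub>s\<^sub>t\<close>, the canonical map and the \<open>x\<close>-th projection. The image \<open>(V, \<rho>)\<close> of a
  family \<open>w\<close> of controls is determined by the equations \<open>T (q x) (V u) = fst (w x) u\<^sub>x\<close> and
  \<open>q x (\<rho> u) = snd (w x) u\<^sub>x\<close>, where \<open>u\<^sub>x\<close> is the \<open>x\<close>-component of \<open>U i\<^sub>t\<^sub>o\<^sub>t u\<close>, because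
  the canonical map and \<open>U i\<^sub>s\<^sub>t\<close> are diffeomorphisms and the \<open>T pr\<^sub>x\<close> are jointly injective. So
  \<open>z\<close>-relatedness may be tested after \<open>T (q x)\<close> and \<open>q x\<close>. There it is the \<open>\<Phi> x\<close>-relatedness of
  the given families, since \<open>q x \<circ> U z\<^sub>s\<^sub>t = U (\<Phi> x)\<^sub>s\<^sub>t \<circ> q (\<phi> x)\<close> by the definition of a morphism
  of networks and \<open>T\<close> is a functor.
\<close>

section \<open>Differential calculus in \<open>\<real>\<^sup>n\<close>\<close>

text \<open>Since \<open>tangent_map\<close> is built from \<open>jacobian\<close>, whose partial
  derivatives are taken within chart images that may have corners, functoriality of T is itself a
  theorem of calculus. The way through is that a chart image is open in a quadrant, so increasing a
  coordinate slightly never leaves it: \<open>part_deriv\<close> then equals a right-hand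
  derivative, which can be computed from any local smooth extension and forgets its domain. The
  chain rule is proved for extensions on open sets and carried back.

  Joint injectivity only identifies the image of a family of controls. That this image lies in
  \<open>dCrl\<close> at all requires smoothness into a tangent bundle whose topology is generated
  by charts, the right base points, and for each jump an edge of \<open>st a\<close>; the edge is
  the image of the tuple of the given edges under the functor inverse to \<open>mst i\<close>. The
  inverses in \<open>dCrl_pullback\<close> and \<open>dCrl_prod\<close> are set-theoretic
  \<open>inv_into\<close>s, for which explicit smooth inverses are substituted. The one for
  \<open>canon X\<close> has to be examined in charts, as no universal property yields a map out of
  a product of coproducts.\<close>

abbreviation coordinate_space ("\<E>") where
  "\<E> \<equiv> Euclidean_space"

section \<open>Boxes, coordinate lines and the chain rule along a curve\<close>

text \<open>A basic open set of the ambient product is a product of open sets, and the coordinates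
  from \<open>n\<close> on are zero for all points concerned; so the first \<open>n\<close> radii
  decide membership, and finitely many of them have a positive minimum. The continuity estimates
  below are phrased through these boxes.\<close>

lemma openin_Euclidean_space_iff_box:
  "openin (\<E> n) W \<longleftrightarrow>
     W \<subseteq> topspace (\<E> n) \<and>
     (\<forall>x\<in>W. \<exists>e>0. \<forall>y\<in>topspace (\<E> n). (\<forall>j<n. \<bar>y j - x j\<bar> < e) \<longrightarrow> y \<in> W)"
  (is "_ \<longleftrightarrow> _ \<and> ?box W")
proof (intro iffI conjI)
  assume W: "openin (\<E> n) W"
  then show sub: "W \<subseteq> topspace (\<E> n)"
    by (rule openin_subset)
  show "?box W"
  proof
    fix x assume x: "x \<in> W"
    obtain U where U: "openin (powertop_real UNIV) U" "W = U \<inter> {x. \<forall>i\<ge>n. x i = 0}"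
      using W by (auto simp: Euclidean_space_def openin_subtopology)
    obtain V where V: "\<And>i. open (V i)" "x \<in> Pi\<^sub>E UNIV V" "Pi\<^sub>E UNIV V \<subseteq> U"
      using U(1) x unfolding openin_product_topology_alt U(2) by (auto; meson UNIV_I)
    have "\<exists>e>0. ball (x j) e \<subseteq> V j" for j
      using V(1)[of j] V(2) by (metis PiE_mem UNIV_I open_contains_ball)
    then obtain e where e: "\<And>j. 0 < e j" "\<And>j. ball (x j) (e j) \<subseteq> V j"
      by metis
    \<comment> \<open>The inserted 1 keeps the minimum defined for \<open>n = 0\<close>.\<close>
    define d where "d = Min (insert 1 (e ` {..<n}))"
    have d: "0 < d" "\<And>j. j < n \<Longrightarrow> d \<le> e j"
      using e(1) by (auto simp: d_def)
    show "\<exists>e>0. \<forall>y\<in>topspace (\<E> n). (\<forall>j<n. \<bar>y j - x j\<bar> < e) \<longrightarrow> y \<in> W"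
    proof (intro exI[of _ d] conjI ballI impI)
      show "0 < d" by (rule d)
      fix y assume y: "y \<in> topspace (\<E> n)" "\<forall>j<n. \<bar>y j - x j\<bar> < d"
      have "y j \<in> V j" for j
      proof (cases "j < n")
        case True
        then have "y j \<in> ball (x j) (e j)"
          using y(2) d(2)[of j] by (force simp: dist_real_def)
        then show ?thesis using e(2) by blast
      next
        case False
        then have "y j = x j"
          using y(1) x sub by (force simp: topspace_Euclidean_space)
        then show ?thesis using V(2) by auto
      qed
      then have "y \<in> U" using V(3) by auto
      then show "y \<in> W" using U(2) y(1) by (simp add: topspace_Euclidean_space)
    qed
  qed
next
  assume *: "W \<subseteq> topspace (\<E> n) \<and> ?box W"
  show "openin (\<E> n) W"
  proof (subst openin_subopen, intro ballI)
    fix x assume x: "x \<in> W"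
    then obtain e where e: "e > 0"
      "\<And>y. y \<in> topspace (\<E> n) \<Longrightarrow> (\<forall>j<n. \<bar>y j - x j\<bar> < e) \<Longrightarrow> y \<in> W"
      using * by blast
    define U where "U = Pi\<^sub>E UNIV (\<lambda>j. if j < n then ball (x j) e else UNIV)"
    have "finite {j. (if j < n then ball (x j) e else UNIV) \<noteq> UNIV}"
      by (rule finite_subset[of _ "{..<n}"]) auto
    then have "openin (powertop_real UNIV) U"
      unfolding U_def by (subst openin_PiE_gen) (auto simp: if_distrib)
    then have "openin (\<E> n) (U \<inter> {x. \<forall>i\<ge>n. x i = 0})"
      by (auto simp: Euclidean_space_def openin_subtopology)
    moreover have "x \<in> U \<inter> {x. \<forall>i\<ge>n. x i = 0}"
      using x * e(1) by (auto simp: U_def topspace_Euclidean_space)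
    moreover have "U \<inter> {x. \<forall>i\<ge>n. x i = 0} \<subseteq> W"
    proof
      fix y assume y: "y \<in> U \<inter> {x. \<forall>i\<ge>n. x i = 0}"
      show "y \<in> W"
      proof (rule e(2))
        show "y \<in> topspace (\<E> n)" using y by (simp add: topspace_Euclidean_space)
        show "\<forall>j<n. \<bar>y j - x j\<bar> < e"
        proof (intro allI impI)
          fix j assume "j < n"
          moreover have "y j \<in> (if j < n then ball (x j) e else UNIV)"
            using y PiE_mem[of y UNIV _ j] unfolding U_def by blast
          ultimately have "y j \<in> ball (x j) e" by simp
          then show "\<bar>y j - x j\<bar> < e" by (auto simp: dist_real_def abs_minus_commute)
        qed
      qed
    qed
    ultimately show "\<exists>T. openin (\<E> n) T \<and> x \<in> T \<and> T \<subseteq> W" by blast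
  qed
qed

lemma continuous_map_Euclidean_box:
  assumes W: "openin (\<E> n) W"
    and g: "continuous_map (subtopology (\<E> n) W) euclideanreal g"
    and x: "x \<in> W" and e: "e > 0"
  shows "\<exists>d>0. \<forall>y\<in>topspace (\<E> n). (\<forall>j<n. \<bar>y j - x j\<bar> < d) \<longrightarrow> y \<in> W \<and> \<bar>g y - g x\<bar> < e"
proof -
  let ?P = "{y \<in> topspace (subtopology (\<E> n) W). g y \<in> ball (g x) e}"
  have "openin (subtopology (\<E> n) W) ?P"
    by (rule openin_continuous_map_preimage[OF g]) simp
  then have "openin (\<E> n) ?P"
    using W openin_trans_full by blast
  moreover have "x \<in> ?P"
    using x e openin_subset[OF W] by (auto simp: topspace_Euclidean_space)
  ultimately obtain d where "d > 0"
    "\<And>y. y\<in>topspace (\<E> n) \<Longrightarrow> (\<forall>j<n. \<bar>y j - x j\<bar> < d) \<Longrightarrow> y \<in> ?P"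
    unfolding openin_Euclidean_space_iff_box by blast
  then show ?thesis
    by (intro exI[of _ d]) (auto simp: dist_real_def abs_minus_commute)
qed

text \<open>It turns the relative filter in \<open>part_deriv\<close> into the full
  \<open>at\<close> when the domain is open.\<close>

lemma open_coordinate_line:
  assumes W: "openin (\<E> n) W" and "i < n"
  shows "open {t. x(i := t) \<in> W}"
  unfolding open_dist
proof safe
  fix t assume t: "x(i := t) \<in> W"
  then obtain e where e: "e > 0"
    "\<And>y. y\<in>topspace (\<E> n) \<Longrightarrow> (\<forall>j<n. \<bar>y j - (x(i := t)) j\<bar> < e) \<Longrightarrow> y \<in> W"
    using W unfolding openin_Euclidean_space_iff_box by blast
  have "x(i := s) \<in> W" if "dist s t < e" for s
  proof (rule e(2))
    show "x(i := s) \<in> topspace (\<E> n)"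
      using t openin_subset[OF W] \<open>i < n\<close> by (auto simp: topspace_Euclidean_space)
    show "\<forall>j<n. \<bar>(x(i := s)) j - (x(i := t)) j\<bar> < e"
      using that e(1) by (auto simp: dist_real_def)
  qed
  then show "\<exists>e>0. \<forall>y. dist y t < e \<longrightarrow> y \<in> {t. x(i := t) \<in> W}"
    using e(1) by blast
qed

text \<open>One-sided derivatives do not depend on the subset of a quadrant that they are taken in.\<close>

definition right_deriv :: "nat \<Rightarrow> ((nat \<Rightarrow> real) \<Rightarrow> real) \<Rightarrow> (nat \<Rightarrow> real) \<Rightarrow> real" where
  "right_deriv i f x = vector_derivative (\<lambda>t. f (x(i := t))) (at_right (x i))"

text \<open>\<open>T\<close> may be any parameter set containing a short segment to the right, and
  \<open>f\<close> and \<open>g\<close> have to agree only on that segment. This is the passage from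
  a smooth extension \<open>f\<close> to the function \<open>g\<close> that it extends.\<close>

lemma right_derivI:
  assumes D: "((\<lambda>t. f (x(i := t))) has_real_derivative D) (at (x i) within T)"
    and "e > 0" and T: "\<And>t. x i \<le> t \<Longrightarrow> t < x i + e \<Longrightarrow> t \<in> T \<and> g (x(i := t)) = f (x(i := t))"
  shows "((\<lambda>t. g (x(i := t))) has_real_derivative D) (at_right (x i))"
    and "right_deriv i g x = D"
proof -
  have "((\<lambda>t. f (x(i := t))) has_real_derivative D) (at (x i) within {x i..<x i + e})"
    by (rule DERIV_subset[OF D]) (use T in auto)
  then have "((\<lambda>t. g (x(i := t))) has_real_derivative D) (at (x i) within {x i..<x i + e})"
    using T \<open>e > 0\<close> by (elim has_field_derivative_transform_within[where d=1]) (auto simp del: fun_upd_apply)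
  then have "((\<lambda>t. g (x(i := t))) has_real_derivative D) (at (x i) within {x i<..<x i + e})"
    by (rule DERIV_subset) auto
  moreover have "at (x i) within {x i<..<x i + e} = at_right (x i)"
    by (rule at_within_nhd[of _ "{x i - 1<..<x i + e}"]) (use \<open>e > 0\<close> in auto)
  ultimately show *: "((\<lambda>t. g (x(i := t))) has_real_derivative D) (at_right (x i))"
    by simp
  show "right_deriv i g x = D"
    unfolding right_deriv_def
    by (rule vector_derivative_within)
      (use * in \<open>auto simp: has_real_derivative_iff_has_vector_derivative trivial_limit_at_right_real\<close>)
qed

lemma right_deriv_open:
  assumes W: "openin (\<E> n) W" and x: "x \<in> W" and i: "i < n"
    and D: "((\<lambda>t. f (x(i := t))) has_real_derivative D) (at (x i))"
  shows "right_deriv i f x = D"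
  by (rule right_derivI(2)[where f=f and e=1, OF D]) simp_all

lemma part_deriv_open:
  assumes W: "openin (\<E> n) W" and x: "x \<in> W" and i: "i < n"
    and D: "(\<lambda>t. f (x(i := t))) differentiable (at (x i))"
  shows "part_deriv W i f x = right_deriv i f x"
proof -
  have at: "at (x i) within {t. x(i := t) \<in> W} = at (x i)"
    by (rule at_within_open[OF _ open_coordinate_line[OF W i]]) (use x in simp)
  obtain D where D: "((\<lambda>t. f (x(i := t))) has_real_derivative D) (at (x i))"
    using D by (meson real_differentiable_def)
  then have "part_deriv W i f x = D"
    unfolding part_deriv_def at
    by (simp add: has_real_derivative_iff_has_vector_derivative vector_derivative_at)
  with right_deriv_open[OF W x i D] show ?thesis by simp
qed

text \<open>The increment along \<open>\<gamma>\<close> is telescoped over the coordinates, with the mean value theorem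
  applied in each; only the partial derivatives need to be continuous.\<close>

lemma chain_rule_curve:
  assumes W: "openin (\<E> m) W"
    and diff: "\<And>j y. j < m \<Longrightarrow> y \<in> W \<Longrightarrow> (\<lambda>t. g (y(j := t))) differentiable (at (y j))"
    and cont: "\<And>j. j < m \<Longrightarrow> continuous_map (subtopology (\<E> m) W) euclideanreal (right_deriv j g)"
    and \<gamma>: "\<gamma> t0 \<in> W" "\<And>t. t \<in> T \<Longrightarrow> \<gamma> t \<in> topspace (\<E> m)"
    and \<gamma>': "\<And>j. j < m \<Longrightarrow> ((\<lambda>t. \<gamma> t j) has_real_derivative \<gamma>' j) (at t0 within T)"
  shows "((\<lambda>t. g (\<gamma> t)) has_real_derivative (\<Sum>j<m. right_deriv j g (\<gamma> t0) * \<gamma>' j)) (at t0 within T)"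
proof -
  \<comment> \<open>The first \<open>k\<close> coordinates have already moved to
    \<open>\<gamma> t\<close>, the others still sit at \<open>\<gamma> t0\<close>; consecutive
    points differ in coordinate \<open>k\<close> alone.\<close>
  define H where "H k t = (\<lambda>j. if j < k then \<gamma> t j else \<gamma> t0 j)" for k t
  have E0: "\<gamma> t0 \<in> topspace (\<E> m)"
    using \<gamma>(1) openin_subset[OF W] by blast
  have HE: "H k t \<in> topspace (\<E> m)" if "t \<in> T" for k t
    using that \<gamma>(2) E0 by (auto simp: H_def topspace_Euclidean_space)
  have H0: "H k t0 = \<gamma> t0" for k by (auto simp: H_def)
  have near: "\<forall>\<^sub>F t in at t0 within T. \<forall>j<m. \<bar>\<gamma> t j - \<gamma> t0 j\<bar> < e" if "e > 0" for e
  proof -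
    have "\<forall>\<^sub>F t in at t0 within T. \<bar>\<gamma> t j - \<gamma> t0 j\<bar> < e" if "j < m" for j
    proof -
      have "((\<lambda>t. \<gamma> t j) \<longlongrightarrow> \<gamma> t0 j) (at t0 within T)"
        using DERIV_continuous[OF \<gamma>'[OF that]] by (simp add: continuous_within)
      from tendstoD[OF this \<open>e > 0\<close>] show ?thesis by (simp add: dist_real_def)
    qed
    then have "\<forall>\<^sub>F t in at t0 within T. \<forall>j\<in>{..<m}. \<bar>\<gamma> t j - \<gamma> t0 j\<bar> < e"
      by (intro eventually_ball_finite) auto
    then show ?thesis by (simp add: Ball_def)
  qed
  have step: "((\<lambda>t. g (H (Suc k) t) - g (H k t)) has_real_derivative right_deriv k g (\<gamma> t0) * \<gamma>' k) (at t0 within T)"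
    if k: "k < m" for k
  proof -
    \<comment> \<open>\<open>\<theta>\<close> is the slope of the \<open>k\<close>-th increment as a
      mean value: the partial derivative at some \<open>y\<close> that is, in each coordinate, no
      farther from \<open>\<gamma> t0\<close> than \<open>\<gamma> t\<close> is. Writing a product
      and not a quotient also covers parameters at which coordinate \<open>k\<close> does not
      move.\<close>
    define P where "P t \<theta> \<longleftrightarrow> (\<exists>y\<in>W. \<theta> = right_deriv k g y \<and> (\<forall>j<m. \<bar>y j - \<gamma> t0 j\<bar> \<le> \<bar>\<gamma> t j - \<gamma> t0 j\<bar>))
       \<and> g (H (Suc k) t) - g (H k t) = \<theta> * (\<gamma> t k - \<gamma> t0 k)" for t \<theta>
    obtain e where e: "e > 0" "\<And>y. y\<in>topspace (\<E> m) \<Longrightarrow> (\<forall>j<m. \<bar>y j - \<gamma> t0 j\<bar> < e) \<Longrightarrow> y \<in> W"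
      using W \<gamma>(1) unfolding openin_Euclidean_space_iff_box by blast
    have ex: "\<exists>\<theta>. P t \<theta>" if t: "t \<in> T" "\<forall>j<m. \<bar>\<gamma> t j - \<gamma> t0 j\<bar> < e" for t
    proof -
      let ?y = "\<lambda>s. (H k t)(k := s)"
      have y_k: "?y (\<gamma> t0 k) = H k t" "?y (\<gamma> t k) = H (Suc k) t"
        by (auto simp: H_def less_Suc_eq)
      have yE: "?y s \<in> topspace (\<E> m)" for s
        using HE[OF t(1), of k] k by (auto simp: topspace_Euclidean_space)
      have close: "\<bar>?y s j - \<gamma> t0 j\<bar> \<le> \<bar>\<gamma> t j - \<gamma> t0 j\<bar>"
        if "min (\<gamma> t0 k) (\<gamma> t k) \<le> s" "s \<le> max (\<gamma> t0 k) (\<gamma> t k)" for s j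
        using that by (auto simp: H_def)
      have yW: "?y s \<in> W" if "min (\<gamma> t0 k) (\<gamma> t k) \<le> s" "s \<le> max (\<gamma> t0 k) (\<gamma> t k)" for s
        using e(2)[OF yE] close[OF that] t(2) by (meson le_less_trans)
      have der: "((\<lambda>s. g (?y s)) has_real_derivative right_deriv k g (?y s)) (at s)"
        if s: "min (\<gamma> t0 k) (\<gamma> t k) \<le> s" "s \<le> max (\<gamma> t0 k) (\<gamma> t k)" for s
      proof -
        obtain D where D: "((\<lambda>u. g ((?y s)(k := u))) has_real_derivative D) (at ((?y s) k))"
          using diff[OF k yW[OF s]] by (meson real_differentiable_def)
        have "right_deriv k g (?y s) = D"
          by (rule right_deriv_open[where f=g, OF W yW[OF s] k D])
        then show ?thesis using D by (simp del: fun_upd_apply add: fun_upd_same)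
      qed
      consider "\<gamma> t k = \<gamma> t0 k" | "\<gamma> t0 k < \<gamma> t k" | "\<gamma> t k < \<gamma> t0 k" by linarith
      then show ?thesis
      proof cases
        case 1
        then have "P t (right_deriv k g (?y (\<gamma> t k)))"
          unfolding P_def using yW[of "\<gamma> t k"] close[of "\<gamma> t k"] y_k by (metis diff_self max.cobounded2 min.cobounded2 mult_zero_right)
        then show ?thesis by blast
      next
        case 2
        obtain s where s: "\<gamma> t0 k < s" "s < \<gamma> t k"
          "g (?y (\<gamma> t k)) - g (?y (\<gamma> t0 k)) = (\<gamma> t k - \<gamma> t0 k) * right_deriv k g (?y s)"
          using MVT2[OF 2, of "\<lambda>s. g (?y s)" "\<lambda>s. right_deriv k g (?y s)"] der 2 by auto
        then have "P t (right_deriv k g (?y s))"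
          unfolding P_def using yW[of s] close[of s] y_k 2 by (auto simp: mult.commute)
        then show ?thesis by blast
      next
        case 3
        obtain s where s: "\<gamma> t k < s" "s < \<gamma> t0 k"
          "g (?y (\<gamma> t0 k)) - g (?y (\<gamma> t k)) = (\<gamma> t0 k - \<gamma> t k) * right_deriv k g (?y s)"
          using MVT2[OF 3, of "\<lambda>s. g (?y s)" "\<lambda>s. right_deriv k g (?y s)"] der 3 by auto
        have "g (H (Suc k) t) - g (H k t) = right_deriv k g (?y s) * (\<gamma> t k - \<gamma> t0 k)"
          using s(3) unfolding y_k by (simp add: algebra_simps)
        then have "P t (right_deriv k g (?y s))"
          unfolding P_def using s(1,2) yW[of s] close[of s] by (auto simp: y_k)
        then show ?thesis by blast
      qed
    qed
    \<comment> \<open>The slope is chosen for each \<open>t\<close> without any regularity; its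
      limit comes from the bound on \<open>y\<close> and the continuity of
      \<open>right_deriv k g\<close>.\<close>
    define \<theta> where "\<theta> t = (SOME \<theta>. P t \<theta>)" for t
    have P\<theta>: "P t (\<theta> t)" if "t \<in> T" "\<forall>j<m. \<bar>\<gamma> t j - \<gamma> t0 j\<bar> < e" for t
      unfolding \<theta>_def by (rule someI_ex[OF ex[OF that]])
    have \<theta>: "\<forall>\<^sub>F t in at t0 within T. P t (\<theta> t)"
    proof -
      have "\<forall>\<^sub>F t in at t0 within T. t \<in> T \<and> (\<forall>j<m. \<bar>\<gamma> t j - \<gamma> t0 j\<bar> < e)"
        using near[OF e(1)] by (auto simp: eventually_at_filter elim: eventually_mono)
      then show ?thesis
        by (rule eventually_mono) (use P\<theta> in blast)
    qed
    have lim: "(\<theta> \<longlongrightarrow> right_deriv k g (\<gamma> t0)) (at t0 within T)"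
    proof (rule tendstoI)
      fix r :: real assume "r > 0"
      then obtain d where d: "d > 0" "\<And>y. y\<in>topspace (\<E> m) \<Longrightarrow> (\<forall>j<m. \<bar>y j - \<gamma> t0 j\<bar> < d)
          \<Longrightarrow> \<bar>right_deriv k g y - right_deriv k g (\<gamma> t0)\<bar> < r"
        using continuous_map_Euclidean_box[OF W cont[OF k] \<gamma>(1)] by meson
      show "\<forall>\<^sub>F t in at t0 within T. dist (\<theta> t) (right_deriv k g (\<gamma> t0)) < r"
        using \<theta> near[OF d(1)]
      proof eventually_elim
        case (elim t)
        then obtain y where y: "y \<in> W" "\<theta> t = right_deriv k g y" "\<And>j. j < m \<Longrightarrow> \<bar>y j - \<gamma> t0 j\<bar> \<le> \<bar>\<gamma> t j - \<gamma> t0 j\<bar>"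
          unfolding P_def by blast
        have "\<forall>j<m. \<bar>y j - \<gamma> t0 j\<bar> < d"
          using y(3) elim(2) by (meson le_less_trans)
        with d(2)[of y] y(1,2) openin_subset[OF W] show ?case
          by (auto simp: dist_real_def)
      qed
    qed
    have "((\<lambda>t. (\<gamma> t k - \<gamma> t0 k) / (t - t0)) \<longlongrightarrow> \<gamma>' k) (at t0 within T)"
      using \<gamma>'[OF k] by (simp add: has_field_derivative_iff)
    then have "((\<lambda>t. \<theta> t * ((\<gamma> t k - \<gamma> t0 k) / (t - t0))) \<longlongrightarrow> right_deriv k g (\<gamma> t0) * \<gamma>' k) (at t0 within T)"
      by (rule tendsto_mult[OF lim])
    \<comment> \<open>At \<open>t0\<close> all points \<open>H k t0\<close> coincide, so the
      subtracted difference is zero.\<close>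
    then have "((\<lambda>t. ((g (H (Suc k) t) - g (H k t)) - (g (H (Suc k) t0) - g (H k t0))) / (t - t0))
        \<longlongrightarrow> right_deriv k g (\<gamma> t0) * \<gamma>' k) (at t0 within T)"
      by (rule Lim_transform_eventually) (use \<theta> in \<open>auto simp: P_def H0 elim: eventually_mono\<close>)
    then show ?thesis by (simp add: has_field_derivative_iff)
  qed
  have tele: "(\<Sum>k<m. g (H (Suc k) t) - g (H k t)) = g (H m t) - g (H 0 t)" for t
    by (rule sum_lessThan_telescope)
  have "((\<lambda>t. (\<Sum>k<m. g (H (Suc k) t) - g (H k t)) + g (\<gamma> t0)) has_real_derivative
      (\<Sum>k<m. right_deriv k g (\<gamma> t0) * \<gamma>' k) + 0) (at t0 within T)"
    by (intro DERIV_add DERIV_const DERIV_sum step) auto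
  moreover have "H 0 t = \<gamma> t0" for t by (auto simp: H_def)
  ultimately have *: "((\<lambda>t. g (H m t)) has_real_derivative (\<Sum>k<m. right_deriv k g (\<gamma> t0) * \<gamma>' k)) (at t0 within T)"
    by (simp add: tele)
  have "g (H m t) = g (\<gamma> t)" if "t \<in> T \<or> t = t0" for t
  proof -
    have "H m t = \<gamma> t"
      using that \<gamma>(2) E0 by (fastforce simp: H_def topspace_Euclidean_space)
    then show ?thesis by simp
  qed
  then show ?thesis
    using * by (subst has_field_derivative_cong_eventually[where g="\<lambda>t. g (H m t)"])
      (auto simp: eventually_at_filter)
qed

section \<open>Closure properties of C^k functions on open sets\<close>

lemma continuous_map_cong_on:
  assumes "\<And>x. x \<in> topspace T \<Longrightarrow> f x = g x"
  shows "continuous_map T T' f \<longleftrightarrow> continuous_map T T' g"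
  using assms continuous_map_eq[of T T' f g] continuous_map_eq[of T T' g f] by auto

text \<open>Derivatives within \<open>W\<close> see only values on \<open>W\<close>; so in the
  recursion a \<open>part_deriv\<close> may be exchanged for any formula that computes it on
  \<open>W\<close>.\<close>

lemma Ck_on_cong:
  assumes "\<And>x. x \<in> W \<Longrightarrow> f x = g x"
  shows "Ck_on k n W f \<longleftrightarrow> Ck_on k n W g"
  using assms
proof (induction k arbitrary: f g)
  case 0
  then show ?case unfolding Ck_on.simps by (intro continuous_map_cong_on) auto
next
  case (Suc k)
  have vd: "((\<lambda>t. f (x(i := t))) has_vector_derivative D) (at (x i) within {t. x(i := t) \<in> W}) \<longleftrightarrow>
      ((\<lambda>t. g (x(i := t))) has_vector_derivative D) (at (x i) within {t. x(i := t) \<in> W})"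
    if "x \<in> W" for x i D
    using that Suc.prems by (intro has_vector_derivative_cong_ev) (auto simp del: fun_upd_apply intro!: always_eventually)
  then have "part_deriv W i f x = part_deriv W i g x" if "x \<in> W" for x i
    using that by (simp add: part_deriv_def vector_derivative_def)
  then have "Ck_on k n W (part_deriv W i f) \<longleftrightarrow> Ck_on k n W (part_deriv W i g)" for i
    by (intro Suc.IH) auto
  moreover have "continuous_map (subtopology (\<E> n) W) euclideanreal f \<longleftrightarrow>
     continuous_map (subtopology (\<E> n) W) euclideanreal g"
    using Suc.prems by (intro continuous_map_cong_on) auto
  moreover have "(\<lambda>t. f (x(i := t))) differentiable (at (x i) within {t. x(i := t) \<in> W}) \<longleftrightarrow>
     (\<lambda>t. g (x(i := t))) differentiable (at (x i) within {t. x(i := t) \<in> W})" if "x \<in> W" for x i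
    using vd[OF that] by (metis real_differentiable_def has_real_derivative_iff_has_vector_derivative)
  ultimately show ?case by auto
qed

text \<open>For open \<open>W\<close> the recursion can be read with two-sided differentiability and
  with \<open>right_deriv\<close>, which does not mention \<open>W\<close>. Restriction to smaller
  open sets then becomes an easy induction.\<close>

lemma Ck_on_Suc_iff:
  assumes W: "openin (\<E> n) W"
  shows "Ck_on (Suc k) n W f \<longleftrightarrow>
     continuous_map (subtopology (\<E> n) W) euclideanreal f \<and>
     (\<forall>i<n. (\<forall>x\<in>W. (\<lambda>t. f (x(i := t))) differentiable (at (x i))) \<and> Ck_on k n W (right_deriv i f))"
proof -
  have "at (x i) within {t. x(i := t) \<in> W} = at (x i)" if "x \<in> W" "i < n" for x i
    by (rule at_within_open[OF _ open_coordinate_line[OF W \<open>i < n\<close>]]) (use that in simp)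
  moreover have "Ck_on k n W (part_deriv W i f) \<longleftrightarrow> Ck_on k n W (right_deriv i f)"
    if "\<forall>x\<in>W. (\<lambda>t. f (x(i := t))) differentiable (at (x i))" "i < n" for i
    using that part_deriv_open[OF W] by (intro Ck_on_cong) auto
  ultimately show ?thesis by auto
qed

lemma Ck_on_continuous: "Ck_on k n W f \<Longrightarrow> continuous_map (subtopology (\<E> n) W) euclideanreal f"
  by (cases k) auto

lemma Ck_on_Suc_imp:
  assumes W: "openin (\<E> n) W" and "Ck_on (Suc k) n W f"
  shows "Ck_on k n W f"
  using assms(2)
proof (induction k arbitrary: f)
  case (Suc k)
  from Suc.prems show ?case
    unfolding Ck_on_Suc_iff[OF W, of "Suc k" f] Ck_on_Suc_iff[OF W, of k f] using Suc.IH by meson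
qed simp

lemma Ck_on_subset:
  assumes "openin (\<E> n) W" "openin (\<E> n) W'" "W' \<subseteq> W" "Ck_on k n W f"
  shows "Ck_on k n W' f"
  using assms(4)
proof (induction k arbitrary: f)
  case 0
  then show ?case using \<open>W' \<subseteq> W\<close> continuous_map_from_subtopology_mono by auto
next
  case (Suc k)
  then show ?case
    using \<open>W' \<subseteq> W\<close> continuous_map_from_subtopology_mono
    unfolding Ck_on_Suc_iff[OF assms(1)] Ck_on_Suc_iff[OF assms(2)] by blast
qed

lemma Ck_on_const:
  assumes W: "openin (\<E> n) W"
  shows "Ck_on k n W (\<lambda>_. c)"
proof (induction k arbitrary: c)
  case (Suc k)
  have "right_deriv i (\<lambda>_. c) = (\<lambda>_. 0)" for i
    by (auto simp: right_deriv_def fun_eq_iff intro!: vector_derivative_within)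
  then show ?case
    unfolding Ck_on_Suc_iff[OF W] using Suc.IH by simp
qed simp

lemma continuous_map_coordinate: "continuous_map (\<E> n) euclideanreal (\<lambda>y. y j)"
  unfolding Euclidean_space_def
  by (intro continuous_map_from_subtopology continuous_map_product_coordinates) simp

lemma right_deriv_coordinate: "right_deriv i (\<lambda>y. y j) x = (if i = j then 1 else 0)"
proof (rule right_derivI(2)[where e=1 and T=UNIV])
  show "((\<lambda>t. (x(i := t)) j) has_real_derivative (if i = j then 1 else 0)) (at (x i) within UNIV)"
    by (auto intro!: derivative_eq_intros)
qed auto

lemma Ck_on_coordinate:
  assumes W: "openin (\<E> n) W"
  shows "Ck_on k n W (\<lambda>y. y j)"
proof (cases k)
  case 0
  then show ?thesis by (simp add: continuous_map_coordinate continuous_map_from_subtopology)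
next
  case (Suc k')
  have "right_deriv i (\<lambda>y. y j) = (\<lambda>_. if i = j then 1 else 0)" for i
    by (simp add: right_deriv_coordinate fun_eq_iff)
  moreover have "(\<lambda>t. (x(i := t)) j) differentiable at (x i)" for x i
    by (cases "i = j") auto
  moreover have "continuous_map (subtopology (\<E> n) W) euclideanreal (\<lambda>y. y j)"
    by (simp add: continuous_map_coordinate continuous_map_from_subtopology)
  ultimately show ?thesis
    unfolding Suc Ck_on_Suc_iff[OF W] using Ck_on_const[OF W] by metis
qed

lemma Ck_on_right_deriv:
  assumes W: "openin (\<E> n) W" and f: "Ck_on (Suc k) n W f" and x: "x \<in> W" and i: "i < n"
  shows "((\<lambda>t. f (x(i := t))) has_real_derivative right_deriv i f x) (at (x i))"
proof -
  obtain D where D: "((\<lambda>t. f (x(i := t))) has_real_derivative D) (at (x i))"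
    using f x i unfolding Ck_on_Suc_iff[OF W] by (meson real_differentiable_def)
  with right_deriv_open[OF W x i D] show ?thesis by simp
qed

text \<open>Introduction rule for the closure proofs: \<open>f'\<close> is the formula delivered by
  a differentiation rule, and it has to agree with \<open>right_deriv\<close> on \<open>W\<close>
  only.\<close>

lemma Ck_on_SucI:
  assumes W: "openin (\<E> n) W"
    and "continuous_map (subtopology (\<E> n) W) euclideanreal f"
    and der: "\<And>i x. i < n \<Longrightarrow> x \<in> W \<Longrightarrow> ((\<lambda>t. f (x(i := t))) has_real_derivative f' i x) (at (x i))"
    and "\<And>i. i < n \<Longrightarrow> Ck_on k n W (f' i)"
  shows "Ck_on (Suc k) n W f"
proof -
  have "Ck_on k n W (right_deriv i f)" if "i < n" for i
    using assms(4)[OF that] Ck_on_cong[of W "right_deriv i f" "f' i" k n] right_deriv_open[OF W _ that der] that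
    by auto
  moreover have "(\<lambda>t. f (x(i := t))) differentiable (at (x i))" if "i < n" "x \<in> W" for i x
    using der[OF that] by (meson real_differentiable_def)
  ultimately show ?thesis
    unfolding Ck_on_Suc_iff[OF W] using assms(2) by blast
qed

lemma Ck_on_add:
  assumes W: "openin (\<E> n) W" and "Ck_on k n W f" "Ck_on k n W g"
  shows "Ck_on k n W (\<lambda>x. f x + g x)"
  using assms(2,3)
proof (induction k arbitrary: f g)
  case 0
  then show ?case by (auto intro: continuous_map_add)
next
  case (Suc k)
  show ?case
  proof (rule Ck_on_SucI[OF W])
    show "continuous_map (subtopology (\<E> n) W) euclideanreal (\<lambda>x. f x + g x)"
      using Suc.prems by (intro continuous_map_add Ck_on_continuous)
    show "((\<lambda>t. f (x(i := t)) + g (x(i := t))) has_real_derivative right_deriv i f x + right_deriv i g x) (at (x i))"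
      if "i < n" "x \<in> W" for i x
      using that Suc.prems by (intro DERIV_add Ck_on_right_deriv[OF W])
    show "Ck_on k n W (\<lambda>x. right_deriv i f x + right_deriv i g x)" if "i < n" for i
      using that Suc.prems by (intro Suc.IH) (auto simp: Ck_on_Suc_iff[OF W] simp del: Ck_on.simps)
  qed
qed

lemma Ck_on_mult:
  assumes W: "openin (\<E> n) W" and "Ck_on k n W f" "Ck_on k n W g"
  shows "Ck_on k n W (\<lambda>x. f x * g x)"
  using assms(2,3)
proof (induction k arbitrary: f g)
  case 0
  then show ?case by (auto intro: continuous_map_real_mult)
next
  case (Suc k)
  show ?case
  proof (rule Ck_on_SucI[OF W])
    show "continuous_map (subtopology (\<E> n) W) euclideanreal (\<lambda>x. f x * g x)"
      using Suc.prems by (intro continuous_map_real_mult Ck_on_continuous)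
    show "((\<lambda>t. f (x(i := t)) * g (x(i := t))) has_real_derivative right_deriv i f x * g x + right_deriv i g x * f x) (at (x i))"
      if "i < n" "x \<in> W" for i x
      using DERIV_mult[OF Ck_on_right_deriv[OF W Suc.prems(1) that(2,1)] Ck_on_right_deriv[OF W Suc.prems(2) that(2,1)]]
      by (simp del: fun_upd_apply)
    show "Ck_on k n W (\<lambda>x. right_deriv i f x * g x + right_deriv i g x * f x)" if "i < n" for i
      using that Suc.prems Suc.prems[THEN Ck_on_Suc_imp[OF W]]
      by (intro Ck_on_add[OF W] Suc.IH) (auto simp: Ck_on_Suc_iff[OF W] simp del: Ck_on.simps)
  qed
qed

lemma Ck_on_sum:
  assumes W: "openin (\<E> n) W" and "\<And>i. i \<in> I \<Longrightarrow> Ck_on k n W (f i)"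
  shows "Ck_on k n W (\<lambda>x. \<Sum>i\<in>I. f i x)"
  using assms(2)
proof (induction I rule: infinite_finite_induct)
  case (insert i I)
  then show ?case by (simp add: Ck_on_add[OF W])
qed (auto simp: Ck_on_const[OF W])

lemma continuous_map_into_Euclidean_space:
  assumes "\<And>x. x \<in> topspace T \<Longrightarrow> f x \<in> topspace (\<E> m)"
    and "\<And>j. j < m \<Longrightarrow> continuous_map T euclideanreal (\<lambda>x. f x j)"
  shows "continuous_map T (\<E> m) f"
proof (rule continuous_map_eq)
  show "continuous_map T (\<E> m) (\<lambda>x i. if i < m then f x i else 0)"
    using assms(2) by (simp add: continuous_map_componentwise_Euclidean_space)
  show "(\<lambda>i. if i < m then f x i else 0) = f x" if "x \<in> topspace T" for x
    using assms(1)[OF that] by (auto simp: topspace_Euclidean_space fun_eq_iff)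
qed

text \<open>The curve is the image under \<open>f\<close> of the coordinate line through
  \<open>x\<close>, which stays in the open set \<open>W\<close> for parameters near
  \<open>x i\<close>.\<close>

lemma chain_rule_open:
  assumes W: "openin (\<E> n) W" and V: "openin (\<E> m) V"
    and f: "f \<in> W \<rightarrow> V" "\<And>j. j < m \<Longrightarrow> Ck_on (Suc k) n W (\<lambda>x. f x j)"
    and g: "Ck_on (Suc k) m V g" and i: "i < n" and x: "x \<in> W"
  shows "((\<lambda>t. g (f (x(i := t)))) has_real_derivative
       (\<Sum>j<m. right_deriv j g (f x) * right_deriv i (\<lambda>x. f x j) x)) (at (x i))"
proof -
  have at: "at (x i) within {t. x(i := t) \<in> W} = at (x i)"
    by (rule at_within_open[OF _ open_coordinate_line[OF W i]]) (use x in simp)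
  have "((\<lambda>t. g (f (x(i := t)))) has_real_derivative
   (\<Sum>j<m. right_deriv j g (f (x(i := x i))) * right_deriv i (\<lambda>x. f x j) x)) (at (x i) within {t. x(i := t) \<in> W})"
  proof (rule chain_rule_curve[OF V])
    show "(\<lambda>t. g (y(j := t))) differentiable at (y j)" if "j < m" "y \<in> V" for j y
      using g that unfolding Ck_on_Suc_iff[OF V] by blast
    show "continuous_map (subtopology (\<E> m) V) euclideanreal (right_deriv j g)" if "j < m" for j
      using g that unfolding Ck_on_Suc_iff[OF V] by (blast intro: Ck_on_continuous)
    show "f (x(i := x i)) \<in> V" using f(1) x by auto
    show "f (x(i := t)) \<in> topspace (\<E> m)" if "t \<in> {t. x(i := t) \<in> W}" for t
      using that f(1) openin_subset[OF V] by blast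
    show "((\<lambda>t. f (x(i := t)) j) has_real_derivative right_deriv i (\<lambda>x. f x j) x) (at (x i) within {t. x(i := t) \<in> W})"
      if "j < m" for j
      unfolding at by (rule Ck_on_right_deriv[OF W f(2)[OF that] x i])
  qed
  then show ?thesis by (simp add: at)
qed

text \<open>Induction on \<open>k\<close> with \<open>g\<close> arbitrary: by the chain rule the
  partial derivatives of the composite are sums of products, and the factors
  \<open>right_deriv j g\<close> composed with \<open>f\<close> fall under the induction hypothesis
  after \<open>f\<close> has been lowered to class \<open>k\<close>.\<close>

lemma Ck_on_compose:
  assumes W: "openin (\<E> n) W" and V: "openin (\<E> m) V"
    and f: "f \<in> W \<rightarrow> V" "\<And>j. j < m \<Longrightarrow> Ck_on k n W (\<lambda>x. f x j)"
    and "Ck_on k m V g"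
  shows "Ck_on k n W (\<lambda>x. g (f x))"
  using assms(4-)
proof (induction k arbitrary: g)
  case 0
  have "continuous_map (subtopology (\<E> n) W) (\<E> m) f"
    using 0 f(1) openin_subset[OF V] by (intro continuous_map_into_Euclidean_space) (auto simp: Pi_iff)
  then have "continuous_map (subtopology (\<E> n) W) (subtopology (\<E> m) V) f"
    using f(1) by (auto simp: continuous_map_in_subtopology)
  from continuous_map_compose[OF this, of euclideanreal g] 0 show ?case
    by (simp add: o_def)
next
  case (Suc k)
  note IH = Suc.IH[OF Ck_on_Suc_imp[OF W Suc.prems(1)]]
  show ?case
  proof (rule Ck_on_SucI[OF W])
    show "continuous_map (subtopology (\<E> n) W) euclideanreal (\<lambda>x. g (f x))"
      by (rule Ck_on_continuous[OF IH]) (use Suc.prems Ck_on_Suc_imp[OF V] in auto)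
    show "((\<lambda>t. g (f (x(i := t)))) has_real_derivative
       (\<Sum>j<m. right_deriv j g (f x) * right_deriv i (\<lambda>x. f x j) x)) (at (x i))"
      if "i < n" "x \<in> W" for i x
      by (rule chain_rule_open[OF W V f(1) Suc.prems that])
    show "Ck_on k n W (\<lambda>x. \<Sum>j<m. right_deriv j g (f x) * right_deriv i (\<lambda>x. f x j) x)" if "i < n" for i
      using Suc.prems that
      by (intro Ck_on_sum[OF W] Ck_on_mult[OF W] IH)
        (auto simp: Ck_on_Suc_iff[OF W] Ck_on_Suc_iff[OF V] simp del: Ck_on.simps)
  qed
qed

section \<open>Smooth functions on subsets of quadrants\<close>

text \<open>The scalar form of \<open>smooth_on\<close>: extensions are chosen for one coordinate at
  a time and merged again in \<open>smooth_vector_extension\<close>, so that sums, products and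
  composites can be treated coordinatewise.\<close>

definition smooth_fun :: "nat \<Rightarrow> (nat \<Rightarrow> real) set \<Rightarrow> ((nat \<Rightarrow> real) \<Rightarrow> real) \<Rightarrow> bool" where
  "smooth_fun n S f \<longleftrightarrow> S \<subseteq> topspace (\<E> n) \<and>
     (\<forall>x\<in>S. \<exists>W h. openin (\<E> n) W \<and> x \<in> W \<and> (\<forall>k. Ck_on k n W h) \<and> (\<forall>y\<in>W \<inter> S. h y = f y))"

lemma smooth_funD:
  assumes "smooth_fun n S f" "x \<in> S"
  obtains W h where "openin (\<E> n) W" "x \<in> W" "\<And>k. Ck_on k n W h" "\<And>y. y \<in> W \<Longrightarrow> y \<in> S \<Longrightarrow> h y = f y"
proof -
  obtain W h where "openin (\<E> n) W" "x \<in> W" "\<forall>k. Ck_on k n W h" "\<forall>y\<in>W \<inter> S. h y = f y"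
    using assms unfolding smooth_fun_def by blast
  then show ?thesis by (intro that[of W h]) auto
qed

text \<open>The finitely many neighbourhoods of the coordinate extensions are intersected, and the
  entries from \<open>m\<close> on are set to 0 so that the values lie in the coordinate space of
  dimension \<open>m\<close>.\<close>

lemma smooth_vector_extension:
  assumes f: "\<forall>j<m. smooth_fun n S (\<lambda>x. f x j)" "f \<in> S \<rightarrow> topspace (\<E> m)"
    and S: "S \<subseteq> topspace (\<E> n)" and x: "x \<in> S"
  shows "\<exists>W h. openin (\<E> n) W \<and> x \<in> W \<and> h \<in> W \<rightarrow> topspace (\<E> m) \<and>
    (\<forall>j<m. \<forall>k. Ck_on k n W (\<lambda>y. h y j)) \<and> (\<forall>y\<in>W \<inter> S. h y = f y)"
proof -
  let ?P = "\<lambda>j W h. openin (\<E> n) W \<and> x \<in> W \<and> (\<forall>k. Ck_on k n W h) \<and> (\<forall>y\<in>W \<inter> S. h y = f y j)"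
  have "\<forall>j\<in>{..<m}. \<exists>p. ?P j (fst p) (snd p)"
  proof
    fix j assume "j \<in> {..<m}"
    then have "smooth_fun n S (\<lambda>x. f x j)" using f(1) by simp
    then obtain W h where "?P j W h" using x unfolding smooth_fun_def by blast
    then show "\<exists>p. ?P j (fst p) (snd p)" by (intro exI[of _ "(W, h)"]) simp
  qed
  from bchoice[OF this] obtain p where p: "\<forall>j\<in>{..<m}. ?P j (fst (p j)) (snd (p j))" ..
  define W h where "W j = fst (p j)" and "h j = snd (p j)" for j
  have Wh: "\<And>j. j < m \<Longrightarrow> openin (\<E> n) (W j)" "\<And>j. j < m \<Longrightarrow> x \<in> W j"
    "\<And>j k. j < m \<Longrightarrow> Ck_on k n (W j) (h j)" "\<And>j y. j < m \<Longrightarrow> y \<in> W j \<Longrightarrow> y \<in> S \<Longrightarrow> h j y = f y j"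
    using p by (simp_all add: W_def h_def)
  \<comment> \<open>For \<open>m = 0\<close> the intersection is over no sets at all; the first
    factor keeps \<open>V\<close> inside the space.\<close>
  define V where "V = topspace (\<E> n) \<inter> (\<Inter>j\<in>{..<m}. W j)"
  have "openin (\<E> n) ((\<Inter>j\<in>{..<m}. W j) \<inter> topspace (\<E> n))"
    using Wh(1) by (intro openin_INT) auto
  then have V: "openin (\<E> n) V"
    by (simp add: V_def Int_commute)
  show ?thesis
  proof (intro exI[of _ V] exI[of _ "\<lambda>y j. if j < m then h j y else 0"] conjI allI impI ballI V)
    show "x \<in> V" using x S Wh(2) by (auto simp: V_def)
    show "(\<lambda>y j. if j < m then h j y else 0) \<in> V \<rightarrow> topspace (\<E> m)"
      by (auto simp: topspace_Euclidean_space)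
    show "Ck_on k n V (\<lambda>y. if j < m then h j y else 0)" if "j < m" for j k
      using Ck_on_subset[OF Wh(1)[OF that] V _ Wh(3)[OF that]] that by (auto simp: V_def)
    show "(\<lambda>j. if j < m then h j y else 0) = f y" if "y \<in> V \<inter> S" for y
    proof
      fix j
      show "(if j < m then h j y else 0) = f y j"
        using that f(2) Wh(4)[of j y] by (auto simp: V_def topspace_Euclidean_space Pi_iff)
    qed
  qed
qed

lemma smooth_on_iff:
  "smooth_on n m S f \<longleftrightarrow> S \<subseteq> topspace (\<E> n) \<and> f \<in> S \<rightarrow> topspace (\<E> m) \<and>
     (\<forall>j<m. smooth_fun n S (\<lambda>x. f x j))" (is "?L \<longleftrightarrow> ?R")
proof
  assume L: ?L
  show ?R
  proof (intro conjI allI impI)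
    fix j assume j: "j < m"
    show "smooth_fun n S (\<lambda>x. f x j)"
      unfolding smooth_fun_def
    proof (intro conjI ballI)
      show "S \<subseteq> topspace (\<E> n)" using L unfolding smooth_on_def by blast
      fix x assume "x \<in> S"
      then obtain W h where "openin (\<E> n) W" "x \<in> W" "\<forall>j<m. \<forall>k. Ck_on k n W (\<lambda>y. h y j)" "\<forall>y\<in>W \<inter> S. h y = f y"
        using L unfolding smooth_on_def by blast
      then show "\<exists>W h. openin (\<E> n) W \<and> x \<in> W \<and> (\<forall>k. Ck_on k n W h) \<and> (\<forall>y\<in>W \<inter> S. h y = f y j)"
        using j by (intro exI[of _ W] exI[of _ "\<lambda>y. h y j"]) auto
    qed
  qed (use L in \<open>auto simp: smooth_on_def\<close>)
next
  assume R: ?R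
  show ?L
    unfolding smooth_on_def
  proof (intro conjI ballI)
    fix x assume x: "x \<in> S"
    show "\<exists>W h. openin (\<E> n) W \<and> x \<in> W \<and> (\<forall>j<m. \<forall>k. Ck_on k n W (\<lambda>y. h y j)) \<and> (\<forall>y\<in>W \<inter> S. h y = f y)"
      using smooth_vector_extension[of m n S f x] R x by blast
  qed (use R in auto)
qed

lemma smooth_fun_subset:
  assumes "smooth_fun n S f" "S' \<subseteq> S"
  shows "smooth_fun n S' f"
  unfolding smooth_fun_def
proof (intro conjI ballI)
  fix x assume "x \<in> S'"
  then obtain W h where "openin (\<E> n) W" "x \<in> W" "\<And>k. Ck_on k n W h"
    "\<And>y. y \<in> W \<Longrightarrow> y \<in> S \<Longrightarrow> h y = f y"
    using smooth_funD[OF assms(1), of x] assms(2) by blast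
  then show "\<exists>W h. openin (\<E> n) W \<and> x \<in> W \<and> (\<forall>k. Ck_on k n W h) \<and> (\<forall>y\<in>W \<inter> S'. h y = f y)"
    using assms(2) by (intro exI[of _ W] exI[of _ h]) auto
qed (use assms in \<open>auto simp: smooth_fun_def\<close>)

lemma smooth_fun_cong:
  assumes "\<And>x. x \<in> S \<Longrightarrow> f x = g x"
  shows "smooth_fun n S f \<longleftrightarrow> smooth_fun n S g"
proof -
  have "(\<forall>y\<in>W \<inter> S. h y = f y) \<longleftrightarrow> (\<forall>y\<in>W \<inter> S. h y = g y)" for W h
    using assms by auto
  then show ?thesis by (simp only: smooth_fun_def)
qed

lemma smooth_fun_local:
  assumes "S \<subseteq> topspace (\<E> n)"
    and "\<And>x. x \<in> S \<Longrightarrow> \<exists>U. openin (\<E> n) U \<and> x \<in> U \<and> smooth_fun n (S \<inter> U) f"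
  shows "smooth_fun n S f"
  unfolding smooth_fun_def
proof (intro conjI ballI)
  fix x assume x: "x \<in> S"
  obtain U where U: "openin (\<E> n) U" "x \<in> U" "smooth_fun n (S \<inter> U) f"
    using assms(2)[OF x] by blast
  obtain W h where W: "openin (\<E> n) W" "x \<in> W" "\<And>k. Ck_on k n W h"
    "\<And>y. y \<in> W \<Longrightarrow> y \<in> S \<inter> U \<Longrightarrow> h y = f y"
    using smooth_funD[OF U(3), of x] x U(2) by blast
  have "Ck_on k n (W \<inter> U) h" for k
    by (rule Ck_on_subset[OF W(1) _ _ W(3)]) (use W(1) U(1) in auto)
  with W U show "\<exists>W h. openin (\<E> n) W \<and> x \<in> W \<and> (\<forall>k. Ck_on k n W h) \<and> (\<forall>y\<in>W \<inter> S. h y = f y)"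
    by (intro exI[of _ "W \<inter> U"] exI[of _ h]) auto
qed (use assms in auto)

lemma smooth_fun_const: "S \<subseteq> topspace (\<E> n) \<Longrightarrow> smooth_fun n S (\<lambda>_. c)"
  unfolding smooth_fun_def
  by (intro conjI ballI exI[of _ "topspace (\<E> n)"] exI[of _ "\<lambda>_. c"]) (auto intro: Ck_on_const simp del: Ck_on.simps)

lemma smooth_fun_coordinate: "S \<subseteq> topspace (\<E> n) \<Longrightarrow> smooth_fun n S (\<lambda>x. x j)"
  unfolding smooth_fun_def
  by (intro conjI ballI exI[of _ "topspace (\<E> n)"] exI[of _ "\<lambda>x. x j"]) (auto intro: Ck_on_coordinate simp del: Ck_on.simps)

text \<open>The extension \<open>h\<close> of \<open>f\<close> may leave the set \<open>V\<close> on
  which \<open>g\<close> has been extended. Its domain is shrunk to the preimage of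
  \<open>V\<close>, which is open because \<open>h\<close> is continuous.\<close>

lemma smooth_composite_extension:
  assumes f: "\<forall>j<m. smooth_fun n S (\<lambda>x. f x j)" "f \<in> S \<rightarrow> S'" and S: "S \<subseteq> topspace (\<E> n)" "x \<in> S"
    and g: "smooth_fun m S' g"
  obtains U h V l where "openin (\<E> n) U" "x \<in> U" "h \<in> U \<rightarrow> V"
    "\<forall>j<m. \<forall>k. Ck_on k n U (\<lambda>y. h y j)" "\<forall>y\<in>U \<inter> S. h y = f y"
    "openin (\<E> m) V" "f x \<in> V" "\<forall>k. Ck_on k m V l" "\<forall>y\<in>V \<inter> S'. l y = g y"
proof -
  have "S' \<subseteq> topspace (\<E> m)" using g by (simp add: smooth_fun_def)
  then have f2: "f \<in> S \<rightarrow> topspace (\<E> m)" using f(2) by blast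
  obtain W h where W: "openin (\<E> n) W" "x \<in> W" "h \<in> W \<rightarrow> topspace (\<E> m)"
    "\<forall>j<m. \<forall>k. Ck_on k n W (\<lambda>y. h y j)" "\<forall>y\<in>W \<inter> S. h y = f y"
    using smooth_vector_extension[OF f(1) f2 S] by blast
  obtain V l where V: "openin (\<E> m) V" "f x \<in> V" "\<And>k. Ck_on k m V l"
    "\<And>y. y \<in> V \<Longrightarrow> y \<in> S' \<Longrightarrow> l y = g y"
    using smooth_funD[OF g, of "f x"] f(2) S(2) by blast
  define U where "U = {y \<in> W. h y \<in> V}"
  have "continuous_map (subtopology (\<E> n) W) (\<E> m) h"
  proof (rule continuous_map_into_Euclidean_space)
    show "continuous_map (subtopology (\<E> n) W) euclideanreal (\<lambda>y. h y j)" if "j < m" for j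
      using W(4) that Ck_on_continuous[of 0 n W "\<lambda>y. h y j"] by blast
  qed (use W(3) in auto)
  from openin_continuous_map_preimage[OF this V(1)]
  have "openin (subtopology (\<E> n) W) U"
    using openin_subset[OF W(1)] by (simp add: U_def Int_absorb1)
  then have U: "openin (\<E> n) U"
    using W(1) openin_trans_full by blast
  show ?thesis
  proof (rule that[OF U, of h V l])
    show "\<forall>j<m. \<forall>k. Ck_on k n U (\<lambda>y. h y j)"
      using W(4) Ck_on_subset[OF W(1) U] by (auto simp: U_def)
  qed (use W V S(2) in \<open>auto simp: U_def\<close>)
qed

lemma smooth_fun_compose:
  assumes S: "S \<subseteq> topspace (\<E> n)"
    and f: "f \<in> S \<rightarrow> S'" "\<And>j. j < m \<Longrightarrow> smooth_fun n S (\<lambda>x. f x j)"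
    and g: "smooth_fun m S' g"
  shows "smooth_fun n S (\<lambda>x. g (f x))"
  unfolding smooth_fun_def
proof (intro conjI ballI)
  fix x assume x: "x \<in> S"
  have f2: "\<forall>j<m. smooth_fun n S (\<lambda>x. f x j)" using f(2) by blast
  obtain U h V l where U: "openin (\<E> n) U" "x \<in> U" "h \<in> U \<rightarrow> V"
    "\<forall>j<m. \<forall>k. Ck_on k n U (\<lambda>y. h y j)" "\<forall>y\<in>U \<inter> S. h y = f y"
    and V: "openin (\<E> m) V" "f x \<in> V" "\<forall>k. Ck_on k m V l" "\<forall>y\<in>V \<inter> S'. l y = g y"
    by (rule smooth_composite_extension[OF f2 f(1) S x g])
  have "Ck_on k n U (\<lambda>y. l (h y))" for k
    by (rule Ck_on_compose[OF U(1) V(1) U(3)]) (use U(4) V(3) in \<open>simp_all del: Ck_on.simps\<close>)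
  moreover have "\<forall>y\<in>U \<inter> S. l (h y) = g (f y)"
    using U(3,5) V(4) f(1) by (force simp: Pi_iff)
  ultimately show "\<exists>W h. openin (\<E> n) W \<and> x \<in> W \<and> (\<forall>k. Ck_on k n W h) \<and> (\<forall>y\<in>W \<inter> S. h y = g (f y))"
    using U(1,2) by (intro exI[of _ U] exI[of _ "\<lambda>y. l (h y)"]) auto
qed (rule S)

text \<open>Common core of the rules for sums and products: both extensions are restricted to the
  intersection of their domains.\<close>

lemma smooth_fun_binary:
  assumes "smooth_fun n S f" "smooth_fun n S g"
    and Ck: "\<And>k W h l. openin (\<E> n) W \<Longrightarrow> Ck_on k n W h \<Longrightarrow> Ck_on k n W l \<Longrightarrow> Ck_on k n W (\<lambda>x. F (h x) (l x))"
  shows "smooth_fun n S (\<lambda>x. F (f x) (g x))"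
  unfolding smooth_fun_def
proof (intro conjI ballI)
  fix x assume x: "x \<in> S"
  obtain W h where W: "openin (\<E> n) W" "x \<in> W" "\<And>k. Ck_on k n W h" "\<And>y. y \<in> W \<Longrightarrow> y \<in> S \<Longrightarrow> h y = f y"
    using smooth_funD[OF assms(1) x] by blast
  obtain V l where V: "openin (\<E> n) V" "x \<in> V" "\<And>k. Ck_on k n V l" "\<And>y. y \<in> V \<Longrightarrow> y \<in> S \<Longrightarrow> l y = g y"
    using smooth_funD[OF assms(2) x] by blast
  have U: "openin (\<E> n) (W \<inter> V)" using W V by blast
  have "Ck_on k n (W \<inter> V) (\<lambda>y. F (h y) (l y))" for k
    using Ck_on_subset[OF W(1) U _ W(3)] Ck_on_subset[OF V(1) U _ V(3)] by (intro Ck[OF U]) auto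
  then show "\<exists>W h. openin (\<E> n) W \<and> x \<in> W \<and> (\<forall>k. Ck_on k n W h) \<and> (\<forall>y\<in>W \<inter> S. h y = F (f y) (g y))"
    using U W V by (intro exI[of _ "W \<inter> V"] exI[of _ "\<lambda>y. F (h y) (l y)"]) auto
qed (use assms in \<open>simp add: smooth_fun_def\<close>)

lemmas smooth_fun_add = smooth_fun_binary[where F="(+)", OF _ _ Ck_on_add]
  and smooth_fun_mult = smooth_fun_binary[where F="\<lambda>a b. a * b", OF _ _ Ck_on_mult]

lemma smooth_fun_sum:
  assumes "S \<subseteq> topspace (\<E> n)" "\<And>i. i \<in> I \<Longrightarrow> smooth_fun n S (f i)"
  shows "smooth_fun n S (\<lambda>x. \<Sum>i\<in>I. f i x)"
  using assms(2)
proof (induction I rule: infinite_finite_induct)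
  case (insert i I)
  then show ?case by (simp add: smooth_fun_add)
qed (auto simp: smooth_fun_const[OF assms(1)])

section \<open>Derivatives on sets that are open in a quadrant\<close>

text \<open>What \<open>corner_chart\<close> says about a chart image, with the constrained
  coordinates forgotten; intersecting with an open set preserves it.\<close>

definition quadrant_open :: "nat \<Rightarrow> (nat \<Rightarrow> real) set \<Rightarrow> bool" where
  "quadrant_open n S \<longleftrightarrow> (\<exists>K. openin (subtopology (\<E> n) (quadrant n K)) S)"

lemma quadrant_open_Int: "quadrant_open n S \<Longrightarrow> openin (\<E> n) W \<Longrightarrow> quadrant_open n (S \<inter> W)"
  unfolding quadrant_open_def by (auto simp: openin_subtopology)

text \<open>Increasing a coordinate cannot violate a constraint \<open>0 \<le> x i\<close>, and the
  open factor leaves some room. This is the reason for differentiating from the right.\<close>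

lemma quadrant_open_segment:
  assumes "quadrant_open n S" "x \<in> S" "i < n"
  obtains e where "e > 0" "\<And>t. x i \<le> t \<Longrightarrow> t < x i + e \<Longrightarrow> x(i := t) \<in> S"
proof -
  obtain K W where W: "openin (\<E> n) W" "S = W \<inter> quadrant n K"
    using assms(1) by (auto simp: quadrant_open_def openin_subtopology)
  have "open {t. x(i := t) \<in> W}" "x i \<in> {t. x(i := t) \<in> W}"
    using open_coordinate_line[OF W(1) assms(3)] assms(2) W(2) by auto
  then obtain e where e: "e > 0" "ball (x i) e \<subseteq> {t. x(i := t) \<in> W}"
    by (meson open_contains_ball)
  show ?thesis
  proof (rule that[OF e(1)])
    fix t assume t: "x i \<le> t" "t < x i + e"
    then have "t \<in> ball (x i) e" by (auto simp: dist_real_def)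
    then have "x(i := t) \<in> W" using e(2) by blast
    moreover have "x(i := t) \<in> quadrant n K"
      using assms(2,3) t(1) W(2) by (force simp: quadrant_def topspace_Euclidean_space)
    ultimately show "x(i := t) \<in> S" using W(2) by simp
  qed
qed

text \<open>By \<open>quadrant_open_segment\<close> the values that enter the right-hand limit are
  all taken inside \<open>S\<close>.\<close>

lemma right_deriv_cong:
  assumes S: "quadrant_open n S" "x \<in> S" "i < n" and "\<And>y. y \<in> S \<Longrightarrow> f y = g y"
  shows "right_deriv i f x = right_deriv i g x"
proof -
  obtain e where e: "e > 0" "\<And>t. x i \<le> t \<Longrightarrow> t < x i + e \<Longrightarrow> x(i := t) \<in> S"
    using quadrant_open_segment[OF S] by blast
  have "\<forall>\<^sub>F t in nhds (x i). t \<in> {..<x i + e}"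
    by (rule eventually_nhds_in_open) (use e(1) in auto)
  then have "\<forall>\<^sub>F t in nhds (x i). t \<in> {x i<..} \<longrightarrow> f (x(i := t)) = g (x(i := t))"
    by (rule eventually_mono) (use e assms(4) in \<open>auto simp del: fun_upd_apply\<close>)
  then have "((\<lambda>t. f (x(i := t))) has_vector_derivative D) (at_right (x i)) \<longleftrightarrow>
      ((\<lambda>t. g (x(i := t))) has_vector_derivative D) (at_right (x i))" for D
    using assms(2,4) by (intro has_vector_derivative_cong_ev) auto
  then show ?thesis by (simp add: right_deriv_def vector_derivative_def)
qed

text \<open>A local extension has a two-sided derivative at \<open>x\<close>, which restricts both
  to the filter within \<open>S\<close> and to the right-hand filter. Both derivatives of
  \<open>f\<close> therefore exist and equal that of the extension.\<close>

lemma part_deriv_eq_right_deriv: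
  assumes f: "smooth_fun n S f" and S: "quadrant_open n S" "x \<in> S" "i < n"
  shows "part_deriv S i f x = right_deriv i f x"
proof -
  obtain W h where W: "openin (\<E> n) W" "x \<in> W" "\<And>k. Ck_on k n W h" "\<And>y. y \<in> W \<Longrightarrow> y \<in> S \<Longrightarrow> h y = f y"
    using smooth_funD[OF f S(2)] by blast
  have D: "((\<lambda>t. h (x(i := t))) has_real_derivative right_deriv i h x) (at (x i))"
    by (rule Ck_on_right_deriv[OF W(1) W(3) W(2) S(3)])
  have SW: "quadrant_open n (S \<inter> W)" by (rule quadrant_open_Int[OF S(1) W(1)])
  obtain e where e: "e > 0" "\<And>t. x i \<le> t \<Longrightarrow> t < x i + e \<Longrightarrow> x(i := t) \<in> S \<inter> W"
    using quadrant_open_segment[OF SW _ S(3), of x] S(2) W(2) by auto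
  have r: "right_deriv i f x = right_deriv i h x"
    by (rule right_derivI(2)[where f=h and g=f and e=e, OF D]) (use e W(4) in auto)
  let ?T = "{t. x(i := t) \<in> S}"
  have "x i \<in> {t. x(i := t) \<in> W}" using W(2) by simp
  then obtain d where d: "d > 0" "ball (x i) d \<subseteq> {t. x(i := t) \<in> W}"
    using open_coordinate_line[OF W(1) S(3), of x] by (meson open_contains_ball)
  have "((\<lambda>t. h (x(i := t))) has_real_derivative right_deriv i h x) (at (x i) within ?T)"
    by (rule has_field_derivative_at_within[OF D])
  then have "((\<lambda>t. f (x(i := t))) has_real_derivative right_deriv i h x) (at (x i) within ?T)"
  proof (rule has_field_derivative_transform_within[OF _ d(1)])
    fix t assume "t \<in> ?T" "dist t (x i) < d"
    then have "x(i := t) \<in> S" "x(i := t) \<in> W" using d(2) by (auto simp: dist_commute)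
    then show "h (x(i := t)) = f (x(i := t))" using W(4) by simp
  qed (use S(2) in simp)
  \<comment> \<open>A derivative within \<open>?T\<close> is unique only if \<open>x i\<close> is a
    limit point of \<open>?T\<close>, and the segment to the right makes it one.\<close>
  moreover have "at (x i) within ?T \<noteq> bot"
  proof -
    have "at_right (x i) = at (x i) within {x i<..<x i + e}"
      by (rule at_within_nhd[of _ "{x i - 1<..<x i + e}"]) (use e in auto)
    also have "\<dots> \<le> at (x i) within ?T"
      by (rule at_le) (use e(2) in auto)
    finally have le: "at_right (x i) \<le> at (x i) within ?T" .
    show ?thesis
    proof
      assume "at (x i) within ?T = bot"
      with le have "at_right (x i) = bot" by (simp only: bot_unique)
      then show False using trivial_limit_at_right_real[of "x i"] by simp
    qed
  qed
  ultimately have "vector_derivative (\<lambda>t. f (x(i := t))) (at (x i) within ?T) = right_deriv i h x"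
    by (auto simp only: has_real_derivative_iff_has_vector_derivative intro: vector_derivative_within)
  then show "part_deriv S i f x = right_deriv i f x"
    by (simp only: part_deriv_def r)
qed

text \<open>The derivative of an extension extends the derivative: at points of \<open>S\<close> in
  the domain of the extension both depend only on the common values there.\<close>

lemma smooth_fun_right_deriv:
  assumes f: "smooth_fun n S f" and S: "quadrant_open n S" and i: "i < n"
  shows "smooth_fun n S (right_deriv i f)"
  unfolding smooth_fun_def
proof (intro conjI ballI)
  fix x assume x: "x \<in> S"
  obtain W h where W: "openin (\<E> n) W" "x \<in> W" "\<And>k. Ck_on k n W h" "\<And>y. y \<in> W \<Longrightarrow> y \<in> S \<Longrightarrow> h y = f y"
    using smooth_funD[OF f x] by blast
  have "Ck_on k n W (right_deriv i h)" for k
    using W(3)[of "Suc k"] i by (simp add: Ck_on_Suc_iff[OF W(1)] del: Ck_on.simps)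
  moreover have "right_deriv i h y = right_deriv i f y" if "y \<in> W \<inter> S" for y
    by (rule right_deriv_cong[OF quadrant_open_Int[OF S W(1)] _ i]) (use that W(4) in auto)
  ultimately show "\<exists>W h. openin (\<E> n) W \<and> x \<in> W \<and> (\<forall>k. Ck_on k n W h) \<and> (\<forall>y\<in>W \<inter> S. h y = right_deriv i f y)"
    using W(1,2) by (intro exI[of _ W] exI[of _ "right_deriv i h"]) auto
qed (use f in \<open>simp add: smooth_fun_def\<close>)

text \<open>The chain rule is applied to the extensions of \<open>f\<close> and \<open>g\<close>;
  each of the three kinds of derivative is then moved back by
  \<open>right_deriv_cong\<close>.\<close>

lemma right_deriv_compose:
  assumes f: "smooth_on n m S f" "f \<in> S \<rightarrow> S'" and S: "quadrant_open n S" "x \<in> S" "i < n"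
    and g: "smooth_fun m S' g" and S': "quadrant_open m S'"
  shows "right_deriv i (\<lambda>y. g (f y)) x = (\<Sum>j<m. right_deriv j g (f x) * right_deriv i (\<lambda>y. f y j) x)"
proof -
  have f1: "\<forall>j<m. smooth_fun n S (\<lambda>x. f x j)" and SE: "S \<subseteq> topspace (\<E> n)"
    using f(1) unfolding smooth_on_iff by blast+
  obtain U h V l where U: "openin (\<E> n) U" "x \<in> U" "h \<in> U \<rightarrow> V"
    "\<forall>j<m. \<forall>k. Ck_on k n U (\<lambda>y. h y j)" "\<forall>y\<in>U \<inter> S. h y = f y"
    and V: "openin (\<E> m) V" "f x \<in> V" "\<forall>k. Ck_on k m V l" "\<forall>y\<in>V \<inter> S'. l y = g y"
    by (rule smooth_composite_extension[OF f1 f(2) SE S(2) g])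
  have hx: "h x = f x" using U(2,5) S(2) by simp
  have SU: "quadrant_open n (S \<inter> U)" by (rule quadrant_open_Int[OF S(1) U(1)])
  have S'V: "quadrant_open m (S' \<inter> V)" by (rule quadrant_open_Int[OF S' V(1)])
  have fx: "f x \<in> S' \<inter> V" using f(2) S(2) V(2) by auto
  have "((\<lambda>t. l (h (x(i := t)))) has_real_derivative
       (\<Sum>j<m. right_deriv j l (h x) * right_deriv i (\<lambda>x. h x j) x)) (at (x i))"
    using U(4) V(3) by (intro chain_rule_open[OF U(1) V(1) U(3) _ _ S(3) U(2)]) (simp_all del: Ck_on.simps)
  then have "right_deriv i (\<lambda>y. l (h y)) x = (\<Sum>j<m. right_deriv j l (h x) * right_deriv i (\<lambda>x. h x j) x)"
    by (rule right_deriv_open[OF U(1,2) S(3), of "\<lambda>y. l (h y)"])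
  moreover have "right_deriv i (\<lambda>y. g (f y)) x = right_deriv i (\<lambda>y. l (h y)) x"
    by (rule right_deriv_cong[OF SU _ S(3)]) (use S(2) U(2,3,5) V(4) f(2) in \<open>force simp: Pi_iff\<close>)+
  moreover have "right_deriv j l (h x) = right_deriv j g (f x)" if "j < m" for j
    unfolding hx by (rule right_deriv_cong[OF S'V fx that]) (use V(4) in auto)
  moreover have "right_deriv i (\<lambda>x. h x j) x = right_deriv i (\<lambda>x. f x j) x" for j
    by (rule right_deriv_cong[OF SU _ S(3)]) (use S(2) U(2,5) in auto)
  ultimately show ?thesis by simp
qed

text \<open>\<open>jacobian\<close> with the domain removed. Changing to a smaller domain or to
  another formula for the same map is then one application of \<open>jac_cong\<close>.\<close>

definition jac :: "nat \<Rightarrow> nat \<Rightarrow> ((nat \<Rightarrow> real) \<Rightarrow> nat \<Rightarrow> real) \<Rightarrow> (nat \<Rightarrow> real) \<Rightarrow> (nat \<Rightarrow> real) \<Rightarrow> nat \<Rightarrow> real" where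
  "jac n m f x v = (\<lambda>j. if j < m then \<Sum>i<n. right_deriv i (\<lambda>y. f y j) x * v i else 0)"

lemma jacobian_eq_jac:
  assumes "smooth_on n m S f" "quadrant_open n S" "x \<in> S"
  shows "jacobian n m S f x v = jac n m f x v"
  using assms part_deriv_eq_right_deriv[OF _ assms(2,3)]
  by (auto simp: jacobian_def jac_def smooth_on_iff fun_eq_iff intro!: sum.cong)

lemma jac_cong:
  assumes "quadrant_open n S" "x \<in> S" "\<And>y. y \<in> S \<Longrightarrow> f y = g y"
  shows "jac n m f x v = jac n m g x v"
  using right_deriv_cong[OF assms(1,2), of _ "\<lambda>y. f y j" "\<lambda>y. g y j" for j] assms(3)
  by (auto simp: jac_def fun_eq_iff intro!: sum.cong)

lemma jac_in_Euclidean_space [simp]: "jac n m f x v \<in> topspace (\<E> m)"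
  by (auto simp: jac_def topspace_Euclidean_space)

lemma jac_compose:
  assumes f: "smooth_on n m S f" "f \<in> S \<rightarrow> S'" and S: "quadrant_open n S" "x \<in> S"
    and g: "smooth_on m l S' g" and S': "quadrant_open m S'"
  shows "jac n l (\<lambda>y. g (f y)) x v = jac m l g (f x) (jac n m f x v)"
proof
  fix k
  show "jac n l (\<lambda>y. g (f y)) x v k = jac m l g (f x) (jac n m f x v) k"
  proof (cases "k < l")
    case True
    then have gk: "smooth_fun m S' (\<lambda>y. g y k)" using g by (simp add: smooth_on_iff)
    have "(\<Sum>i<n. right_deriv i (\<lambda>y. g (f y) k) x * v i) =
        (\<Sum>i<n. (\<Sum>j<m. right_deriv j (\<lambda>y. g y k) (f x) * right_deriv i (\<lambda>y. f y j) x) * v i)"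
      using right_deriv_compose[OF f S _ gk S'] by (intro sum.cong) auto
    also have "\<dots> = (\<Sum>j<m. right_deriv j (\<lambda>y. g y k) (f x) * (\<Sum>i<n. right_deriv i (\<lambda>y. f y j) x * v i))"
      unfolding sum_distrib_left sum_distrib_right by (subst sum.swap) (simp add: mult.assoc)
    finally show ?thesis using True by (simp add: jac_def)
  qed (simp add: jac_def)
qed

lemma jac_id:
  assumes "v \<in> topspace (\<E> n)"
  shows "jac n n (\<lambda>y. y) x v = v"
proof
  fix j
  have "(\<Sum>i<n. (if i = j then 1 else 0) * v i) = (if j < n then v j else 0)"
    by (simp add: if_distrib[of "\<lambda>a. a * _"] cong: if_cong)
  then show "jac n n (\<lambda>y. y) x v j = v j"
    using assms by (auto simp: jac_def right_deriv_coordinate topspace_Euclidean_space)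
qed

text \<open>Base point \<open>u z\<close> and vector \<open>v z\<close> both vary with the parameter
  \<open>z\<close>: the coordinate form of the smoothness of Tf along a vector field.\<close>

lemma smooth_fun_jac:
  assumes f: "smooth_on n m S f" and S: "quadrant_open n S"
    and u: "T \<subseteq> topspace (\<E> l)" "u \<in> T \<rightarrow> S" "\<And>i. i < n \<Longrightarrow> smooth_fun l T (\<lambda>z. u z i)"
    and v: "\<And>i. i < n \<Longrightarrow> smooth_fun l T (\<lambda>z. v z i)"
  shows "smooth_fun l T (\<lambda>z. jac n m f (u z) (v z) j)"
proof (cases "j < m")
  case True
  then have "smooth_fun n S (\<lambda>y. f y j)" using f by (simp add: smooth_on_iff)
  then have "smooth_fun l T (\<lambda>z. right_deriv i (\<lambda>y. f y j) (u z))" if "i < n" for i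
    using smooth_fun_compose[OF u smooth_fun_right_deriv[OF _ S that]] by simp
  then have "smooth_fun l T (\<lambda>z. \<Sum>i<n. right_deriv i (\<lambda>y. f y j) (u z) * v z i)"
    by (intro smooth_fun_sum u smooth_fun_mult v) auto
  then show ?thesis using True by (simp add: jac_def)
qed (simp add: jac_def smooth_fun_const u)

section \<open>Smooth maps in charts\<close>

text \<open>The Hausdorff and countability axioms are left out: they play no role in what follows, and without
  them the condition passes easily to coproducts and products.\<close>

definition smooth_atlas :: "'p mfd \<Rightarrow> bool" where
  "smooth_atlas M \<longleftrightarrow>
     (\<forall>c\<in>atlas M. corner_chart (mtop M) c) \<and> points M = (\<Union>c\<in>atlas M. cdom c) \<and>
     (\<forall>c\<in>atlas M. \<forall>d\<in>atlas M. smooth_on (cdim c) (cdim d) (loc_dom c (\<lambda>p. p) d) (loc_rep c (\<lambda>p. p) d))"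

lemma manifold_imp_smooth_atlas: "manifold M \<Longrightarrow> smooth_atlas M"
  by (simp add: manifold_def smooth_atlas_def)

lemma smooth_atlas_corner_chart: "smooth_atlas M \<Longrightarrow> c \<in> atlas M \<Longrightarrow> corner_chart (mtop M) c"
  by (simp add: smooth_atlas_def)

lemma corner_chart_openin: "corner_chart T c \<Longrightarrow> openin T (cdom c)"
  by (simp add: corner_chart_def)

lemma corner_chart_Euclidean: "corner_chart T c \<Longrightarrow> p \<in> cdom c \<Longrightarrow> cmap c p \<in> topspace (\<E> (cdim c))"
  by (fastforce simp: corner_chart_def dest: openin_subset)

lemma corner_chart_image_subset:
  "corner_chart T c \<Longrightarrow> U \<subseteq> cdom c \<Longrightarrow> cmap c ` U \<subseteq> topspace (\<E> (cdim c))"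
  using corner_chart_Euclidean[of T c] by blast

lemma corner_chart_inj:
  assumes "corner_chart T c"
  shows "inj_on (cmap c) (cdom c)"
proof -
  have "cdom c \<subseteq> topspace T" by (rule openin_subset[OF corner_chart_openin[OF assms]])
  then have "topspace (subtopology T (cdom c)) = cdom c" by auto
  moreover have "inj_on (cmap c) (topspace (subtopology T (cdom c)))"
    using assms unfolding corner_chart_def by (meson homeomorphic_imp_injective_map)
  ultimately show ?thesis by simp
qed

lemma cinv_cmap: "corner_chart T c \<Longrightarrow> p \<in> cdom c \<Longrightarrow> cinv c (cmap c p) = p"
  unfolding cinv_def by (rule inv_into_f_f[OF corner_chart_inj])

text \<open>Relative openness of the image is given as the trace of an open \<open>W\<close>, since
  \<open>smooth_fun_local\<close> asks for open sets of the coordinate space.\<close>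

lemma corner_chart_open_image:
  assumes c: "corner_chart T c" and N: "openin T N"
  obtains W where "openin (\<E> (cdim c)) W" "cmap c ` (cdom c \<inter> N) = W \<inter> cmap c ` cdom c"
proof -
  have "open_map (subtopology T (cdom c)) (subtopology (\<E> (cdim c)) (cmap c ` cdom c)) (cmap c)"
    using c unfolding corner_chart_def by (meson homeomorphic_imp_open_map)
  moreover have "openin (subtopology T (cdom c)) (cdom c \<inter> N)"
    using N by (rule openin_subtopology_Int2)
  ultimately have "openin (subtopology (\<E> (cdim c)) (cmap c ` cdom c)) (cmap c ` (cdom c \<inter> N))"
    unfolding open_map_def by blast
  then show ?thesis using that by (auto simp: openin_subtopology)
qed

lemma corner_chart_quadrant_open:
  assumes c: "corner_chart T c" and N: "openin T N"
  shows "quadrant_open (cdim c) (cmap c ` (cdom c \<inter> N))"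
proof -
  obtain W where W: "openin (\<E> (cdim c)) W" "cmap c ` (cdom c \<inter> N) = W \<inter> cmap c ` cdom c"
    using corner_chart_open_image[OF c N] by blast
  have "quadrant_open (cdim c) (cmap c ` cdom c)"
    using c unfolding corner_chart_def quadrant_open_def by blast
  from quadrant_open_Int[OF this W(1)] show ?thesis
    unfolding W(2) by (simp add: Int_commute)
qed

lemma corner_chart_continuous:
  assumes c: "corner_chart T c" and U: "U \<subseteq> cdom c"
  shows "continuous_map (subtopology T U) (\<E> (cdim c)) (cmap c)"
proof -
  have "continuous_map (subtopology T (cdom c)) (subtopology (\<E> (cdim c)) (cmap c ` cdom c)) (cmap c)"
    using c unfolding corner_chart_def by (meson homeomorphic_imp_continuous_map)
  then have "continuous_map (subtopology T (cdom c)) (\<E> (cdim c)) (cmap c)"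
    by (simp add: continuous_map_in_subtopology)
  then show ?thesis
    by (rule continuous_map_from_subtopology_mono[OF _ U])
qed

section \<open>Smooth real functions in one chart\<close>

text \<open>Smoothness of maps is reduced to this scalar notion by taking for \<open>h\<close> the
  coordinates of the values, see \<open>smooth_map_iff\<close>. Most arguments can then speak of
  subsets \<open>U\<close> of the manifold instead of their images.\<close>

definition chart_smooth :: "'p chart \<Rightarrow> 'p set \<Rightarrow> ('p \<Rightarrow> real) \<Rightarrow> bool" where
  "chart_smooth c U h \<longleftrightarrow> smooth_fun (cdim c) (cmap c ` U) (\<lambda>z. h (cinv c z))"

lemma chart_smooth_subset: "chart_smooth c U h \<Longrightarrow> U' \<subseteq> U \<Longrightarrow> chart_smooth c U' h"
  unfolding chart_smooth_def by (erule smooth_fun_subset) (rule image_mono)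

lemma chart_smooth_cong:
  assumes "corner_chart T c" "U \<subseteq> cdom c" "\<And>p. p \<in> U \<Longrightarrow> h p = h' p"
  shows "chart_smooth c U h \<longleftrightarrow> chart_smooth c U h'"
  unfolding chart_smooth_def
  by (rule smooth_fun_cong) (use assms cinv_cmap[OF assms(1)] in auto)

lemma chart_smooth_local:
  assumes c: "corner_chart T c" and U: "U \<subseteq> cdom c"
    and "\<And>p. p \<in> U \<Longrightarrow> \<exists>N. openin T N \<and> p \<in> N \<and> chart_smooth c (U \<inter> N) h"
  shows "chart_smooth c U h"
  unfolding chart_smooth_def
proof (rule smooth_fun_local)
  show "cmap c ` U \<subseteq> topspace (\<E> (cdim c))"
    by (rule corner_chart_image_subset[OF c U])
  fix z assume "z \<in> cmap c ` U"
  then obtain p where p: "p \<in> U" "z = cmap c p" by blast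
  obtain N where N: "openin T N" "p \<in> N" "chart_smooth c (U \<inter> N) h"
    using assms(3)[OF p(1)] by blast
  obtain W where W: "openin (\<E> (cdim c)) W" "cmap c ` (cdom c \<inter> N) = W \<inter> cmap c ` cdom c"
    using corner_chart_open_image[OF c N(1)] by blast
  \<comment> \<open>\<open>W\<close> is controlled only through the image of the whole chart domain;
    injectivity of the chart yields the trace on the image of \<open>U\<close>.\<close>
  have "cmap c ` U \<inter> W = cmap c ` (U \<inter> N)"
  proof
    show "cmap c ` U \<inter> W \<subseteq> cmap c ` (U \<inter> N)"
    proof
      fix y assume "y \<in> cmap c ` U \<inter> W"
      then obtain q where q: "q \<in> U" "y = cmap c q" "y \<in> cmap c ` (cdom c \<inter> N)"
        using U W(2) by blast
      then obtain q' where "q' \<in> cdom c" "q' \<in> N" "cmap c q = cmap c q'" by blast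
      then have "q = q'" using inj_onD[OF corner_chart_inj[OF c]] q(1) U by blast
      then show "y \<in> cmap c ` (U \<inter> N)" using q \<open>q' \<in> N\<close> by blast
    qed
    show "cmap c ` (U \<inter> N) \<subseteq> cmap c ` U \<inter> W"
      using W(2) U by blast
  qed
  moreover have "z \<in> W" using p N(2) W(2) U by blast
  ultimately show "\<exists>W. openin (\<E> (cdim c)) W \<and> z \<in> W \<and> smooth_fun (cdim c) (cmap c ` U \<inter> W) (\<lambda>z. h (cinv c z))"
    using W(1) N(3) unfolding chart_smooth_def by (intro exI[of _ W]) simp
qed

text \<open>Local extensions are continuous, and the traces of their domains form a relatively open
  cover of \<open>S\<close> indexed by its points, to which the pasting lemma applies.\<close>

lemma smooth_fun_continuous:
  assumes "smooth_fun n S f"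
  shows "continuous_map (subtopology (\<E> n) S) euclideanreal f"
proof -
  let ?P = "\<lambda>x W. openin (\<E> n) W \<and> x \<in> W \<and> continuous_map (subtopology (\<E> n) (S \<inter> W)) euclideanreal f"
  have "\<forall>x\<in>S. \<exists>W. ?P x W"
  proof
    fix x assume "x \<in> S"
    obtain W h where W: "openin (\<E> n) W" "x \<in> W" "\<And>k. Ck_on k n W h" "\<And>y. y \<in> W \<Longrightarrow> y \<in> S \<Longrightarrow> h y = f y"
      using smooth_funD[OF assms \<open>x \<in> S\<close>] by blast
    have "continuous_map (subtopology (\<E> n) (S \<inter> W)) euclideanreal h"
      by (rule continuous_map_from_subtopology_mono[OF Ck_on_continuous[OF W(3)]]) auto
    then have "continuous_map (subtopology (\<E> n) (S \<inter> W)) euclideanreal f"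
      by (rule continuous_map_eq) (use W(4) in auto)
    with W(1,2) show "\<exists>W. ?P x W" by blast
  qed
  from bchoice[OF this] obtain W where "\<forall>x\<in>S. ?P x (W x)" ..
  then have W: "\<And>x. x \<in> S \<Longrightarrow> openin (\<E> n) (W x)" "\<And>x. x \<in> S \<Longrightarrow> x \<in> W x"
    "\<And>x. x \<in> S \<Longrightarrow> continuous_map (subtopology (\<E> n) (S \<inter> W x)) euclideanreal f"
    by simp_all
  show ?thesis
  proof (rule pasting_lemma[where I=S and T="\<lambda>x. S \<inter> W x" and f="\<lambda>_. f"])
    show "openin (subtopology (\<E> n) S) (S \<inter> W x)" if "x \<in> S" for x
      using W(1)[OF that] by (rule openin_subtopology_Int2)
    show "continuous_map (subtopology (subtopology (\<E> n) S) (S \<inter> W x)) euclideanreal f" if "x \<in> S" for x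
      using W(3)[OF that] by (simp add: subtopology_subtopology Int_absorb1 flip: Int_assoc)
    show "\<exists>j. j \<in> S \<and> x \<in> S \<inter> W j \<and> f x = f x" if "x \<in> topspace (subtopology (\<E> n) S)" for x
      using that W(2) by auto
  qed auto
qed

lemma chart_smooth_continuous:
  assumes c: "corner_chart T c" and U: "U \<subseteq> cdom c" and h: "chart_smooth c U h"
  shows "continuous_map (subtopology T U) euclideanreal h"
proof -
  have "continuous_map (subtopology T U) (subtopology (\<E> (cdim c)) (cmap c ` U)) (cmap c)"
    using corner_chart_continuous[OF c U] by (auto simp: continuous_map_in_subtopology)
  from continuous_map_compose[OF this smooth_fun_continuous[OF h[unfolded chart_smooth_def]]]
  have "continuous_map (subtopology T U) euclideanreal ((\<lambda>z. h (cinv c z)) \<circ> cmap c)" .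
  then show ?thesis
    by (rule continuous_map_eq) (use U cinv_cmap[OF c] in auto)
qed

text \<open>Inserting \<open>cinv d\<close> after \<open>cmap d\<close> between \<open>f\<close> and
  \<open>h\<close> exhibits a composite of two coordinate representations.\<close>

lemma chart_smooth_compose:
  assumes c: "corner_chart T c" "U \<subseteq> cdom c" and d: "corner_chart T' d" "V \<subseteq> cdom d"
    and f: "f \<in> U \<rightarrow> V" "\<And>j. j < cdim d \<Longrightarrow> chart_smooth c U (\<lambda>p. cmap d (f p) j)"
    and h: "chart_smooth d V h"
  shows "chart_smooth c U (\<lambda>p. h (f p))"
proof -
  have "smooth_fun (cdim c) (cmap c ` U) (\<lambda>z. h (cinv d (cmap d (f (cinv c z)))))"
  proof (rule smooth_fun_compose[where g="\<lambda>y. h (cinv d y)" and f="\<lambda>z. cmap d (f (cinv c z))"])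
    show "cmap c ` U \<subseteq> topspace (\<E> (cdim c))"
      by (rule corner_chart_image_subset[OF c])
    show "(\<lambda>z. cmap d (f (cinv c z))) \<in> cmap c ` U \<rightarrow> cmap d ` V"
      using c(2) f(1) by (force simp: cinv_cmap[OF c(1)])
    show "smooth_fun (cdim c) (cmap c ` U) (\<lambda>z. cmap d (f (cinv c z)) j)" if "j < cdim d" for j
      using f(2)[OF that] by (simp add: chart_smooth_def)
    show "smooth_fun (cdim d) (cmap d ` V) (\<lambda>y. h (cinv d y))"
      using h by (simp add: chart_smooth_def)
  qed
  then have "chart_smooth c U (\<lambda>p. h (cinv d (cmap d (f p))))"
    by (simp add: chart_smooth_def)
  moreover have "h (cinv d (cmap d (f p))) = h (f p)" if "p \<in> U" for p
    using that f(1) d(2) cinv_cmap[OF d(1), of "f p"] by (simp add: Pi_iff subset_iff)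
  ultimately show ?thesis
    using chart_smooth_cong[OF c, of "\<lambda>p. h (cinv d (cmap d (f p)))" "\<lambda>p. h (f p)"] by simp
qed

section \<open>Smooth maps between charted spaces\<close>

text \<open>Isolates what is asked of a target of smooth maps, so that tangent bundles can serve as
  targets without a full \<open>smooth_atlas\<close>.\<close>

definition Euclidean_charts :: "'p mfd \<Rightarrow> bool" where
  "Euclidean_charts M \<longleftrightarrow> (\<forall>c\<in>atlas M. cmap c ` cdom c \<subseteq> topspace (\<E> (cdim c)))"

lemma smooth_atlas_Euclidean_charts: "smooth_atlas M \<Longrightarrow> Euclidean_charts M"
  unfolding Euclidean_charts_def using corner_chart_image_subset smooth_atlas_corner_chart by blast

lemma smooth_map_iff:
  assumes "smooth_atlas A" "Euclidean_charts B"
  shows "smooth_map A B f \<longleftrightarrow> continuous_map (mtop A) (mtop B) f \<and>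
    (\<forall>c\<in>atlas A. \<forall>d\<in>atlas B. \<forall>j<cdim d. chart_smooth c {p \<in> cdom c. f p \<in> cdom d} (\<lambda>p. cmap d (f p) j))"
proof -
  have "smooth_on (cdim c) (cdim d) (loc_dom c f d) (loc_rep c f d) \<longleftrightarrow>
      (\<forall>j<cdim d. chart_smooth c {p \<in> cdom c. f p \<in> cdom d} (\<lambda>p. cmap d (f p) j))"
    if "c \<in> atlas A" "d \<in> atlas B" for c d
  proof -
    note c = smooth_atlas_corner_chart[OF assms(1) that(1)]
    have "loc_dom c f d \<subseteq> topspace (\<E> (cdim c))"
      unfolding loc_dom_def by (rule corner_chart_image_subset[OF c]) auto
    moreover have "loc_rep c f d \<in> loc_dom c f d \<rightarrow> topspace (\<E> (cdim d))"
      using assms(2) that(2) by (fastforce simp: Euclidean_charts_def loc_dom_def loc_rep_def cinv_cmap[OF c])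
    ultimately show ?thesis
      by (simp add: smooth_on_iff chart_smooth_def loc_dom_def loc_rep_def)
  qed
  then show ?thesis by (simp add: smooth_map_def)
qed

lemma smooth_mapD:
  assumes f: "smooth_map A B f" and "c \<in> atlas A" "d \<in> atlas B"
    and "U \<subseteq> cdom c" "f \<in> U \<rightarrow> cdom d" "j < cdim d"
  shows "chart_smooth c U (\<lambda>p. cmap d (f p) j)"
proof -
  have "chart_smooth c {p \<in> cdom c. f p \<in> cdom d} (\<lambda>p. cmap d (f p) j)"
    using assms(1-3,6) by (simp add: smooth_map_def smooth_on_iff chart_smooth_def loc_dom_def loc_rep_def)
  then show ?thesis by (rule chart_smooth_subset) (use assms(4,5) in auto)
qed

text \<open>A transition map is the identity of \<open>M\<close> read from \<open>d\<close> to
  \<open>c\<close>, so this is a composition.\<close>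

lemma chart_smooth_change:
  assumes M: "smooth_atlas M" and c: "c \<in> atlas M" and d: "d \<in> atlas M" and U: "U \<subseteq> cdom c" "U \<subseteq> cdom d"
    and h: "chart_smooth c U h"
  shows "chart_smooth d U h"
proof (rule chart_smooth_compose[where f="\<lambda>p. p"])
  show "corner_chart (mtop M) c" "corner_chart (mtop M) d"
    using M c d by (auto simp: smooth_atlas_def)
  show "chart_smooth d U (\<lambda>p. cmap c p j)" if "j < cdim c" for j
  proof -
    have "smooth_on (cdim d) (cdim c) (loc_dom d (\<lambda>p. p) c) (loc_rep d (\<lambda>p. p) c)"
      using M c d by (auto simp: smooth_atlas_def)
    then have "chart_smooth d {p \<in> cdom d. p \<in> cdom c} (\<lambda>p. cmap c p j)"
      using that by (simp add: smooth_on_iff chart_smooth_def loc_dom_def loc_rep_def)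
    then show ?thesis by (rule chart_smooth_subset) (use U in auto)
  qed
qed (use U h in auto)

lemma smooth_atlas_chartE:
  assumes "smooth_atlas M" "p \<in> points M"
  obtains c where "c \<in> atlas M" "p \<in> cdom c" "corner_chart (mtop M) c"
  using assms by (auto simp: smooth_atlas_def)

lemma openin_chart_preimage:
  assumes "smooth_atlas B" "continuous_map (mtop A) (mtop B) f" "openin (mtop A) U" "d \<in> atlas B"
  shows "openin (mtop A) {p \<in> U. f p \<in> cdom d}"
proof -
  have "openin (mtop A) {p \<in> topspace (mtop A). f p \<in> cdom d}"
    using openin_continuous_map_preimage[OF assms(2)] corner_chart_openin smooth_atlas_corner_chart assms(1,4) by blast
  then have "openin (mtop A) (U \<inter> {p \<in> topspace (mtop A). f p \<in> cdom d})"
    using assms(3) by blast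
  moreover have "U \<inter> {p \<in> topspace (mtop A). f p \<in> cdom d} = {p \<in> U. f p \<in> cdom d}"
    using openin_subset[OF assms(3)] by auto
  ultimately show ?thesis by simp
qed

lemma smooth_map_in_points: "smooth_map A B f \<Longrightarrow> p \<in> points A \<Longrightarrow> f p \<in> points B"
  by (auto simp: smooth_map_def points_def continuous_map_def)

text \<open>Elements of \<open>dCrl\<close> are restricted to the points, whereas smoothness is
  obtained for unrestricted formulas; this lemma mediates, also with a tangent bundle as
  \<open>B\<close>.\<close>

lemma smooth_map_cong:
  assumes A: "smooth_atlas A" and "\<And>p. p \<in> points A \<Longrightarrow> f p = g p" and f: "smooth_map A B f"
  shows "smooth_map A B g"
  unfolding smooth_map_def
proof (intro conjI ballI)
  show "continuous_map (mtop A) (mtop B) g"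
    using f assms(2) by (auto simp: smooth_map_def points_def intro: continuous_map_eq)
  fix c d assume c: "c \<in> atlas A" and d: "d \<in> atlas B"
  note cc = smooth_atlas_corner_chart[OF A c]
  have cp: "cdom c \<subseteq> points A" using A c by (auto simp: smooth_atlas_def)
  then have dom: "{p \<in> cdom c. g p \<in> cdom d} = {p \<in> cdom c. f p \<in> cdom d}" using assms(2) by (metis (no_types, opaque_lifting) subset_iff)
  have rep: "loc_rep c g d z = loc_rep c f d z" if "z \<in> loc_dom c f d" for z
    using that cp assms(2) by (auto simp: loc_dom_def loc_rep_def cinv_cmap[OF cc])
  have "smooth_on (cdim c) (cdim d) (loc_dom c f d) (loc_rep c f d)"
    using f c d by (simp add: smooth_map_def)
  moreover have "loc_rep c g d \<in> loc_dom c f d \<rightarrow> topspace (\<E> (cdim d)) \<longleftrightarrow> loc_rep c f d \<in> loc_dom c f d \<rightarrow> topspace (\<E> (cdim d))"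
    using rep by (simp add: Pi_iff)
  moreover have "smooth_fun (cdim c) (loc_dom c f d) (\<lambda>x. loc_rep c g d x j) \<longleftrightarrow> smooth_fun (cdim c) (loc_dom c f d) (\<lambda>x. loc_rep c f d x j)" for j
    by (rule smooth_fun_cong) (simp add: rep)
  ultimately show "smooth_on (cdim c) (cdim d) (loc_dom c g d) (loc_rep c g d)"
    using dom by (simp add: smooth_on_iff) (simp add: loc_dom_def)
qed

text \<open>The part of a chart domain on which the composite lands in \<open>e\<close> is covered
  by open sets that \<open>f\<close> maps into a single chart of \<open>B\<close>; on each of them
  the coordinate representations compose.\<close>

lemma smooth_map_compose:
  assumes A: "smooth_atlas A" and B: "smooth_atlas B" and f: "smooth_map A B f" and g: "smooth_map B C g"
    and C: "Euclidean_charts C"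
  shows "smooth_map A C (\<lambda>p. g (f p))"
  unfolding smooth_map_iff[OF A C]
proof (intro conjI ballI allI impI)
  show "continuous_map (mtop A) (mtop C) (\<lambda>p. g (f p))"
    using continuous_map_compose[of "mtop A" "mtop B" f "mtop C" g] f g by (simp add: smooth_map_def o_def)
  fix c e j assume c: "c \<in> atlas A" and e: "e \<in> atlas C" and j: "j < cdim e"
  note cc = smooth_atlas_corner_chart[OF A c]
  have cp: "cdom c \<subseteq> points A" using A c by (auto simp: smooth_atlas_def)
  let ?U = "{p \<in> cdom c. g (f p) \<in> cdom e}"
  show "chart_smooth c ?U (\<lambda>p. cmap e (g (f p)) j)"
  proof (rule chart_smooth_local[OF cc])
    fix p assume p: "p \<in> ?U"
    then have "f p \<in> points B" using cp smooth_map_in_points[OF f] by blast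
    then obtain d where d: "d \<in> atlas B" "f p \<in> cdom d" "corner_chart (mtop B) d"
      using smooth_atlas_chartE[OF B] by blast
    let ?N = "{q \<in> cdom c. f q \<in> cdom d}"
    have "openin (mtop A) ?N"
      using openin_chart_preimage[OF B _ corner_chart_openin[OF cc] d(1)] f by (simp add: smooth_map_def)
    moreover have "chart_smooth c (?U \<inter> ?N) (\<lambda>p. cmap e (g (f p)) j)"
    proof (rule chart_smooth_compose[OF cc _ d(3)])
      show "f \<in> ?U \<inter> ?N \<rightarrow> {q \<in> cdom d. g q \<in> cdom e}" by auto
      show "chart_smooth c (?U \<inter> ?N) (\<lambda>p. cmap d (f p) j)" if "j < cdim d" for j
        by (rule smooth_mapD[OF f c d(1) _ _ that]) auto
      show "chart_smooth d {q \<in> cdom d. g q \<in> cdom e} (\<lambda>q. cmap e (g q) j)"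
        by (rule smooth_mapD[OF g d(1) e _ _ j]) auto
    qed auto
    ultimately show "\<exists>N. openin (mtop A) N \<and> p \<in> N \<and> chart_smooth c (?U \<inter> N) (\<lambda>p. cmap e (g (f p)) j)"
      using p d(2) by blast
  qed auto
qed

lemma smooth_map_id: "smooth_atlas M \<Longrightarrow> smooth_map M M (\<lambda>p. p)"
  by (simp add: smooth_map_def smooth_atlas_def)

text \<open>One suitable pair of charts near \<open>p\<close>, whereas \<open>smooth_map\<close>
  quantifies over all pairs. Well adapted charts can thus be chosen point by point.\<close>

definition smooth_near :: "'p mfd \<Rightarrow> 'q mfd \<Rightarrow> ('p \<Rightarrow> 'q) \<Rightarrow> 'p \<Rightarrow> bool" where
  "smooth_near A B f p \<longleftrightarrow> (\<exists>c\<in>atlas A. \<exists>d\<in>atlas B. \<exists>U. openin (mtop A) U \<and> p \<in> U \<and> U \<subseteq> cdom c \<and>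
      f ` U \<subseteq> cdom d \<and> (\<forall>j<cdim d. chart_smooth c U (\<lambda>p. cmap d (f p) j)))"

lemma smooth_nearI:
  assumes "c \<in> atlas A" "d \<in> atlas B" "openin (mtop A) U" "p \<in> U" "U \<subseteq> cdom c" "f ` U \<subseteq> cdom d"
    and "\<And>j. j < cdim d \<Longrightarrow> chart_smooth c U (\<lambda>p. cmap d (f p) j)"
  shows "smooth_near A B f p"
  unfolding smooth_near_def using assms by blast

text \<open>Any other pair of charts differs from the good one by coordinate changes on both sides.
  Continuity follows as well, because the coordinates of \<open>f\<close> are continuous and charts
  of \<open>B\<close> are open maps onto their images.\<close>

lemma smooth_map_pointwiseI:
  assumes A: "smooth_atlas A" and B: "smooth_atlas B"
    and *: "\<And>p. p \<in> points A \<Longrightarrow> smooth_near A B f p"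
  shows "smooth_map A B f"
proof -
  have "f p \<in> points B" if "p \<in> points A" for p
    using *[OF that] B by (auto simp: smooth_near_def smooth_atlas_def)
  then have into: "f \<in> topspace (mtop A) \<rightarrow> topspace (mtop B)" by (auto simp: points_def)
  have "continuous_map (mtop A) (mtop B) f"
    unfolding continuous_map_def
  proof (intro conjI allI impI into)
    fix V assume V: "openin (mtop B) V"
    show "openin (mtop A) {p \<in> topspace (mtop A). f p \<in> V}"
    proof (subst openin_subopen, intro ballI)
      fix p assume p: "p \<in> {p \<in> topspace (mtop A). f p \<in> V}"
      then obtain c d U where c: "c \<in> atlas A" and d: "d \<in> atlas B" and U: "openin (mtop A) U" "p \<in> U" "U \<subseteq> cdom c"
        "f ` U \<subseteq> cdom d" and sm: "\<forall>j<cdim d. chart_smooth c U (\<lambda>p. cmap d (f p) j)"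
        using *[of p] by (auto simp: points_def smooth_near_def)
      note cc = smooth_atlas_corner_chart[OF A c]
      note cd = smooth_atlas_corner_chart[OF B d]
      \<comment> \<open>Near \<open>p\<close> the preimage of \<open>V\<close> under
        \<open>f\<close> is that of the open set \<open>W\<close> under the coordinates of
        \<open>f\<close>.\<close>
      obtain W where W: "openin (\<E> (cdim d)) W" "cmap d ` (cdom d \<inter> V) = W \<inter> cmap d ` cdom d"
        using corner_chart_open_image[OF cd V] by blast
      have top: "topspace (subtopology (mtop A) U) = U"
        using openin_subset[OF U(1)] by auto
      have "continuous_map (subtopology (mtop A) U) (\<E> (cdim d)) (\<lambda>p. cmap d (f p))"
        using sm U(3,4) by (intro continuous_map_into_Euclidean_space chart_smooth_continuous[OF cc])
          (auto intro!: corner_chart_Euclidean[OF cd])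
      from openin_continuous_map_preimage[OF this W(1)]
      have "openin (subtopology (mtop A) U) {p \<in> U. cmap d (f p) \<in> W}" unfolding top .
      then have "openin (mtop A) {p \<in> U. cmap d (f p) \<in> W}"
        using U(1) openin_trans_full by blast
      moreover have "p \<in> {p \<in> U. cmap d (f p) \<in> W}" using U p W(2) by auto
      moreover have "{p \<in> U. cmap d (f p) \<in> W} \<subseteq> {p \<in> topspace (mtop A). f p \<in> V}"
      proof clarify
        fix q assume q: "q \<in> U" "cmap d (f q) \<in> W"
        then have fq: "f q \<in> cdom d" using U(4) by blast
        then have "cmap d (f q) \<in> cmap d ` (cdom d \<inter> V)" using W(2) q(2) by blast
        then have "f q \<in> V" using inj_onD[OF corner_chart_inj[OF cd]] fq by blast
        then show "q \<in> topspace (mtop A) \<and> f q \<in> V" using q(1) openin_subset[OF U(1)] by blast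
      qed
      ultimately show "\<exists>T. openin (mtop A) T \<and> p \<in> T \<and> T \<subseteq> {p \<in> topspace (mtop A). f p \<in> V}" by blast
    qed
  qed
  moreover have "chart_smooth c' {p \<in> cdom c'. f p \<in> cdom d'} (\<lambda>p. cmap d' (f p) j)"
    if c': "c' \<in> atlas A" and d': "d' \<in> atlas B" and j: "j < cdim d'" for c' d' j
  proof (rule chart_smooth_local)
    show cc': "corner_chart (mtop A) c'" by (rule smooth_atlas_corner_chart[OF A c'])
    fix p assume p: "p \<in> {p \<in> cdom c'. f p \<in> cdom d'}"
    then have "p \<in> points A" using A c' by (auto simp: smooth_atlas_def)
    then obtain c d U where c: "c \<in> atlas A" and d: "d \<in> atlas B" and U: "openin (mtop A) U" "p \<in> U" "U \<subseteq> cdom c"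
      "f ` U \<subseteq> cdom d" and sm: "\<forall>j<cdim d. chart_smooth c U (\<lambda>p. cmap d (f p) j)"
      using *[of p] by (auto simp: smooth_near_def)
    note cc = smooth_atlas_corner_chart[OF A c]
    note cd = smooth_atlas_corner_chart[OF B d]
    \<comment> \<open>On \<open>?N\<close> all four charts are available: the target is changed from
      \<open>d\<close> to \<open>d'\<close> first, the source from \<open>c\<close> to
      \<open>c'\<close> afterwards.\<close>
    let ?N = "{p \<in> cdom c'. f p \<in> cdom d'} \<inter> U"
    have "chart_smooth c ?N (\<lambda>p. cmap d' (f p) j)"
    proof (rule chart_smooth_compose[OF cc _ cd, where V="{q \<in> cdom d. q \<in> cdom d'}"])
      show "chart_smooth c ?N (\<lambda>p. cmap d (f p) j)" if "j < cdim d" for j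
        using sm that by (auto intro: chart_smooth_subset)
      show "chart_smooth d {q \<in> cdom d. q \<in> cdom d'} (\<lambda>q. cmap d' q j)"
        by (rule smooth_mapD[OF smooth_map_id[OF B] d d' _ _ j]) auto
    qed (use U in auto)
    then have "chart_smooth c' ?N (\<lambda>p. cmap d' (f p) j)"
      by (rule chart_smooth_change[OF A c c', rotated 2]) (use U in auto)
    then show "\<exists>N. openin (mtop A) N \<and> p \<in> N \<and> chart_smooth c' ({p \<in> cdom c'. f p \<in> cdom d'} \<inter> N) (\<lambda>p. cmap d' (f p) j)"
      using U by blast
  qed auto
  ultimately show ?thesis
    unfolding smooth_map_iff[OF A smooth_atlas_Euclidean_charts[OF B]] by blast
qed

section \<open>The tangent functor\<close>

definition chart_jac :: "'p chart \<Rightarrow> ('p \<Rightarrow> 'q) \<Rightarrow> 'q chart \<Rightarrow> 'p \<Rightarrow> (nat \<Rightarrow> real) \<Rightarrow> nat \<Rightarrow> real" where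
  "chart_jac c f d p v = jac (cdim c) (cdim d) (loc_rep c f d) (cmap c p) v"

lemma chart_jac_Euclidean [simp]: "chart_jac c f d p v \<in> topspace (\<E> (cdim d))"
  by (simp add: chart_jac_def)

lemma charts_at_iff: "c \<in> charts_at M p \<longleftrightarrow> c \<in> atlas M \<and> p \<in> cdom c"
  by (simp add: charts_at_def)

lemma quadrant_open_loc_dom:
  assumes A: "smooth_atlas A" and B: "smooth_atlas B" and f: "continuous_map (mtop A) (mtop B) f"
    and c: "c \<in> atlas A" and d: "d \<in> atlas B"
  shows "quadrant_open (cdim c) (loc_dom c f d)"
proof -
  note cc = smooth_atlas_corner_chart[OF A c]
  have "quadrant_open (cdim c) (cmap c ` (cdom c \<inter> {p \<in> cdom c. f p \<in> cdom d}))"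
    by (rule corner_chart_quadrant_open[OF cc openin_chart_preimage[OF B f corner_chart_openin[OF cc] d]])
  moreover have "cdom c \<inter> {p \<in> cdom c. f p \<in> cdom d} = {p \<in> cdom c. f p \<in> cdom d}" by auto
  ultimately show ?thesis by (simp add: loc_dom_def)
qed

lemma jacobian_loc_rep:
  assumes A: "smooth_atlas A" and B: "smooth_atlas B" and f: "smooth_map A B f"
    and c: "c \<in> charts_at A p" and d: "d \<in> charts_at B (f p)"
  shows "jacobian (cdim c) (cdim d) (loc_dom c f d) (loc_rep c f d) (cmap c p) v = chart_jac c f d p v"
  unfolding chart_jac_def
proof (rule jacobian_eq_jac)
  show "smooth_on (cdim c) (cdim d) (loc_dom c f d) (loc_rep c f d)"
    using f c d by (simp add: smooth_map_def charts_at_iff)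
  show "quadrant_open (cdim c) (loc_dom c f d)"
    using quadrant_open_loc_dom[OF A B] f c d by (simp add: smooth_map_def charts_at_iff)
  show "cmap c p \<in> loc_dom c f d"
    using c d by (auto simp: loc_dom_def charts_at_iff)
qed

lemma chart_jac_compose:
  assumes A: "smooth_atlas A" and B: "smooth_atlas B" and C: "smooth_atlas C"
    and f: "smooth_map A B f" and g: "smooth_map B C g"
    and c: "c \<in> charts_at A p" and d: "d \<in> charts_at B (f p)" and e: "e \<in> charts_at C (g (f p))"
  shows "chart_jac c (\<lambda>p. g (f p)) e p v = chart_jac d g e (f p) (chart_jac c f d p v)"
proof -
  have c': "c \<in> atlas A" "p \<in> cdom c" and d': "d \<in> atlas B" "f p \<in> cdom d" and e': "e \<in> atlas C" "g (f p) \<in> cdom e"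
    using c d e by (simp_all add: charts_at_iff)
  note cc = smooth_atlas_corner_chart[OF A c'(1)]
  note cd = smooth_atlas_corner_chart[OF B d'(1)]
  have fc: "continuous_map (mtop A) (mtop B) f" and gc: "continuous_map (mtop B) (mtop C) g"
    using f g by (simp_all add: smooth_map_def)
  have gfc: "continuous_map (mtop A) (mtop C) (\<lambda>p. g (f p))"
    using continuous_map_compose[OF fc gc] by (simp add: o_def)
  \<comment> \<open>The composite may be defined in the charts \<open>c\<close> and \<open>e\<close>
    at points that \<open>f\<close> sends outside \<open>d\<close>. On \<open>N\<close> all three
    charts apply, and its image is open in a quadrant, which is enough for
    \<open>jac_cong\<close>.\<close>
  define N where "N = {q \<in> {q \<in> cdom c. f q \<in> cdom d}. g (f q) \<in> cdom e}"
  have N: "openin (mtop A) N"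
    unfolding N_def
    by (rule openin_chart_preimage[OF C gfc openin_chart_preimage[OF B fc corner_chart_openin[OF cc] d'(1)] e'(1)])
  have Nc: "cdom c \<inter> N = N" and pN: "p \<in> N"
    using c' d' e' by (auto simp: N_def)
  have q: "quadrant_open (cdim c) (cmap c ` N)"
    using corner_chart_quadrant_open[OF cc N] by (simp add: Nc)
  have cN: "cinv c (cmap c q) = q" if "q \<in> N" for q
    using that cinv_cmap[OF cc] by (simp add: N_def)
  have "chart_jac c (\<lambda>p. g (f p)) e p v = jac (cdim c) (cdim e) (\<lambda>z. loc_rep d g e (loc_rep c f d z)) (cmap c p) v"
    unfolding chart_jac_def
  proof (rule jac_cong[OF q])
    fix z assume "z \<in> cmap c ` N"
    then obtain q where "q \<in> N" "z = cmap c q" by blast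
    then show "loc_rep c (\<lambda>p. g (f p)) e z = loc_rep d g e (loc_rep c f d z)"
      using cinv_cmap[OF cd, of "f q"] by (simp add: loc_rep_def cN) (simp add: N_def)
  qed (use pN in auto)
  also have "\<dots> = jac (cdim d) (cdim e) (loc_rep d g e) (loc_rep c f d (cmap c p)) (jac (cdim c) (cdim d) (loc_rep c f d) (cmap c p) v)"
  proof (rule jac_compose)
    have sub: "cmap c ` N \<subseteq> loc_dom c f d" by (auto simp: N_def loc_dom_def)
    have "smooth_on (cdim c) (cdim d) (loc_dom c f d) (loc_rep c f d)"
      using f c'(1) d'(1) by (simp add: smooth_map_def)
    then show "smooth_on (cdim c) (cdim d) (cmap c ` N) (loc_rep c f d)"
      using sub smooth_fun_subset[OF _ sub] by (auto simp: smooth_on_iff)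
    show "loc_rep c f d \<in> cmap c ` N \<rightarrow> loc_dom d g e"
      by (auto simp: loc_rep_def loc_dom_def cN) (auto simp: N_def)
    show "smooth_on (cdim d) (cdim e) (loc_dom d g e) (loc_rep d g e)"
      using g d'(1) e'(1) by (simp add: smooth_map_def)
    show "quadrant_open (cdim d) (loc_dom d g e)"
      by (rule quadrant_open_loc_dom[OF B C gc d'(1) e'(1)])
  qed (use q pN in auto)
  also have "loc_rep c f d (cmap c p) = cmap d (f p)"
    by (simp add: loc_rep_def cN pN)
  finally show ?thesis by (simp add: chart_jac_def)
qed

lemma chart_jac_id:
  assumes M: "smooth_atlas M" and c: "c \<in> charts_at M p" and v: "v \<in> topspace (\<E> (cdim c))"
  shows "chart_jac c (\<lambda>p. p) c p v = v"
proof -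
  have c': "c \<in> atlas M" "p \<in> cdom c" using c by (simp_all add: charts_at_iff)
  note cc = smooth_atlas_corner_chart[OF M c'(1)]
  have "chart_jac c (\<lambda>p. p) c p v = jac (cdim c) (cdim c) (\<lambda>z. z) (cmap c p) v"
    unfolding chart_jac_def
    by (rule jac_cong[OF corner_chart_quadrant_open[OF cc corner_chart_openin[OF cc]]])
      (use c' in \<open>auto simp: loc_rep_def cinv_cmap[OF cc]\<close>)
  then show ?thesis by (simp add: jac_id[OF v])
qed

lemma chart_jac_cong:
  assumes A: "smooth_atlas A" and c: "c \<in> charts_at A p" and fg: "\<And>q. q \<in> points A \<Longrightarrow> f q = g q"
  shows "chart_jac c f d p v = chart_jac c g d p v"
proof -
  have c': "c \<in> atlas A" "p \<in> cdom c" using c by (simp_all add: charts_at_iff)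
  note cc = smooth_atlas_corner_chart[OF A c'(1)]
  have "cdom c \<subseteq> points A" using A c'(1) by (auto simp: smooth_atlas_def)
  then show ?thesis
    unfolding chart_jac_def
    by (intro jac_cong[OF corner_chart_quadrant_open[OF cc corner_chart_openin[OF cc]]])
      (use c' fg in \<open>auto simp: loc_rep_def cinv_cmap[OF cc] subset_iff\<close>)
qed

section \<open>Tangent vectors and functoriality of T\<close>

lemma tangent_space_iff:
  assumes M: "smooth_atlas M"
  shows "v \<in> tangent_space M p \<longleftrightarrow> v \<in> (\<Pi>\<^sub>E c\<in>charts_at M p. topspace (\<E> (cdim c))) \<and>
     (\<forall>c\<in>charts_at M p. \<forall>d\<in>charts_at M p. v d = chart_jac c (\<lambda>p. p) d p (v c))"
  using jacobian_loc_rep[OF M M smooth_map_id[OF M]] by (simp add: tangent_space_def)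

lemma tangent_space_extensional: "v \<in> tangent_space M p \<Longrightarrow> v \<in> extensional (charts_at M p)"
  unfolding tangent_space_def PiE_iff by blast

lemma tangent_space_Euclidean:
  "v \<in> tangent_space M p \<Longrightarrow> c \<in> charts_at M p \<Longrightarrow> v c \<in> topspace (\<E> (cdim c))"
  unfolding tangent_space_def by (drule CollectD, drule conjunct1, erule PiE_mem)

lemma charts_at_nonempty: "smooth_atlas M \<Longrightarrow> p \<in> points M \<Longrightarrow> \<exists>c. c \<in> charts_at M p"
  by (auto simp: smooth_atlas_def charts_at_def)

lemma fst_tangent_map [simp]: "fst (tangent_map M N f u) = f (fst u)"
  by (simp add: tangent_map_def split_beta)

text \<open>\<open>tangent_map\<close> evaluates in a chart picked by \<open>SOME\<close>. The
  transformation law of \<open>v\<close> together with the chain rule for the identity followed by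
  \<open>f\<close> allows every chart \<open>c\<close> in its place.\<close>

lemma snd_tangent_map:
  assumes M: "smooth_atlas M" and N: "smooth_atlas N" and f: "smooth_map M N f"
    and v: "v \<in> tangent_space M p" and c: "c \<in> charts_at M p" and d: "d \<in> charts_at N (f p)"
  shows "snd (tangent_map M N f (p, v)) d = chart_jac c f d p (v c)"
proof -
  define c0 where "c0 = (SOME c. c \<in> charts_at M p)"
  have c0: "c0 \<in> charts_at M p" unfolding c0_def using c by (rule someI)
  have "snd (tangent_map M N f (p, v)) d = chart_jac c0 f d p (v c0)"
    using d jacobian_loc_rep[OF M N f c0 d] by (simp add: tangent_map_def Let_def flip: c0_def)
  also have "v c0 = chart_jac c (\<lambda>p. p) c0 p (v c)"
    using v c c0 unfolding tangent_space_iff[OF M] by blast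
  also have "chart_jac c0 f d p \<dots> = chart_jac c f d p (v c)"
    using chart_jac_compose[OF M M N smooth_map_id[OF M] f c c0 d] by simp
  finally show ?thesis .
qed

text \<open>The transformation law in \<open>N\<close> is the chain rule for \<open>f\<close>
  followed by the identity of \<open>N\<close>, read in two charts.\<close>

lemma tangent_map_in_tangent_space:
  assumes M: "smooth_atlas M" and N: "smooth_atlas N" and f: "smooth_map M N f"
    and p: "p \<in> points M" and v: "v \<in> tangent_space M p"
  shows "snd (tangent_map M N f (p, v)) \<in> tangent_space N (f p)"
proof -
  obtain c where c: "c \<in> charts_at M p" using charts_at_nonempty[OF M p] by blast
  note * = snd_tangent_map[OF M N f v c]
  have ext: "snd (tangent_map M N f (p, v)) \<in> extensional (charts_at N (f p))"
    by (simp add: tangent_map_def)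
  have change: "snd (tangent_map M N f (p, v)) d = chart_jac d' (\<lambda>p. p) d (f p) (snd (tangent_map M N f (p, v)) d')"
    if "d \<in> charts_at N (f p)" "d' \<in> charts_at N (f p)" for d d'
    unfolding *[OF that(1)] *[OF that(2)]
    using chart_jac_compose[OF M N N f smooth_map_id[OF N] c that(2,1)] .
  show ?thesis
    unfolding tangent_space_iff[OF N] PiE_iff
  proof (intro conjI ballI ext)
    show "snd (tangent_map M N f (p, v)) d \<in> topspace (\<E> (cdim d))" if "d \<in> charts_at N (f p)" for d
      unfolding *[OF that] by simp
  qed (rule change)
qed

lemma tangent_vector_eqI:
  assumes "v \<in> tangent_space M p" "w \<in> tangent_space M p" "\<And>c. c \<in> charts_at M p \<Longrightarrow> v c = w c"
  shows "v = w"
  using assms by (intro extensionalityI[of v "charts_at M p" w] tangent_space_extensional)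

text \<open>The underlying set of the tangent bundle, described without its generated topology;
  \<open>points_tangent_bundle\<close> identifies the two.\<close>

definition tangent_vectors :: "'p mfd \<Rightarrow> 'p tvec set" where
  "tangent_vectors M = Sigma (points M) (tangent_space M)"

lemma tangent_vectors_iff: "u \<in> tangent_vectors M \<longleftrightarrow> fst u \<in> points M \<and> snd u \<in> tangent_space M (fst u)"
  by (cases u) (simp add: tangent_vectors_def)

lemma tangent_map_in:
  assumes "smooth_atlas M" "smooth_atlas N" "smooth_map M N f" "u \<in> tangent_vectors M"
  shows "tangent_map M N f u \<in> tangent_vectors N"
  using assms tangent_map_in_tangent_space[OF assms(1-3), of "fst u" "snd u"] smooth_map_in_points[OF assms(3)]
  by (simp add: tangent_vectors_iff)

lemma tangent_vectors_eqI:
  assumes "u \<in> tangent_vectors M" "w \<in> tangent_vectors M" "fst u = fst w"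
    and "\<And>c. c \<in> charts_at M (fst u) \<Longrightarrow> snd u c = snd w c"
  shows "u = w"
  using assms tangent_vector_eqI[of "snd u" M "fst u" "snd w"]
  by (auto simp: tangent_vectors_iff intro: prod_eqI)

text \<open>Both sides are computed in one chart around \<open>p\<close> and one around
  \<open>f p\<close>; by \<open>snd_tangent_map\<close> the choice does not matter.\<close>

lemma tangent_map_compose:
  assumes A: "smooth_atlas A" and B: "smooth_atlas B" and C: "smooth_atlas C"
    and f: "smooth_map A B f" and g: "smooth_map B C g" and u: "u \<in> tangent_vectors A"
  shows "tangent_map B C g (tangent_map A B f u) = tangent_map A C (\<lambda>p. g (f p)) u"
proof (rule tangent_vectors_eqI[where M=C])
  have gf: "smooth_map A C (\<lambda>p. g (f p))"
    by (rule smooth_map_compose[OF A B f g smooth_atlas_Euclidean_charts[OF C]])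
  have fu: "tangent_map A B f u \<in> tangent_vectors B" by (rule tangent_map_in[OF A B f u])
  show "tangent_map B C g (tangent_map A B f u) \<in> tangent_vectors C" by (rule tangent_map_in[OF B C g fu])
  show "tangent_map A C (\<lambda>p. g (f p)) u \<in> tangent_vectors C" by (rule tangent_map_in[OF A C gf u])
  fix e assume "e \<in> charts_at C (fst (tangent_map B C g (tangent_map A B f u)))"
  then have e: "e \<in> charts_at C (g (f (fst u)))" by simp
  obtain p v where uv: "u = (p, v)" by (cases u)
  have p: "p \<in> points A" and v: "v \<in> tangent_space A p" using u by (auto simp: uv tangent_vectors_iff)
  obtain c where c: "c \<in> charts_at A p" using charts_at_nonempty[OF A p] by blast
  obtain d where d: "d \<in> charts_at B (f p)" using charts_at_nonempty[OF B smooth_map_in_points[OF f p]] by blast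
  have "snd (tangent_map B C g (f p, snd (tangent_map A B f u))) e = chart_jac d g e (f p) (snd (tangent_map A B f u) d)"
    by (rule snd_tangent_map[OF B C g _ d]) (use fu e in \<open>auto simp: tangent_vectors_iff uv\<close>)
  also have "\<dots> = chart_jac d g e (f p) (chart_jac c f d p (v c))"
    by (simp add: uv snd_tangent_map[OF A B f v c d])
  also have "\<dots> = chart_jac c (\<lambda>p. g (f p)) e p (v c)"
    by (rule chart_jac_compose[symmetric, OF A B C f g c d]) (use e uv in auto)
  also have "\<dots> = snd (tangent_map A C (\<lambda>p. g (f p)) u) e"
    using snd_tangent_map[OF A C gf v c] e by (simp add: uv)
  also have "(f p, snd (tangent_map A B f u)) = tangent_map A B f u"
    by (simp add: prod_eq_iff uv)
  finally show "snd (tangent_map B C g (tangent_map A B f u)) e = snd (tangent_map A C (\<lambda>p. g (f p)) u) e" .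
qed simp

lemma tangent_map_id:
  assumes M: "smooth_atlas M" and u: "u \<in> tangent_vectors M"
  shows "tangent_map M M (\<lambda>p. p) u = u"
proof (rule tangent_vectors_eqI[where M=M])
  show "tangent_map M M (\<lambda>p. p) u \<in> tangent_vectors M" by (rule tangent_map_in[OF M M smooth_map_id[OF M] u])
  fix c assume "c \<in> charts_at M (fst (tangent_map M M (\<lambda>p. p) u))"
  then have c: "c \<in> charts_at M (fst u)" by simp
  have v: "snd u \<in> tangent_space M (fst u)" using u by (simp add: tangent_vectors_iff)
  then have "snd u c \<in> topspace (\<E> (cdim c))"
    using c by (rule tangent_space_Euclidean)
  then show "snd (tangent_map M M (\<lambda>p. p) u) c = snd u c"
    using snd_tangent_map[OF M M smooth_map_id[OF M] v c c] chart_jac_id[OF M c] by simp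
qed (use u in auto)

lemma tangent_map_cong:
  assumes M: "smooth_atlas M" and N: "smooth_atlas N" and f: "smooth_map M N f"
    and fg: "\<And>p. p \<in> points M \<Longrightarrow> f p = g p" and u: "u \<in> tangent_vectors M"
  shows "tangent_map M N f u = tangent_map M N g u"
proof (rule tangent_vectors_eqI[where M=N])
  have g: "smooth_map M N g" by (rule smooth_map_cong[OF M fg f])
  have p: "fst u \<in> points M" and v: "snd u \<in> tangent_space M (fst u)" using u by (auto simp: tangent_vectors_iff)
  show "tangent_map M N f u \<in> tangent_vectors N" by (rule tangent_map_in[OF M N f u])
  show "tangent_map M N g u \<in> tangent_vectors N" by (rule tangent_map_in[OF M N g u])
  show "fst (tangent_map M N f u) = fst (tangent_map M N g u)" using fg[OF p] by simp
  fix d assume "d \<in> charts_at N (fst (tangent_map M N f u))"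
  then have d: "d \<in> charts_at N (f (fst u))" "d \<in> charts_at N (g (fst u))" using fg[OF p] by auto
  obtain c where c: "c \<in> charts_at M (fst u)" using charts_at_nonempty[OF M p] by blast
  show "snd (tangent_map M N f u) d = snd (tangent_map M N g u) d"
    using snd_tangent_map[OF M N f v c d(1)] snd_tangent_map[OF M N g v c d(2)]
      chart_jac_cong[OF M c fg] by simp
qed

section \<open>Charts of the tangent bundle and smooth maps into it\<close>

lemma cdom_tchart: "cdom (tchart M c) = Sigma (cdom c) (tangent_space M)"
  and cdim_tchart: "cdim (tchart M c) = 2 * cdim c"
  and cmap_tchart: "cmap (tchart M c) u i = (if i < cdim c then cmap c (fst u) i else snd u c (i - cdim c))"
  by (simp_all add: tchart_def split_beta)

lemma cdom_tchart_iff: "u \<in> cdom (tchart M c) \<longleftrightarrow> fst u \<in> cdom c \<and> snd u \<in> tangent_space M (fst u)"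
  by (cases u) (simp add: cdom_tchart)

lemma cmap_tchart_Euclidean:
  assumes "smooth_atlas M" "c \<in> atlas M" "u \<in> cdom (tchart M c)"
  shows "cmap (tchart M c) u \<in> topspace (\<E> (2 * cdim c))"
proof -
  have "c \<in> charts_at M (fst u)" "snd u \<in> tangent_space M (fst u)"
    using assms(2,3) by (simp_all add: cdom_tchart_iff charts_at_iff)
  then have "snd u c \<in> topspace (\<E> (cdim c))"
    by (rule tangent_space_Euclidean[rotated])
  then show ?thesis
    by (auto simp: topspace_Euclidean_space cmap_tchart)
qed

lemma Euclidean_charts_tangent_bundle:
  assumes "smooth_atlas M"
  shows "Euclidean_charts (tangent_bundle M)"
  unfolding Euclidean_charts_def tangent_bundle_def
  using cmap_tchart_Euclidean[OF assms] by (auto simp: cdim_tchart)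

lemma points_tangent_bundle:
  assumes M: "smooth_atlas M"
  shows "points (tangent_bundle M) = tangent_vectors M"
proof -
  have "u \<in> cdom (tchart M c) \<Longrightarrow> c \<in> atlas M \<Longrightarrow> u \<in> tangent_vectors M" for u c
    using M by (auto simp: cdom_tchart_iff tangent_vectors_iff smooth_atlas_def)
  moreover have "\<exists>c\<in>atlas M. u \<in> cdom (tchart M c) \<and> cmap (tchart M c) u \<in> topspace (\<E> (2 * cdim c))"
    if u: "u \<in> tangent_vectors M" for u
  proof -
    obtain c where "c \<in> charts_at M (fst u)" using charts_at_nonempty[OF M] u by (auto simp: tangent_vectors_iff)
    then have c: "c \<in> atlas M" "u \<in> cdom (tchart M c)"
      using u by (simp_all add: charts_at_iff cdom_tchart_iff tangent_vectors_iff)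
    with cmap_tchart_Euclidean[OF M this] show ?thesis by blast
  qed
  moreover have "points (tangent_bundle M) = \<Union>{{u \<in> cdom (tchart M c). cmap (tchart M c) u \<in> V} | c V.
            c \<in> atlas M \<and> openin (\<E> (2 * cdim c)) V}"
    by (simp add: points_def tangent_bundle_def topology_generated_by_topspace)
  ultimately show ?thesis by blast
qed

text \<open>With a smooth base map, half of the coordinates in each \<open>tchart\<close> are
  settled, and the fibre coordinates remain. Continuity into the generated topology is a consequence
  of smoothness of the coordinates.\<close>

lemma smooth_map_tangent_bundle_iff:
  assumes A: "smooth_atlas A" and M: "smooth_atlas M" and f: "smooth_map A M (\<lambda>p. fst (V p))"
    and V: "V \<in> points A \<rightarrow> tangent_vectors M"
  shows "smooth_map A (tangent_bundle M) V \<longleftrightarrow>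
    (\<forall>c\<in>atlas A. \<forall>d\<in>atlas M. \<forall>i<cdim d. chart_smooth c {p \<in> cdom c. fst (V p) \<in> cdom d} (\<lambda>p. snd (V p) d i))"
    (is "_ \<longleftrightarrow> ?R")
proof -
  let ?U = "\<lambda>c d. {p \<in> cdom c. fst (V p) \<in> cdom d}"
  have cA: "cdom c \<subseteq> points A" if "c \<in> atlas A" for c using A that by (auto simp: smooth_atlas_def)
  have dom: "{p \<in> cdom c. V p \<in> cdom (tchart M d)} = ?U c d" if "c \<in> atlas A" for c d
    using V cA[OF that] by (auto simp: cdom_tchart_iff tangent_vectors_iff)
  have base: "chart_smooth c (?U c d) (\<lambda>p. cmap d (fst (V p)) i)" if "c \<in> atlas A" "d \<in> atlas M" "i < cdim d" for c d i
    by (rule smooth_mapD[OF f that(1,2) _ _ that(3)]) auto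
  have comp: "(\<forall>j<cdim (tchart M d). chart_smooth c {p \<in> cdom c. V p \<in> cdom (tchart M d)} (\<lambda>p. cmap (tchart M d) (V p) j)) \<longleftrightarrow>
      (\<forall>i<cdim d. chart_smooth c (?U c d) (\<lambda>p. snd (V p) d i))" if "c \<in> atlas A" "d \<in> atlas M" for c d
    unfolding dom[OF that(1)] cdim_tchart
  proof (intro iffI allI impI)
    fix i assume *: "\<forall>j<2 * cdim d. chart_smooth c (?U c d) (\<lambda>p. cmap (tchart M d) (V p) j)" and i: "i < cdim d"
    \<comment> \<open>Fibre coordinates are stored after the base coordinates, hence the shift by
      \<open>cdim d\<close>.\<close>
    then have "chart_smooth c (?U c d) (\<lambda>p. cmap (tchart M d) (V p) (cdim d + i))" by simp
    then show "chart_smooth c (?U c d) (\<lambda>p. snd (V p) d i)" by (simp add: cmap_tchart)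
  next
    fix j assume *: "\<forall>i<cdim d. chart_smooth c (?U c d) (\<lambda>p. snd (V p) d i)" and j: "j < 2 * cdim d"
    show "chart_smooth c (?U c d) (\<lambda>p. cmap (tchart M d) (V p) j)"
    proof (cases "j < cdim d")
      case True then show ?thesis using base[OF that] by (simp add: cmap_tchart)
    next
      case False
      then have "j - cdim d < cdim d" using j by simp
      then show ?thesis using * False by (simp add: cmap_tchart)
    qed
  qed
  have atl: "atlas (tangent_bundle M) = tchart M ` atlas M" by (simp add: tangent_bundle_def)
  have "continuous_map (mtop A) (mtop (tangent_bundle M)) V" if R: ?R
  proof -
    \<comment> \<open>These sets generate the topology of the bundle, so their preimages decide
      continuity. Near each point the preimage is that of \<open>W\<close> under continuous
      coordinates.\<close>
    have "openin (mtop A) (V -` {u \<in> cdom (tchart M d). cmap (tchart M d) u \<in> W} \<inter> topspace (mtop A))"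
      if d: "d \<in> atlas M" and W: "openin (\<E> (2 * cdim d)) W" for d W
    proof (subst openin_subopen, intro ballI)
      fix p assume p: "p \<in> V -` {u \<in> cdom (tchart M d). cmap (tchart M d) u \<in> W} \<inter> topspace (mtop A)"
      then have "p \<in> points A" by (simp add: points_def)
      then obtain c where c: "c \<in> atlas A" "p \<in> cdom c" "corner_chart (mtop A) c"
        using smooth_atlas_chartE[OF A] by blast
      have N: "openin (mtop A) (?U c d)"
        using openin_chart_preimage[OF M _ corner_chart_openin[OF c(3)] d] f by (simp add: smooth_map_def)
      have top: "topspace (subtopology (mtop A) (?U c d)) = ?U c d"
        using openin_subset[OF N] by auto
      have mem: "V q \<in> cdom (tchart M d)" if "q \<in> ?U c d" for q
        using that dom[OF c(1), of d] by blast
      have "continuous_map (subtopology (mtop A) (?U c d)) (\<E> (2 * cdim d)) (\<lambda>q. cmap (tchart M d) (V q))"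
      proof (rule continuous_map_into_Euclidean_space)
        show "cmap (tchart M d) (V q) \<in> topspace (\<E> (2 * cdim d))"
          if "q \<in> topspace (subtopology (mtop A) (?U c d))" for q
          using cmap_tchart_Euclidean[OF M d mem] that top by blast
        show "continuous_map (subtopology (mtop A) (?U c d)) euclideanreal (\<lambda>q. cmap (tchart M d) (V q) j)"
          if "j < 2 * cdim d" for j
          using comp[OF c(1) d] R c(1) d that dom[OF c(1), of d]
          by (intro chart_smooth_continuous[OF c(3)]) (auto simp: cdim_tchart)
      qed
      from openin_continuous_map_preimage[OF this W]
      have "openin (subtopology (mtop A) (?U c d)) {q \<in> ?U c d. cmap (tchart M d) (V q) \<in> W}" unfolding top .
      then have "openin (mtop A) {q \<in> ?U c d. cmap (tchart M d) (V q) \<in> W}"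
        using N openin_trans_full by blast
      moreover have "p \<in> {q \<in> ?U c d. cmap (tchart M d) (V q) \<in> W}"
        using p c(2) by (auto simp: cdom_tchart_iff)
      moreover have "{q \<in> ?U c d. cmap (tchart M d) (V q) \<in> W} \<subseteq> V -` {u \<in> cdom (tchart M d). cmap (tchart M d) u \<in> W} \<inter> topspace (mtop A)"
        using mem openin_subset[OF N] by blast
      ultimately show "\<exists>T. openin (mtop A) T \<and> p \<in> T \<and> T \<subseteq> V -` {u \<in> cdom (tchart M d). cmap (tchart M d) u \<in> W} \<inter> topspace (mtop A)"
        by blast
    qed
    moreover have "V ` topspace (mtop A) \<subseteq> points (tangent_bundle M)"
      using V points_tangent_bundle[OF M] by (auto simp: points_def)
    ultimately show ?thesis
      unfolding tangent_bundle_def points_def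
      by (auto simp: continuous_on_generated_topo_iff topology_generated_by_topspace)
  qed
  then show ?thesis
    unfolding smooth_map_iff[OF A Euclidean_charts_tangent_bundle[OF M]] atl using comp by blast
qed

lemma smooth_map_tangent_vectors:
  assumes "smooth_atlas M" "smooth_map A (tangent_bundle M) V"
  shows "V \<in> points A \<rightarrow> tangent_vectors M"
  using smooth_map_in_points[OF assms(2)] by (simp add: points_tangent_bundle[OF assms(1)])

text \<open>Smoothness of Tf is stated after composition with \<open>V\<close>, which is the form
  needed for controls and keeps the tangent bundle in the position of a target.\<close>

lemma smooth_map_tangent_map:
  assumes A: "smooth_atlas A" and M: "smooth_atlas M" and N: "smooth_atlas N"
    and f: "smooth_map M N f" and g: "smooth_map A M (\<lambda>p. fst (V p))" and V: "smooth_map A (tangent_bundle M) V"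
  shows "smooth_map A (tangent_bundle N) (\<lambda>p. tangent_map M N f (V p))"
proof -
  note VT = smooth_map_tangent_vectors[OF M V]
  have fg: "smooth_map A N (\<lambda>p. fst (tangent_map M N f (V p)))"
    using smooth_map_compose[OF A M g f smooth_atlas_Euclidean_charts[OF N]] by simp
  have TVT: "(\<lambda>p. tangent_map M N f (V p)) \<in> points A \<rightarrow> tangent_vectors N"
    using VT tangent_map_in[OF M N f] by blast
  show ?thesis
    unfolding smooth_map_tangent_bundle_iff[OF A N fg TVT]
  proof (intro ballI allI impI)
    fix c d i assume c: "c \<in> atlas A" and d: "d \<in> atlas N" and i: "i < cdim d"
    note cc = smooth_atlas_corner_chart[OF A c]
    have cA: "cdom c \<subseteq> points A" using A c by (auto simp: smooth_atlas_def)
    let ?U = "{p \<in> cdom c. fst (tangent_map M N f (V p)) \<in> cdom d}"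
    show "chart_smooth c ?U (\<lambda>p. snd (tangent_map M N f (V p)) d i)"
    proof (rule chart_smooth_local[OF cc])
      fix p assume p: "p \<in> ?U"
      then have "fst (V p) \<in> points M" using VT cA by (auto simp: tangent_vectors_iff)
      then obtain e where e: "e \<in> atlas M" "fst (V p) \<in> cdom e" "corner_chart (mtop M) e"
        using smooth_atlas_chartE[OF M] by blast
      let ?N = "{q \<in> cdom c. fst (V q) \<in> cdom e}"
      have N': "openin (mtop A) ?N"
        using openin_chart_preimage[OF M _ corner_chart_openin[OF cc] e(1)] g by (simp add: smooth_map_def)
      let ?S = "cmap c ` (?U \<inter> ?N)"
      have "smooth_fun (cdim c) ?S (\<lambda>z. jac (cdim e) (cdim d) (loc_rep e f d) (cmap e (fst (V (cinv c z)))) (snd (V (cinv c z)) e) i)"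
      proof (rule smooth_fun_jac)
        show "smooth_on (cdim e) (cdim d) (loc_dom e f d) (loc_rep e f d)"
          using f e(1) d by (simp add: smooth_map_def)
        show "quadrant_open (cdim e) (loc_dom e f d)"
          using quadrant_open_loc_dom[OF M N _ e(1) d] f by (simp add: smooth_map_def)
        show "?S \<subseteq> topspace (\<E> (cdim c))"
          by (rule corner_chart_image_subset[OF cc]) auto
        show "(\<lambda>z. cmap e (fst (V (cinv c z)))) \<in> ?S \<rightarrow> loc_dom e f d"
          by (auto simp: cinv_cmap[OF cc] loc_dom_def)
        show "smooth_fun (cdim c) ?S (\<lambda>z. cmap e (fst (V (cinv c z))) k)" if "k < cdim e" for k
          using smooth_mapD[OF g c e(1) _ _ that, of "?U \<inter> ?N"] by (auto simp: chart_smooth_def)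
        show "smooth_fun (cdim c) ?S (\<lambda>z. snd (V (cinv c z)) e k)" if "k < cdim e" for k
        proof -
          have "chart_smooth c ?N (\<lambda>p. snd (V p) e k)"
            using V c e(1) that unfolding smooth_map_tangent_bundle_iff[OF A M g VT] by blast
          then have "chart_smooth c (?U \<inter> ?N) (\<lambda>p. snd (V p) e k)" by (rule chart_smooth_subset) auto
          then show ?thesis by (simp add: chart_smooth_def)
        qed
      qed
      then have "chart_smooth c (?U \<inter> ?N) (\<lambda>p. jac (cdim e) (cdim d) (loc_rep e f d) (cmap e (fst (V p))) (snd (V p) e) i)"
        by (simp add: chart_smooth_def)
      moreover have "jac (cdim e) (cdim d) (loc_rep e f d) (cmap e (fst (V q))) (snd (V q) e) i = snd (tangent_map M N f (V q)) d i"
        if q: "q \<in> ?U \<inter> ?N" for q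
      proof -
        have "snd (V q) \<in> tangent_space M (fst (V q))" using q cA VT by (auto simp: tangent_vectors_iff)
        from snd_tangent_map[OF M N f this, of e d] q e(1) d show ?thesis
          by (simp add: charts_at_iff chart_jac_def)
      qed
      ultimately have "chart_smooth c (?U \<inter> ?N) (\<lambda>p. snd (tangent_map M N f (V p)) d i)"
        using chart_smooth_cong[OF cc, of "?U \<inter> ?N"] by (smt (verit, best) IntE mem_Collect_eq subsetI)
      with N' e(2) p show "\<exists>N'. openin (mtop A) N' \<and> p \<in> N' \<and> chart_smooth c (?U \<inter> N') (\<lambda>p. snd (tangent_map M N f (V p)) d i)"
        by blast
    qed auto
  qed
qed

section \<open>Charts of coproducts and products\<close>

text \<open>The homeomorphism condition split into injectivity, continuity and relative openness,
  which are the checks natural for sums and products of charts.\<close>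

lemma corner_chartI:
  assumes D: "openin T (cdom c)" and K: "K \<subseteq> {..<cdim c}"
    and img: "openin (subtopology (\<E> (cdim c)) (quadrant (cdim c) K)) (cmap c ` cdom c)"
    and inj: "inj_on (cmap c) (cdom c)"
    and cont: "continuous_map (subtopology T (cdom c)) (\<E> (cdim c)) (cmap c)"
    and opn: "\<And>N. openin T N \<Longrightarrow> N \<subseteq> cdom c \<Longrightarrow> openin (subtopology (\<E> (cdim c)) (cmap c ` cdom c)) (cmap c ` N)"
  shows "corner_chart T c"
  unfolding corner_chart_def
proof (intro conjI D exI[of _ K] K img)
  have top: "topspace (subtopology T (cdom c)) = cdom c"
    using openin_subset[OF D] by auto
  have imgE: "cmap c ` cdom c \<subseteq> topspace (\<E> (cdim c))"
    using openin_subset[OF img] by auto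
  show "homeomorphic_map (subtopology T (cdom c)) (subtopology (\<E> (cdim c)) (cmap c ` cdom c)) (cmap c)"
  proof (rule bijective_open_imp_homeomorphic_map)
    show "continuous_map (subtopology T (cdom c)) (subtopology (\<E> (cdim c)) (cmap c ` cdom c)) (cmap c)"
      using cont top by (auto simp: continuous_map_in_subtopology)
    show "open_map (subtopology T (cdom c)) (subtopology (\<E> (cdim c)) (cmap c ` cdom c)) (cmap c)"
      unfolding open_map_def using opn openin_open_subtopology[OF D] by simp
    show "cmap c ` topspace (subtopology T (cdom c)) = topspace (subtopology (\<E> (cdim c)) (cmap c ` cdom c))"
      unfolding top using imgE by auto
    show "inj_on (cmap c) (topspace (subtopology T (cdom c)))"
      unfolding top by (rule inj)
  qed
qed

lemma chart_smooth_coordinate: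
  assumes c: "corner_chart T c" and U: "U \<subseteq> cdom c"
  shows "chart_smooth c U (\<lambda>p. cmap c p j)"
proof -
  have "smooth_fun (cdim c) (cmap c ` U) (\<lambda>z. z j)"
    by (rule smooth_fun_coordinate[OF corner_chart_image_subset[OF c U]])
  moreover have "smooth_fun (cdim c) (cmap c ` U) (\<lambda>z. z j) \<longleftrightarrow> smooth_fun (cdim c) (cmap c ` U) (\<lambda>z. cmap c (cinv c z) j)"
    by (rule smooth_fun_cong) (use U in \<open>auto simp: cinv_cmap[OF c]\<close>)
  ultimately show ?thesis by (simp add: chart_smooth_def)
qed

section \<open>Coproducts\<close>

definition sum_chart :: "'s \<Rightarrow> 'p chart \<Rightarrow> ('s \<times> 'p) chart" where
  "sum_chart s c = \<lparr> cdom = {s} \<times> cdom c, cdim = cdim c, cmap = (\<lambda>(_, p). cmap c p) \<rparr>"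

lemma sum_chart_simps [simp]:
  "cdom (sum_chart s c) = {s} \<times> cdom c" "cdim (sum_chart s c) = cdim c" "cmap (sum_chart s c) u = cmap c (snd u)"
  by (simp_all add: sum_chart_def split_beta)

lemma atlas_mfd_sum: "atlas (mfd_sum S M) = {sum_chart s c | s c. s \<in> S \<and> c \<in> atlas (M s)}"
  and mtop_mfd_sum: "mtop (mfd_sum S M) = sum_topology (\<lambda>s. mtop (M s)) S"
  by (simp_all add: mfd_sum_def sum_chart_def)

lemma points_mfd_sum: "points (mfd_sum S M) = Sigma S (\<lambda>s. points (M s))"
  by (simp add: points_def mtop_mfd_sum o_def)

lemma openin_sum_slice:
  assumes "s \<in> S" "openin (T s) U"
  shows "openin (sum_topology T S) ({s} \<times> U)"
proof -
  have "openin (T i) {x. (i, x) \<in> {s} \<times> U}" if "i \<in> S" for i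
    using assms(2) by (cases "i = s") auto
  then show ?thesis
    using assms openin_subset[OF assms(2)] by (auto simp: openin_sum_topology)
qed

text \<open>The image of the chart is that of \<open>c\<close>, so the same quadrant serves; only
  openness has to be moved between a slice and the sum.\<close>

lemma corner_chart_sum_chart:
  assumes s: "s \<in> S" and c: "corner_chart (mtop (M s)) c"
  shows "corner_chart (mtop (mfd_sum S M)) (sum_chart s c)"
proof -
  obtain K where K: "K \<subseteq> {..<cdim c}" "openin (subtopology (\<E> (cdim c)) (quadrant (cdim c) K)) (cmap c ` cdom c)"
    using c unfolding corner_chart_def by blast
  have img: "cmap (sum_chart s c) ` ({s} \<times> U) = cmap c ` U" for U
    by force
  have D: "openin (mtop (mfd_sum S M)) ({s} \<times> cdom c)"
    unfolding mtop_mfd_sum by (rule openin_sum_slice[where T="\<lambda>s. mtop (M s)", OF s corner_chart_openin[OF c]])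
  show ?thesis
  proof (rule corner_chartI[where K=K])
    show "inj_on (cmap (sum_chart s c)) (cdom (sum_chart s c))"
      using corner_chart_inj[OF c] by (auto simp: inj_on_def)
    show "continuous_map (subtopology (mtop (mfd_sum S M)) (cdom (sum_chart s c)))
        (\<E> (cdim (sum_chart s c))) (cmap (sum_chart s c))"
      unfolding continuous_map_def
    proof (intro conjI allI impI)
      show "cmap (sum_chart s c) \<in> topspace (subtopology (mtop (mfd_sum S M)) (cdom (sum_chart s c)))
          \<rightarrow> topspace (\<E> (cdim (sum_chart s c)))"
        using corner_chart_Euclidean[OF c] by auto
      fix W assume "openin (\<E> (cdim (sum_chart s c))) W"
      then have "openin (subtopology (mtop (M s)) (cdom c)) {p \<in> topspace (subtopology (mtop (M s)) (cdom c)). cmap c p \<in> W}"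
        using corner_chart_continuous[OF c order_refl] by (simp add: continuous_map_def)
      then have op: "openin (mtop (M s)) {p \<in> topspace (subtopology (mtop (M s)) (cdom c)). cmap c p \<in> W}"
        using corner_chart_openin[OF c] openin_trans_full by blast
      have "openin (mtop (mfd_sum S M)) ({s} \<times> {p \<in> topspace (subtopology (mtop (M s)) (cdom c)). cmap c p \<in> W})"
        unfolding mtop_mfd_sum by (rule openin_sum_slice[where T="\<lambda>s. mtop (M s)", OF s op])
      moreover have "{s} \<times> {p \<in> topspace (subtopology (mtop (M s)) (cdom c)). cmap c p \<in> W} =
          {u \<in> topspace (subtopology (mtop (mfd_sum S M)) (cdom (sum_chart s c))). cmap (sum_chart s c) u \<in> W}"
        using s by (auto simp: mtop_mfd_sum)
      ultimately show "openin (subtopology (mtop (mfd_sum S M)) (cdom (sum_chart s c)))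
          {u \<in> topspace (subtopology (mtop (mfd_sum S M)) (cdom (sum_chart s c))). cmap (sum_chart s c) u \<in> W}"
        using D by (simp add: openin_open_subtopology) blast
    qed
    fix N assume N: "openin (mtop (mfd_sum S M)) N" "N \<subseteq> cdom (sum_chart s c)"
    then have op: "openin (mtop (M s)) {x. (s, x) \<in> N}"
      using s by (simp add: mtop_mfd_sum openin_sum_topology)
    have "N = {s} \<times> {x. (s, x) \<in> N}" using N(2) by auto
    then have "cmap (sum_chart s c) ` N = cmap c ` {x. (s, x) \<in> N}" using img by metis
    also have "{x. (s, x) \<in> N} = cdom c \<inter> {x. (s, x) \<in> N}" using N(2) by auto
    finally have eq: "cmap (sum_chart s c) ` N = cmap c ` (cdom c \<inter> {x. (s, x) \<in> N})" .
    obtain W where "openin (\<E> (cdim c)) W" "cmap c ` (cdom c \<inter> {x. (s, x) \<in> N}) = W \<inter> cmap c ` cdom c"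
      using corner_chart_open_image[OF c op] by blast
    then show "openin (subtopology (\<E> (cdim (sum_chart s c))) (cmap (sum_chart s c) ` cdom (sum_chart s c))) (cmap (sum_chart s c) ` N)"
      unfolding eq sum_chart_simps(1,2) img openin_subtopology by blast
  qed (use K D img in \<open>simp_all only: sum_chart_simps\<close>)
qed

lemma chart_smooth_sum_chart:
  fixes M :: "'s \<Rightarrow> 'p mfd"
  assumes s: "s \<in> S" and c: "corner_chart (mtop (M s)) c" and V: "V \<subseteq> cdom c"
    and h: "chart_smooth c V (\<lambda>q. h (s, q))"
  shows "chart_smooth (sum_chart s c) ({s} \<times> V) h"
proof -
  note cs = corner_chart_sum_chart[where M=M, OF s c]
  have img: "cmap (sum_chart s c) ` ({s} \<times> V) = cmap c ` V" by force
  have "smooth_fun (cdim c) (cmap c ` V) (\<lambda>z. h (s, cinv c z))"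
    using h by (simp add: chart_smooth_def)
  moreover have "smooth_fun (cdim c) (cmap c ` V) (\<lambda>z. h (s, cinv c z)) \<longleftrightarrow> smooth_fun (cdim c) (cmap c ` V) (\<lambda>z. h (cinv (sum_chart s c) z))"
  proof (rule smooth_fun_cong)
    fix z assume "z \<in> cmap c ` V"
    then obtain q where q: "q \<in> cdom c" "z = cmap c q" using V by blast
    then have "cinv (sum_chart s c) z = (s, q)" using cinv_cmap[OF cs, of "(s, q)"] by simp
    then show "h (s, cinv c z) = h (cinv (sum_chart s c) z)" using cinv_cmap[OF c q(1)] q(2) by simp
  qed
  ultimately show ?thesis by (simp only: chart_smooth_def img sum_chart_simps)
qed

lemma smooth_atlasI:
  assumes "\<And>c. c \<in> atlas M \<Longrightarrow> corner_chart (mtop M) c"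
    and "\<And>p. p \<in> points M \<Longrightarrow> \<exists>c\<in>atlas M. p \<in> cdom c"
    and "\<And>c d j. c \<in> atlas M \<Longrightarrow> d \<in> atlas M \<Longrightarrow> j < cdim d \<Longrightarrow> chart_smooth c (cdom c \<inter> cdom d) (\<lambda>p. cmap d p j)"
  shows "smooth_atlas M"
  unfolding smooth_atlas_def
proof (intro conjI ballI)
  show "points M = \<Union> (cdom ` atlas M)"
    using assms(2) openin_subset[OF corner_chart_openin[OF assms(1)]] by (fastforce simp: points_def)
  fix c d assume c: "c \<in> atlas M" and d: "d \<in> atlas M"
  note cc = assms(1)[OF c] and cd = assms(1)[OF d]
  have "{p \<in> cdom c. p \<in> cdom d} = cdom c \<inter> cdom d" by auto
  then have "loc_dom c (\<lambda>p. p) d = cmap c ` (cdom c \<inter> cdom d)" by (simp add: loc_dom_def)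
  moreover have "cmap c ` (cdom c \<inter> cdom d) \<subseteq> topspace (\<E> (cdim c))"
    by (rule corner_chart_image_subset[OF cc]) auto
  moreover have "loc_rep c (\<lambda>p. p) d \<in> cmap c ` (cdom c \<inter> cdom d) \<rightarrow> topspace (\<E> (cdim d))"
    using corner_chart_Euclidean[OF cd] by (auto simp: loc_rep_def cinv_cmap[OF cc])
  ultimately show "smooth_on (cdim c) (cdim d) (loc_dom c (\<lambda>p. p) d) (loc_rep c (\<lambda>p. p) d)"
    using assms(3)[OF c d] by (simp add: smooth_on_iff chart_smooth_def loc_rep_def)
qed (rule assms(1))

lemma smooth_atlas_mfd_sum:
  assumes M: "\<And>s. s \<in> S \<Longrightarrow> smooth_atlas (M s)"
  shows "smooth_atlas (mfd_sum S M)"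
proof (rule smooth_atlasI)
  show "corner_chart (mtop (mfd_sum S M)) c" if "c \<in> atlas (mfd_sum S M)" for c
    using that corner_chart_sum_chart[where M=M] smooth_atlas_corner_chart[OF M] unfolding atlas_mfd_sum by blast
  show "\<exists>c\<in>atlas (mfd_sum S M). u \<in> cdom c" if pt: "u \<in> points (mfd_sum S M)" for u
  proof -
    obtain s p where u: "u = (s, p)" "s \<in> S" "p \<in> points (M s)" using pt by (auto simp: points_mfd_sum)
    then obtain c where "c \<in> atlas (M s)" "p \<in> cdom c" using smooth_atlas_chartE[OF M] by blast
    then show ?thesis using u by (intro bexI[of _ "sum_chart s c"]) (auto simp: atlas_mfd_sum)
  qed
  fix c' d' j assume c': "c' \<in> atlas (mfd_sum S M)" and d': "d' \<in> atlas (mfd_sum S M)" and j: "j < cdim d'"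
  obtain s c where c: "c' = sum_chart s c" "s \<in> S" "c \<in> atlas (M s)" using c' by (auto simp: atlas_mfd_sum)
  obtain t d where d: "d' = sum_chart t d" "t \<in> S" "d \<in> atlas (M t)" using d' by (auto simp: atlas_mfd_sum)
  note cc = smooth_atlas_corner_chart[OF M[OF c(2)] c(3)]
  show "chart_smooth c' (cdom c' \<inter> cdom d') (\<lambda>p. cmap d' p j)"
  proof (cases "s = t")
    case True
    have "chart_smooth c (cdom c \<inter> cdom d) (\<lambda>q. cmap d q j)"
      by (rule smooth_mapD[OF smooth_map_id[OF M[OF c(2)]] c(3)]) (use True d j in auto)
    then have "chart_smooth (sum_chart s c) ({s} \<times> (cdom c \<inter> cdom d)) (\<lambda>p. cmap d' p j)"
      by (intro chart_smooth_sum_chart[where M=M, OF c(2) cc]) (auto simp: d)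
    then show ?thesis using True by (simp add: c d Times_Int_Times)
  next
    case False
    \<comment> \<open>Charts over different nodes never meet, so there is no transition to
      check.\<close>
    then have "cdom c' \<inter> cdom d' = {}" by (auto simp: c d)
    then show ?thesis by (simp add: chart_smooth_def smooth_fun_def)
  qed
qed

lemma smooth_map_into_sum:
  assumes s: "s \<in> S" and M: "\<And>s. s \<in> S \<Longrightarrow> smooth_atlas (M s)"
  shows "smooth_map (M s) (mfd_sum S M) (Pair s)"
proof (rule smooth_map_pointwiseI[OF M[OF s] smooth_atlas_mfd_sum[OF M]])
  fix p assume "p \<in> points (M s)"
  then obtain c where c: "c \<in> atlas (M s)" "p \<in> cdom c" "corner_chart (mtop (M s)) c"
    using smooth_atlas_chartE[OF M[OF s]] by blast
  show "smooth_near (M s) (mfd_sum S M) (Pair s) p"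
    by (rule smooth_nearI[OF c(1) _ corner_chart_openin[OF c(3)] c(2) order_refl, of "sum_chart s c"])
      (use c s chart_smooth_coordinate[OF c(3) order_refl] in \<open>auto simp: atlas_mfd_sum\<close>)
qed

text \<open>Together with \<open>smooth_map_into_sum\<close> this is the universal property of the
  coproduct. It holds because the slices are open and charts of the sum are charts of a
  summand.\<close>

lemma smooth_map_from_sum:
  assumes M: "\<And>s. s \<in> S \<Longrightarrow> smooth_atlas (M s)" and B: "smooth_atlas B"
    and f: "\<And>s. s \<in> S \<Longrightarrow> smooth_map (M s) B (\<lambda>p. f (s, p))"
  shows "smooth_map (mfd_sum S M) B f"
proof (rule smooth_map_pointwiseI[OF smooth_atlas_mfd_sum[OF M] B])
  fix u assume "u \<in> points (mfd_sum S M)"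
  then obtain s p where u: "u = (s, p)" and s: "s \<in> S" and p: "p \<in> points (M s)" by (auto simp: points_mfd_sum)
  obtain c where c: "c \<in> atlas (M s)" "p \<in> cdom c" "corner_chart (mtop (M s)) c"
    using smooth_atlas_chartE[OF M[OF s] p] by blast
  obtain d where d: "d \<in> atlas B" "f (s, p) \<in> cdom d"
    using smooth_atlas_chartE[OF B smooth_map_in_points[OF f[OF s] p]] by blast
  define V where "V = {q \<in> cdom c. f (s, q) \<in> cdom d}"
  have fc: "continuous_map (mtop (M s)) (mtop B) (\<lambda>p. f (s, p))" using f[OF s] by (simp add: smooth_map_def)
  have V: "openin (mtop (M s)) V"
    unfolding V_def by (rule openin_chart_preimage[OF B fc corner_chart_openin[OF c(3)] d(1)])
  have "openin (mtop (mfd_sum S M)) ({s} \<times> V)"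
    unfolding mtop_mfd_sum by (rule openin_sum_slice[where T="\<lambda>s. mtop (M s)", OF s V])
  moreover have "chart_smooth (sum_chart s c) ({s} \<times> V) (\<lambda>u. cmap d (f u) j)" if "j < cdim d" for j
  proof (rule chart_smooth_sum_chart[where M=M, OF s c(3)])
    show "chart_smooth c V (\<lambda>q. cmap d (f (s, q)) j)"
      by (rule smooth_mapD[OF f[OF s] c(1) d(1) _ _ that]) (auto simp: V_def)
  qed (auto simp: V_def)
  ultimately show "smooth_near (mfd_sum S M) B f u"
    using c d s u by (intro smooth_nearI[of "sum_chart s c" _ d _ "{s} \<times> V"]) (auto simp: atlas_mfd_sum V_def)
qed

section \<open>Product charts\<close>

definition prod_chart :: "'i set \<Rightarrow> ('i \<Rightarrow> 'p chart) \<Rightarrow> nat \<Rightarrow> (nat \<Rightarrow> 'i \<times> nat) \<Rightarrow> ('i \<Rightarrow> 'p) chart" where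
  "prod_chart X c N e =
     \<lparr> cdom = (\<Pi>\<^sub>E x\<in>X. cdom (c x)), cdim = N,
       cmap = (\<lambda>p j. if j < N then (case e j of (x, i) \<Rightarrow> cmap (c x) (p x) i) else 0) \<rparr>"

lemma prod_chart_simps [simp]:
  "cdom (prod_chart X c N e) = (\<Pi>\<^sub>E x\<in>X. cdom (c x))" "cdim (prod_chart X c N e) = N"
  by (simp_all add: prod_chart_def)

lemma cmap_prod_chart: "j < N \<Longrightarrow> cmap (prod_chart X c N e) p j = cmap (c (fst (e j))) (p (fst (e j))) (snd (e j))"
  by (simp add: prod_chart_def split_beta)

lemma mtop_mfd_prod: "mtop (mfd_prod X M) = product_topology (\<lambda>x. mtop (M x)) X"
  by (simp add: mfd_prod_def)

definition coord_enum :: "'i set \<Rightarrow> ('i \<Rightarrow> 'p chart) \<Rightarrow> nat \<Rightarrow> (nat \<Rightarrow> 'i \<times> nat) \<Rightarrow> bool" where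
  "coord_enum X c N e \<longleftrightarrow> bij_betw e {..<N} (SIGMA x:X. {..<cdim (c x)})"

lemma atlas_mfd_prod:
  "atlas (mfd_prod X M) = {prod_chart X c N e | c N e. c \<in> (\<Pi>\<^sub>E x\<in>X. atlas (M x)) \<and> coord_enum X c N e}"
  by (simp add: mfd_prod_def prod_chart_def coord_enum_def)

text \<open>The position, in the concatenated coordinate vector, of coordinate \<open>i\<close> of
  factor \<open>x\<close>: the inverse of the enumeration \<open>e\<close>.\<close>

definition coord_index :: "nat \<Rightarrow> (nat \<Rightarrow> 'i \<times> nat) \<Rightarrow> 'i \<Rightarrow> nat \<Rightarrow> nat" where
  "coord_index N e x i = inv_into {..<N} e (x, i)"

lemma coord_index:
  assumes "coord_enum X c N e" "x \<in> X" "i < cdim (c x)"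
  shows "coord_index N e x i < N" "e (coord_index N e x i) = (x, i)"
proof -
  have "(x, i) \<in> e ` {..<N}"
    using assms by (auto simp: coord_enum_def bij_betw_def)
  from inv_into_into[OF this] f_inv_into_f[OF this]
  show "coord_index N e x i < N" "e (coord_index N e x i) = (x, i)"
    by (auto simp: coord_index_def)
qed

lemma coord_enum_mem:
  assumes "coord_enum X c N e" "j < N"
  shows "fst (e j) \<in> X" "snd (e j) < cdim (c (fst (e j)))" "coord_index N e (fst (e j)) (snd (e j)) = j"
proof -
  have "e j \<in> (SIGMA x:X. {..<cdim (c x)})"
    using assms unfolding coord_enum_def bij_betw_def by blast
  then show "fst (e j) \<in> X" "snd (e j) < cdim (c (fst (e j)))" by auto
  show "coord_index N e (fst (e j)) (snd (e j)) = j"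
    using assms by (simp add: coord_index_def coord_enum_def bij_betw_def inv_into_f_f)
qed

lemma cmap_prod_chart_index:
  assumes "coord_enum X c N e" "x \<in> X" "i < cdim (c x)"
  shows "cmap (prod_chart X c N e) p (coord_index N e x i) = cmap (c x) (p x) i"
  using coord_index[OF assms] by (simp add: cmap_prod_chart)

lemma ex_coord_enum:
  assumes "finite X"
  shows "\<exists>N e. coord_enum X c N e"
proof -
  have "finite (SIGMA x:X. {..<cdim (c x)})" using assms by auto
  from ex_bij_betw_nat_finite[OF this] show ?thesis
    unfolding coord_enum_def atLeast0LessThan by blast
qed

text \<open>The linear projection of the concatenated vector onto the coordinates of factor
  \<open>x\<close>, padded by zeros. Openness, quadrants and derivatives of product charts are all
  handled block by block, which hides the enumeration.\<close>

definition coord_block :: "('i \<Rightarrow> 'p chart) \<Rightarrow> nat \<Rightarrow> (nat \<Rightarrow> 'i \<times> nat) \<Rightarrow> 'i \<Rightarrow> (nat \<Rightarrow> real) \<Rightarrow> nat \<Rightarrow> real" where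
  "coord_block c N e x z = (\<lambda>i. if i < cdim (c x) then z (coord_index N e x i) else 0)"

lemma coord_block_Euclidean [simp]: "coord_block c N e x z \<in> topspace (\<E> (cdim (c x)))"
  by (auto simp: coord_block_def topspace_Euclidean_space)

lemma continuous_map_coord_block:
  "continuous_map (\<E> N) (\<E> (cdim (c x))) (coord_block c N e x)"
  by (intro continuous_map_into_Euclidean_space coord_block_Euclidean)
    (simp add: coord_block_def continuous_map_coordinate)

lemma coord_block_prod_chart:
  assumes "coord_enum X c N e" "x \<in> X" "cmap (c x) (p x) \<in> topspace (\<E> (cdim (c x)))"
  shows "coord_block c N e x (cmap (prod_chart X c N e) p) = cmap (c x) (p x)"
proof
  fix i
  show "coord_block c N e x (cmap (prod_chart X c N e) p) i = cmap (c x) (p x) i"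
    using assms(3) cmap_prod_chart_index[OF assms(1,2), of i p]
    by (auto simp: coord_block_def topspace_Euclidean_space)
qed

lemma cmap_prod_chart_Euclidean: "cmap (prod_chart X c N e) p \<in> topspace (\<E> N)"
  by (auto simp: prod_chart_def topspace_Euclidean_space)

text \<open>A vector is the image of a point of the box as soon as each block is an image in its
  factor; the preimages are chosen separately and \<open>coord_enum_mem\<close> recovers every
  entry.\<close>

lemma prod_chart_image:
  assumes e: "coord_enum X c N e" and c: "\<And>x. x \<in> X \<Longrightarrow> corner_chart (T x) (c x)"
    and U: "\<And>x. x \<in> X \<Longrightarrow> U x \<subseteq> cdom (c x)"
  shows "cmap (prod_chart X c N e) ` (\<Pi>\<^sub>E x\<in>X. U x) =
    {z \<in> topspace (\<E> N). \<forall>x\<in>X. coord_block c N e x z \<in> cmap (c x) ` U x}" (is "?L = ?R")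
proof
  show "?L \<subseteq> ?R"
  proof
    fix z assume "z \<in> ?L"
    then obtain p where p: "p \<in> (\<Pi>\<^sub>E x\<in>X. U x)" "z = cmap (prod_chart X c N e) p" by blast
    have "coord_block c N e x z \<in> cmap (c x) ` U x" if x: "x \<in> X" for x
    proof -
      have px: "p x \<in> U x" using p(1) x by (rule PiE_mem)
      then have "cmap (c x) (p x) \<in> topspace (\<E> (cdim (c x)))"
        using corner_chart_Euclidean[OF c[OF x]] U[OF x] by blast
      then show ?thesis using coord_block_prod_chart[OF e x] px p(2) by simp
    qed
    then show "z \<in> ?R" using cmap_prod_chart_Euclidean p(2) by blast
  qed
  show "?R \<subseteq> ?L"
  proof
    fix z assume z: "z \<in> ?R"
    then have "\<forall>x\<in>X. \<exists>q. q \<in> U x \<and> coord_block c N e x z = cmap (c x) q" by blast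
    from bchoice[OF this] obtain q where q: "\<forall>x\<in>X. q x \<in> U x \<and> coord_block c N e x z = cmap (c x) (q x)" ..
    have "cmap (prod_chart X c N e) (restrict q X) j = z j" for j
    proof (cases "j < N")
      case True
      note m = coord_enum_mem[OF e True]
      have "coord_block c N e (fst (e j)) z (snd (e j)) = cmap (c (fst (e j))) (q (fst (e j))) (snd (e j))"
        using q m(1) by simp
      then show ?thesis using m True by (simp add: cmap_prod_chart coord_block_def)
    next
      case False
      then show ?thesis using z by (auto simp: prod_chart_def topspace_Euclidean_space)
    qed
    then have "z = cmap (prod_chart X c N e) (restrict q X)" by (intro ext) simp
    moreover have "restrict q X \<in> (\<Pi>\<^sub>E x\<in>X. U x)" using q by auto
    ultimately show "z \<in> ?L" by blast
  qed
qed

lemma openin_Euclidean_blocks: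
  assumes "finite X" "\<And>x. x \<in> X \<Longrightarrow> openin (\<E> (cdim (c x))) (W x)"
  shows "openin (\<E> N) {z \<in> topspace (\<E> N). \<forall>x\<in>X. coord_block c N e x z \<in> W x}"
proof -
  have "openin (\<E> N) {z \<in> topspace (\<E> N). coord_block c N e x z \<in> W x}" if "x \<in> X" for x
    by (rule openin_continuous_map_preimage[OF continuous_map_coord_block[of N c x e] assms(2)[OF that]])
  then have "openin (\<E> N) ((\<Inter>x\<in>X. {z \<in> topspace (\<E> N). coord_block c N e x z \<in> W x}) \<inter> topspace (\<E> N))"
    using assms(1) by (intro openin_INT) auto
  moreover have "(\<Inter>x\<in>X. {z \<in> topspace (\<E> N). coord_block c N e x z \<in> W x}) \<inter> topspace (\<E> N)
     = {z \<in> topspace (\<E> N). \<forall>x\<in>X. coord_block c N e x z \<in> W x}" by auto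
  ultimately show ?thesis by simp
qed

text \<open>Conditions on blocks are preimages under continuous projections, finitely many of them,
  so images of open boxes are relatively open. Injectivity is likewise inherited from the
  blocks.\<close>

lemma corner_chart_prod_chart:
  assumes X: "finite X" and e: "coord_enum X c N e" and c: "\<And>x. x \<in> X \<Longrightarrow> corner_chart (mtop (M x)) (c x)"
  shows "corner_chart (mtop (mfd_prod X M)) (prod_chart X c N e)"
proof -
  let ?pc = "prod_chart X c N e"
  note img = prod_chart_image[where T="\<lambda>x. mtop (M x)", OF e c]
  have imgD: "cmap ?pc ` (\<Pi>\<^sub>E x\<in>X. cdom (c x)) =
    {z \<in> topspace (\<E> N). \<forall>x\<in>X. coord_block c N e x z \<in> cmap (c x) ` cdom (c x)}"
    by (rule img) auto
  have "\<forall>x\<in>X. \<exists>K. K \<subseteq> {..<cdim (c x)} \<and> openin (subtopology (\<E> (cdim (c x))) (quadrant (cdim (c x)) K)) (cmap (c x) ` cdom (c x))"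
    using c unfolding corner_chart_def by blast
  from bchoice[OF this] obtain K where K: "\<forall>x\<in>X. K x \<subseteq> {..<cdim (c x)} \<and>
    openin (subtopology (\<E> (cdim (c x))) (quadrant (cdim (c x)) (K x))) (cmap (c x) ` cdom (c x))" ..
  then have "\<forall>x\<in>X. \<exists>W. openin (\<E> (cdim (c x))) W \<and> cmap (c x) ` cdom (c x) = W \<inter> quadrant (cdim (c x)) (K x)"
    by (simp add: openin_subtopology)
  from bchoice[OF this] obtain W where W: "\<forall>x\<in>X. openin (\<E> (cdim (c x))) (W x) \<and>
    cmap (c x) ` cdom (c x) = W x \<inter> quadrant (cdim (c x)) (K x)" ..
  \<comment> \<open>The constrained coordinates of the factors, renumbered by \<open>e\<close>. They
    need not be an initial segment, which is why quadrants admit arbitrary sets of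
    coordinates.\<close>
  define L where "L = {j. j < N \<and> snd (e j) \<in> K (fst (e j))}"
  have quad: "(\<forall>x\<in>X. coord_block c N e x z \<in> quadrant (cdim (c x)) (K x)) \<longleftrightarrow> z \<in> quadrant N L"
    if "z \<in> topspace (\<E> N)" for z
  proof
    assume *: "\<forall>x\<in>X. coord_block c N e x z \<in> quadrant (cdim (c x)) (K x)"
    have "0 \<le> z j" if "j \<in> L" for j
    proof -
      have j: "j < N" "snd (e j) \<in> K (fst (e j))" using that by (auto simp: L_def)
      note m = coord_enum_mem[OF e j(1)]
      have "0 \<le> coord_block c N e (fst (e j)) z (snd (e j))"
        using * m(1) j(2) by (auto simp: quadrant_def)
      then show ?thesis using m by (simp add: coord_block_def)
    qed
    then show "z \<in> quadrant N L" using that by (simp add: quadrant_def)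
  next
    assume *: "z \<in> quadrant N L"
    show "\<forall>x\<in>X. coord_block c N e x z \<in> quadrant (cdim (c x)) (K x)"
      unfolding quadrant_def
    proof (intro ballI CollectI conjI coord_block_Euclidean)
      fix x i assume x: "x \<in> X" and i: "i \<in> K x"
      then have i': "i < cdim (c x)" using K by blast
      note ci = coord_index[OF e x i']
      have "coord_index N e x i \<in> L" using ci i by (simp add: L_def)
      then show "0 \<le> coord_block c N e x z i" using * i' by (simp add: quadrant_def coord_block_def)
    qed
  qed
  have img_eq: "cmap ?pc ` (\<Pi>\<^sub>E x\<in>X. cdom (c x)) =
      {z \<in> topspace (\<E> N). \<forall>x\<in>X. coord_block c N e x z \<in> W x} \<inter> quadrant N L"
    unfolding imgD
  proof (rule set_eqI)
    fix z
    have "(\<forall>x\<in>X. coord_block c N e x z \<in> cmap (c x) ` cdom (c x)) \<longleftrightarrow>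
        (\<forall>x\<in>X. coord_block c N e x z \<in> W x) \<and> (\<forall>x\<in>X. coord_block c N e x z \<in> quadrant (cdim (c x)) (K x))"
      using W by auto
    then show "z \<in> {z \<in> topspace (\<E> N). \<forall>x\<in>X. coord_block c N e x z \<in> cmap (c x) ` cdom (c x)} \<longleftrightarrow>
        z \<in> {z \<in> topspace (\<E> N). \<forall>x\<in>X. coord_block c N e x z \<in> W x} \<inter> quadrant N L"
      using quad[of z] by (auto simp: quadrant_def[of N])
  qed
  have D: "openin (mtop (mfd_prod X M)) (\<Pi>\<^sub>E x\<in>X. cdom (c x))"
    unfolding mtop_mfd_prod using X corner_chart_openin[OF c] by (simp add: openin_PiE)
  show ?thesis
  proof (rule corner_chartI[where K=L])
    show "openin (mtop (mfd_prod X M)) (cdom ?pc)" using D by simp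
    show "L \<subseteq> {..<cdim ?pc}" by (auto simp: L_def)
    show "openin (subtopology (\<E> (cdim ?pc)) (quadrant (cdim ?pc) L)) (cmap ?pc ` cdom ?pc)"
      unfolding prod_chart_simps img_eq openin_subtopology
      using openin_Euclidean_blocks[OF X, of c W N e] W by blast
    show "inj_on (cmap ?pc) (cdom ?pc)"
    proof (rule inj_onI)
      fix p q assume p: "p \<in> cdom ?pc" and q: "q \<in> cdom ?pc" and eq: "cmap ?pc p = cmap ?pc q"
      have "p x = q x" if x: "x \<in> X" for x
      proof -
        have "p x \<in> cdom (c x)" "q x \<in> cdom (c x)" using p q x by auto
        moreover from this have "cmap (c x) (p x) = cmap (c x) (q x)"
          using coord_block_prod_chart[OF e x] corner_chart_Euclidean[OF c[OF x]] eq by metis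
        ultimately show ?thesis using inj_onD[OF corner_chart_inj[OF c[OF x]]] by blast
      qed
      then show "p = q" using p q by (auto intro: PiE_ext)
    qed
    show "continuous_map (subtopology (mtop (mfd_prod X M)) (cdom ?pc)) (\<E> (cdim ?pc)) (cmap ?pc)"
    proof (rule continuous_map_into_Euclidean_space)
      show "cmap ?pc p \<in> topspace (\<E> (cdim ?pc))" for p
        using cmap_prod_chart_Euclidean[of X c N e p] by simp
      fix j assume j: "j < cdim ?pc"
      then have jN: "j < N" by simp
      define x i where "x = fst (e j)" and "i = snd (e j)"
      have x: "x \<in> X" using coord_enum_mem[OF e jN] by (simp add: x_def)
      have "continuous_map (subtopology (mtop (mfd_prod X M)) (cdom ?pc)) (subtopology (mtop (M x)) (cdom (c x))) (\<lambda>p. p x)"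
        unfolding mtop_mfd_prod using x
        by (auto simp: continuous_map_in_subtopology intro!: continuous_map_from_subtopology continuous_map_product_coordinates)
      from continuous_map_compose[OF continuous_map_compose[OF this corner_chart_continuous[OF c[OF x] order_refl]] continuous_map_coordinate[of _ i]]
      show "continuous_map (subtopology (mtop (mfd_prod X M)) (cdom ?pc)) euclideanreal (\<lambda>p. cmap ?pc p j)"
        using jN by (simp add: o_def cmap_prod_chart x_def i_def)
    qed
    fix V assume V: "openin (mtop (mfd_prod X M)) V" "V \<subseteq> cdom ?pc"
    show "openin (subtopology (\<E> (cdim ?pc)) (cmap ?pc ` cdom ?pc)) (cmap ?pc ` V)"
    proof (subst openin_subopen, intro ballI)
      fix z assume "z \<in> cmap ?pc ` V"
      then obtain p where p: "p \<in> V" "z = cmap ?pc p" by blast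
      obtain U where U: "\<And>x. x \<in> X \<Longrightarrow> openin (mtop (M x)) (U x)" "p \<in> Pi\<^sub>E X U" "Pi\<^sub>E X U \<subseteq> V"
        using V(1) p(1) unfolding mtop_mfd_prod openin_product_topology_alt by meson
      have "\<forall>x\<in>X. \<exists>Z. openin (\<E> (cdim (c x))) Z \<and> cmap (c x) ` (cdom (c x) \<inter> U x) = Z \<inter> cmap (c x) ` cdom (c x)"
        using corner_chart_open_image[OF c U(1)] by metis
      from bchoice[OF this] obtain Z where Z: "\<forall>x\<in>X. openin (\<E> (cdim (c x))) (Z x) \<and>
        cmap (c x) ` (cdom (c x) \<inter> U x) = Z x \<inter> cmap (c x) ` cdom (c x)" ..
      \<comment> \<open>A box of the product topology inside \<open>V\<close>, cut down to the chart
        domain; its image is a relatively open neighbourhood of \<open>z\<close> within the image of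
        \<open>V\<close>.\<close>
      let ?O = "cmap ?pc ` (\<Pi>\<^sub>E x\<in>X. cdom (c x) \<inter> U x)"
      define B where "B = {z \<in> topspace (\<E> N). \<forall>x\<in>X. coord_block c N e x z \<in> Z x}"
      have B: "openin (\<E> N) B"
        unfolding B_def by (rule openin_Euclidean_blocks[OF X]) (use Z in blast)
      have "?O = {z \<in> topspace (\<E> N). \<forall>x\<in>X. coord_block c N e x z \<in> cmap (c x) ` (cdom (c x) \<inter> U x)}"
        by (rule img) auto
      also have "\<dots> = B \<inter> cmap ?pc ` (\<Pi>\<^sub>E x\<in>X. cdom (c x))"
        unfolding imgD B_def using Z by auto
      finally have O: "?O = B \<inter> cmap ?pc ` (\<Pi>\<^sub>E x\<in>X. cdom (c x))" .
      have "openin (subtopology (\<E> (cdim ?pc)) (cmap ?pc ` cdom ?pc)) ?O"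
        unfolding prod_chart_simps O using B by (rule openin_subtopology_Int)
      moreover have "p \<in> (\<Pi>\<^sub>E x\<in>X. cdom (c x) \<inter> U x)" using p(1) V(2) U(2) by (auto simp: PiE_iff)
      moreover have "(\<Pi>\<^sub>E x\<in>X. cdom (c x) \<inter> U x) \<subseteq> V" using U(3) by (auto simp: PiE_iff subset_iff)
      ultimately show "\<exists>T. openin (subtopology (\<E> (cdim ?pc)) (cmap ?pc ` cdom ?pc)) T \<and> z \<in> T \<and> T \<subseteq> cmap ?pc ` V"
        using p(2) by blast
    qed
  qed
qed

lemma chart_smooth_prod_chart:
  fixes M :: "'i \<Rightarrow> 'p mfd"
  assumes X: "finite X" and e: "coord_enum X c N e" and c: "\<And>x. x \<in> X \<Longrightarrow> corner_chart (mtop (M x)) (c x)"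
    and x: "x \<in> X" and V: "V \<subseteq> cdom (c x)" and U: "U \<subseteq> cdom (prod_chart X c N e)" "(\<lambda>p. p x) \<in> U \<rightarrow> V"
    and h: "chart_smooth (c x) V h"
  shows "chart_smooth (prod_chart X c N e) U (\<lambda>p. h (p x))"
proof (rule chart_smooth_compose[OF _ U(1) c[OF x] V U(2) _ h])
  show pc: "corner_chart (mtop (mfd_prod X M)) (prod_chart X c N e)"
    by (rule corner_chart_prod_chart[OF X e c])
  show "chart_smooth (prod_chart X c N e) U (\<lambda>p. cmap (c x) (p x) i)" if "i < cdim (c x)" for i
    using chart_smooth_coordinate[OF pc U(1), of "coord_index N e x i"]
    by (simp add: cmap_prod_chart_index[OF e x that])
qed

lemma prod_chart_at:
  assumes X: "finite X" and M: "\<And>x. x \<in> X \<Longrightarrow> smooth_atlas (M x)" and p: "p \<in> points (mfd_prod X M)"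
  obtains c N e where "c \<in> (\<Pi>\<^sub>E x\<in>X. atlas (M x))" "coord_enum X c N e" "p \<in> (\<Pi>\<^sub>E x\<in>X. cdom (c x))"
proof -
  have "\<forall>x\<in>X. \<exists>c. c \<in> atlas (M x) \<and> p x \<in> cdom c"
    using p M smooth_atlas_chartE by (metis PiE_mem points_mfd_prod)
  from bchoice[OF this] obtain c where c: "\<forall>x\<in>X. c x \<in> atlas (M x) \<and> p x \<in> cdom (c x)" ..
  obtain N e where "coord_enum X (restrict c X) N e" using ex_coord_enum[OF X] by blast
  moreover have "p \<in> (\<Pi>\<^sub>E x\<in>X. cdom (restrict c X x))" using c p by (auto simp: points_mfd_prod PiE_iff)
  ultimately show ?thesis using c by (intro that[of "restrict c X" N e]) auto
qed

lemma smooth_atlas_mfd_prod: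
  assumes X: "finite X" and M: "\<And>x. x \<in> X \<Longrightarrow> smooth_atlas (M x)"
  shows "smooth_atlas (mfd_prod X M)"
proof (rule smooth_atlasI)
  have cc: "corner_chart (mtop (M x)) (c x)" if "c \<in> (\<Pi>\<^sub>E x\<in>X. atlas (M x))" "x \<in> X" for c x
    using smooth_atlas_corner_chart[OF M[OF that(2)] PiE_mem[OF that]] .
  show "corner_chart (mtop (mfd_prod X M)) d" if "d \<in> atlas (mfd_prod X M)" for d
  proof -
    obtain c N e where d: "d = prod_chart X c N e" and c: "c \<in> (\<Pi>\<^sub>E x\<in>X. atlas (M x))" and e: "coord_enum X c N e"
      using \<open>d \<in> atlas (mfd_prod X M)\<close> unfolding atlas_mfd_prod by blast
    show ?thesis unfolding d by (rule corner_chart_prod_chart[OF X e cc[OF c]])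
  qed
  show "\<exists>d\<in>atlas (mfd_prod X M). p \<in> cdom d" if "p \<in> points (mfd_prod X M)" for p
  proof -
    obtain c N e where c: "c \<in> (\<Pi>\<^sub>E x\<in>X. atlas (M x))" "coord_enum X c N e" "p \<in> (\<Pi>\<^sub>E x\<in>X. cdom (c x))"
      by (rule prod_chart_at[OF X M \<open>p \<in> points (mfd_prod X M)\<close>])
    then have "prod_chart X c N e \<in> atlas (mfd_prod X M)" unfolding atlas_mfd_prod by blast
    then show ?thesis using c(3) by (intro bexI[of _ "prod_chart X c N e"]) simp_all
  qed
  fix d d' j assume d: "d \<in> atlas (mfd_prod X M)" and d': "d' \<in> atlas (mfd_prod X M)" and j: "j < cdim d'"
  obtain c N e where c: "d = prod_chart X c N e" "c \<in> (\<Pi>\<^sub>E x\<in>X. atlas (M x))" "coord_enum X c N e"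
    using d unfolding atlas_mfd_prod by blast
  obtain c' N' e' where c': "d' = prod_chart X c' N' e'" "c' \<in> (\<Pi>\<^sub>E x\<in>X. atlas (M x))" "coord_enum X c' N' e'"
    using d' unfolding atlas_mfd_prod by blast
  have jN: "j < N'" using j by (simp add: c')
  \<comment> \<open>Coordinate \<open>j\<close> of the second chart involves the single factor
    \<open>x\<close>, so smoothness reduces to the transition maps of that factor.\<close>
  define x i where "x = fst (e' j)" and "i = snd (e' j)"
  have x: "x \<in> X" and i: "i < cdim (c' x)" using coord_enum_mem[OF c'(3) jN] by (simp_all add: x_def i_def)
  have "chart_smooth (prod_chart X c N e) (cdom d \<inter> cdom d') (\<lambda>p. cmap (c' x) (p x) i)"
  proof (rule chart_smooth_prod_chart[where M=M and h="\<lambda>q. cmap (c' x) q i", OF X c(3) cc[OF c(2)] x])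
    show "chart_smooth (c x) (cdom (c x) \<inter> cdom (c' x)) (\<lambda>q. cmap (c' x) q i)"
      by (rule smooth_mapD[OF smooth_map_id[OF M[OF x]] PiE_mem[OF c(2) x] PiE_mem[OF c'(2) x] _ _ i]) auto
  qed (use x in \<open>auto simp: c(1) c'(1)\<close>)
  then show "chart_smooth d (cdom d \<inter> cdom d') (\<lambda>p. cmap d' p j)"
    using jN by (simp add: c(1) c'(1) cmap_prod_chart x_def i_def)
qed

section \<open>Products and their tangent bundles\<close>

lemma smooth_map_pr:
  assumes X: "finite X" and M: "\<And>x. x \<in> X \<Longrightarrow> smooth_atlas (M x)" and x: "x \<in> X"
  shows "smooth_map (mfd_prod X M) (M x) (\<lambda>p. p x)"
proof (rule smooth_map_pointwiseI[OF smooth_atlas_mfd_prod[OF X M] M[OF x]])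
  fix p assume p: "p \<in> points (mfd_prod X M)"
  obtain c N e where c: "c \<in> (\<Pi>\<^sub>E x\<in>X. atlas (M x))" and e: "coord_enum X c N e" and pc: "p \<in> (\<Pi>\<^sub>E x\<in>X. cdom (c x))"
    by (rule prod_chart_at[OF X M p])
  have cc: "corner_chart (mtop (M x)) (c x)" if "x \<in> X" for x
    using smooth_atlas_corner_chart[OF M[OF that] PiE_mem[OF c that]] .
  let ?d = "prod_chart X c N e"
  have d: "?d \<in> atlas (mfd_prod X M)" using c e unfolding atlas_mfd_prod by blast
  have "openin (mtop (mfd_prod X M)) (cdom ?d)"
    by (rule corner_chart_openin[OF corner_chart_prod_chart[OF X e cc]])
  moreover have "chart_smooth ?d (cdom ?d) (\<lambda>p. cmap (c x) (p x) j)" for j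
    by (rule chart_smooth_prod_chart[where M=M and h="\<lambda>q. cmap (c x) q j", OF X e cc x order_refl order_refl _
          chart_smooth_coordinate[OF cc[OF x] order_refl]]) (use x in auto)
  ultimately show "smooth_near (mfd_prod X M) (M x) (\<lambda>p. p x) p"
    using d pc x by (intro smooth_nearI[of ?d _ "c x" _ "cdom ?d"]) (auto intro: PiE_mem[OF c])
qed

text \<open>Existence part of the universal property; \<open>ext\<close> is what puts the values
  into the extensional product. Near \<open>a\<close> all finitely many components stay in the
  factors of one product chart.\<close>

lemma smooth_map_into_prod:
  assumes X: "finite X" and M: "\<And>x. x \<in> X \<Longrightarrow> smooth_atlas (M x)" and A: "smooth_atlas A"
    and f: "\<And>x. x \<in> X \<Longrightarrow> smooth_map A (M x) (\<lambda>a. f a x)" and ext: "\<And>a. a \<in> points A \<Longrightarrow> f a \<in> extensional X"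
  shows "smooth_map A (mfd_prod X M) f"
proof (rule smooth_map_pointwiseI[OF A smooth_atlas_mfd_prod[OF X M]])
  fix a assume a: "a \<in> points A"
  have fa: "f a \<in> points (mfd_prod X M)"
    using smooth_map_in_points[OF f a] ext[OF a] by (auto simp: points_mfd_prod PiE_iff)
  obtain d N e where d: "d \<in> (\<Pi>\<^sub>E x\<in>X. atlas (M x))" and e: "coord_enum X d N e" and fd: "f a \<in> (\<Pi>\<^sub>E x\<in>X. cdom (d x))"
    by (rule prod_chart_at[OF X M fa])
  obtain c where c: "c \<in> atlas A" "a \<in> cdom c" "corner_chart (mtop A) c" by (rule smooth_atlas_chartE[OF A a])
  let ?d = "prod_chart X d N e"
  have d': "?d \<in> atlas (mfd_prod X M)" using d e unfolding atlas_mfd_prod by blast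
  \<comment> \<open>The last two factors keep \<open>U\<close> inside the chart domain when
    \<open>X\<close> is empty.\<close>
  define U where "U = (\<Inter>x\<in>X. {q \<in> cdom c. f q x \<in> cdom (d x)}) \<inter> topspace (mtop A) \<inter> cdom c"
  have "openin (mtop A) ((\<Inter>x\<in>X. {q \<in> cdom c. f q x \<in> cdom (d x)}) \<inter> topspace (mtop A))"
  proof (rule openin_INT[OF X])
    fix x assume x: "x \<in> X"
    have "continuous_map (mtop A) (mtop (M x)) (\<lambda>a. f a x)" using f[OF x] by (simp add: smooth_map_def)
    then show "openin (mtop A) {q \<in> cdom c. f q x \<in> cdom (d x)}"
      by (rule openin_chart_preimage[OF M[OF x] _ corner_chart_openin[OF c(3)] PiE_mem[OF d x]])
  qed
  then have U: "openin (mtop A) U" using corner_chart_openin[OF c(3)] unfolding U_def by blast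
  have aU: "a \<in> U" using a c fd by (auto simp: U_def points_def)
  have fU: "f ` U \<subseteq> cdom ?d"
    using ext by (auto simp: U_def points_def PiE_iff extensional_def)
  have "chart_smooth c U (\<lambda>p. cmap ?d (f p) j)" if j: "j < N" for j
  proof -
    define x i where "x = fst (e j)" and "i = snd (e j)"
    have x: "x \<in> X" and i: "i < cdim (d x)" using coord_enum_mem[OF e j] by (simp_all add: x_def i_def)
    have "chart_smooth c U (\<lambda>p. cmap (d x) (f p x) i)"
      by (rule smooth_mapD[OF f[OF x] c(1) PiE_mem[OF d x] _ _ i]) (use x in \<open>auto simp: U_def\<close>)
    then show ?thesis using j by (simp add: cmap_prod_chart x_def i_def)
  qed
  then show "smooth_near A (mfd_prod X M) f a"
    using c(1) d' U aU fU by (intro smooth_nearI[of c _ ?d _ U]) (auto simp: U_def)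
qed

text \<open>A map from a coproduct into a product, so the two universal properties suffice.\<close>

lemma smooth_map_canon:
  assumes X: "finite X" and M: "\<And>x s. x \<in> X \<Longrightarrow> s \<in> S x \<Longrightarrow> smooth_atlas (M x s)"
  shows "smooth_map (mfd_sum (\<Pi>\<^sub>E x\<in>X. S x) (\<lambda>s. mfd_prod X (\<lambda>x. M x (s x)))) (mfd_prod X (\<lambda>x. mfd_sum (S x) (M x))) (canon X)"
proof -
  have MS: "smooth_atlas (mfd_sum (S x) (M x))" if "x \<in> X" for x
    by (rule smooth_atlas_mfd_sum[OF M[OF that]])
  have Ms: "smooth_atlas (M x (s x))" if "s \<in> (\<Pi>\<^sub>E x\<in>X. S x)" "x \<in> X" for s x
    by (rule M[OF that(2) PiE_mem[OF that]])
  show ?thesis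
  proof (rule smooth_map_from_sum)
    show "smooth_atlas (mfd_prod X (\<lambda>x. M x (s x)))" if "s \<in> (\<Pi>\<^sub>E x\<in>X. S x)" for s
      by (rule smooth_atlas_mfd_prod[OF X Ms[OF that]])
    show "smooth_atlas (mfd_prod X (\<lambda>x. mfd_sum (S x) (M x)))"
      by (rule smooth_atlas_mfd_prod[OF X MS])
    fix s assume s: "s \<in> (\<Pi>\<^sub>E x\<in>X. S x)"
    note Ps = smooth_atlas_mfd_prod[where M="\<lambda>x. M x (s x)", OF X Ms[OF s]]
    show "smooth_map (mfd_prod X (\<lambda>x. M x (s x))) (mfd_prod X (\<lambda>x. mfd_sum (S x) (M x))) (\<lambda>p. canon X (s, p))"
    proof (rule smooth_map_into_prod[OF X MS Ps])
      fix x assume x: "x \<in> X"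
      have sx: "s x \<in> S x" by (rule PiE_mem[OF s x])
      have pr: "smooth_map (mfd_prod X (\<lambda>x. M x (s x))) (M x (s x)) (\<lambda>p. p x)"
        by (rule smooth_map_pr[where M="\<lambda>x. M x (s x)", OF X Ms[OF s] x])
      have "smooth_map (mfd_prod X (\<lambda>x. M x (s x))) (mfd_sum (S x) (M x)) (\<lambda>p. (s x, p x))"
        by (rule smooth_map_compose[OF Ps Ms[OF s x] pr smooth_map_into_sum[where M="M x", OF sx M[OF x]]
              smooth_atlas_Euclidean_charts[OF MS[OF x]]])
      then show "smooth_map (mfd_prod X (\<lambda>x. M x (s x))) (mfd_sum (S x) (M x)) (\<lambda>p. canon X (s, p) x)"
        using x by (simp add: canon_def)
    qed (simp_all add: canon_def)
  qed
qed

definition canon_inv :: "'i set \<Rightarrow> ('i \<Rightarrow> 's \<times> 'p) \<Rightarrow> ('i \<Rightarrow> 's) \<times> ('i \<Rightarrow> 'p)" where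
  "canon_inv X q = (\<lambda>x\<in>X. fst (q x), \<lambda>x\<in>X. snd (q x))"

text \<open>The source is a product of coproducts, and charts have to be inspected. Around
  \<open>q\<close> the nodes are constant, because finitely many slices are open, and in charts made
  from the same factors the map is the identity on coordinates.\<close>

lemma smooth_map_canon_inv:
  assumes X: "finite X" and M: "\<And>x s. x \<in> X \<Longrightarrow> s \<in> S x \<Longrightarrow> smooth_atlas (M x s)"
  shows "smooth_map (mfd_prod X (\<lambda>x. mfd_sum (S x) (M x))) (mfd_sum (\<Pi>\<^sub>E x\<in>X. S x) (\<lambda>s. mfd_prod X (\<lambda>x. M x (s x)))) (canon_inv X)"
    (is "smooth_map ?P ?N _")
proof -
  have MS: "smooth_atlas (mfd_sum (S x) (M x))" if "x \<in> X" for x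
    by (rule smooth_atlas_mfd_sum[OF M[OF that]])
  have Ms: "smooth_atlas (M x (s x))" if "s \<in> (\<Pi>\<^sub>E x\<in>X. S x)" "x \<in> X" for s x
    by (rule M[OF that(2) PiE_mem[OF that]])
  have P: "smooth_atlas ?P" by (rule smooth_atlas_mfd_prod[OF X MS])
  have N: "smooth_atlas ?N" by (rule smooth_atlas_mfd_sum[OF smooth_atlas_mfd_prod[OF X Ms]])
  show ?thesis
  proof (rule smooth_map_pointwiseI[OF P N])
    fix q assume q: "q \<in> points ?P"
    define s where "s = (\<lambda>x\<in>X. fst (q x))"
    have qx: "q x \<in> Sigma (S x) (\<lambda>s. points (M x s))" if "x \<in> X" for x
      using q that by (auto simp: points_mfd_prod points_mfd_sum)
    have s: "s \<in> (\<Pi>\<^sub>E x\<in>X. S x)" using qx by (fastforce simp: s_def)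
    have "\<forall>x\<in>X. \<exists>c. c \<in> atlas (M x (s x)) \<and> snd (q x) \<in> cdom c"
    proof
      fix x assume x: "x \<in> X"
      have "snd (q x) \<in> points (M x (s x))" using qx[OF x] x by (auto simp: s_def)
      then show "\<exists>c. c \<in> atlas (M x (s x)) \<and> snd (q x) \<in> cdom c"
        using smooth_atlas_chartE[OF Ms[OF s x]] by blast
    qed
    from bchoice[OF this] obtain c0 where c0: "\<forall>x\<in>X. c0 x \<in> atlas (M x (s x)) \<and> snd (q x) \<in> cdom (c0 x)" ..
    define c where "c = restrict c0 X"
    have c: "c \<in> (\<Pi>\<^sub>E x\<in>X. atlas (M x (s x)))" and qc: "\<And>x. x \<in> X \<Longrightarrow> snd (q x) \<in> cdom (c x)"
      using c0 by (auto simp: c_def)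
    define d where "d = (\<lambda>x\<in>X. sum_chart (s x) (c x))"
    have d: "d \<in> (\<Pi>\<^sub>E x\<in>X. atlas (mfd_sum (S x) (M x)))"
    proof (unfold d_def, rule restrict_PiE_iff[THEN iffD2], rule ballI)
      fix x assume x: "x \<in> X"
      show "sum_chart (s x) (c x) \<in> atlas (mfd_sum (S x) (M x))"
        unfolding atlas_mfd_sum using PiE_mem[OF s x] PiE_mem[OF c x] by blast
    qed
    have dx: "d x = sum_chart (s x) (c x)" if "x \<in> X" for x using that by (simp add: d_def)
    obtain n e where e: "coord_enum X c n e" using ex_coord_enum[OF X] by blast
    \<comment> \<open>\<open>sum_chart\<close> keeps the dimension, so one enumeration serves the
      charts on both sides and no renumbering separates the two coordinate vectors.\<close>
    have "(SIGMA x:X. {..<cdim (d x)}) = (SIGMA x:X. {..<cdim (c x)})" using dx by auto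
    then have e': "coord_enum X d n e" using e by (simp add: coord_enum_def)
    let ?d = "prod_chart X d n e" and ?c = "sum_chart s (prod_chart X c n e)"
    have dP: "?d \<in> atlas ?P" using d e' unfolding atlas_mfd_prod by blast
    have "prod_chart X c n e \<in> atlas (mfd_prod X (\<lambda>x. M x (s x)))" using c e unfolding atlas_mfd_prod by blast
    then have cN: "?c \<in> atlas ?N" using s unfolding atlas_mfd_sum by blast
    note cd = smooth_atlas_corner_chart[OF P dP]
    have fU: "canon_inv X ` cdom ?d \<subseteq> cdom ?c"
    proof
      fix u assume "u \<in> canon_inv X ` cdom ?d"
      then obtain r where r: "r \<in> (\<Pi>\<^sub>E x\<in>X. cdom (d x))" "u = canon_inv X r" by auto
      have rx: "r x \<in> {s x} \<times> cdom (c x)" if "x \<in> X" for x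
        using PiE_mem[OF r(1) that] dx[OF that] by simp
      have "(\<lambda>x\<in>X. fst (r x)) = s" using rx by (fastforce simp: s_def)
      moreover have "(\<lambda>x\<in>X. snd (r x)) \<in> (\<Pi>\<^sub>E x\<in>X. cdom (c x))" using rx by fastforce
      ultimately show "u \<in> cdom ?c" by (simp add: r(2) canon_inv_def)
    qed
    have qd: "q \<in> cdom ?d"
    proof -
      have "q x \<in> cdom (d x)" if "x \<in> X" for x
        using qx[OF that] qc[OF that] dx[OF that] that by (auto simp: s_def)
      moreover have "q \<in> extensional X" using q by (auto simp: points_mfd_prod PiE_iff)
      ultimately show ?thesis by (simp add: PiE_iff)
    qed
    have "cmap ?c (canon_inv X r) j = cmap ?d r j" if "j < n" for r j
      using that coord_enum_mem[OF e that] dx by (simp add: cmap_prod_chart canon_inv_def)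
    then have sm: "\<forall>j<n. chart_smooth ?d (cdom ?d) (\<lambda>r. cmap ?c (canon_inv X r) j)"
      using chart_smooth_coordinate[OF cd order_refl] by simp
    show "smooth_near ?P ?N (canon_inv X) q"
      by (rule smooth_nearI[OF dP cN corner_chart_openin[OF cd] qd order_refl fU])
        (use sm in \<open>simp only: sum_chart_simps prod_chart_simps\<close>)
  qed
qed

section \<open>Tangent vectors of a product\<close>

text \<open>The components in the other charts are forced by the transformation law, and the chain
  rule makes them consistent. A tangent vector of a product, with components in the product charts
  for all enumerations, is thus produced from a single chart.\<close>

lemma tangent_vector_from_chart:
  assumes M: "smooth_atlas M" and c: "c \<in> charts_at M p" and v: "v \<in> topspace (\<E> (cdim c))"
  obtains w where "w \<in> tangent_space M p" "w c = v"
proof -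
  define w where "w = (\<lambda>d\<in>charts_at M p. chart_jac c (\<lambda>p. p) d p v)"
  have "w d' = chart_jac d (\<lambda>p. p) d' p (w d)" if "d \<in> charts_at M p" "d' \<in> charts_at M p" for d d'
    using chart_jac_compose[OF M M M smooth_map_id[OF M] smooth_map_id[OF M] c that] that by (simp add: w_def)
  moreover have "w \<in> (\<Pi>\<^sub>E c\<in>charts_at M p. topspace (\<E> (cdim c)))"
    by (simp add: w_def)
  ultimately have "w \<in> tangent_space M p"
    unfolding tangent_space_iff[OF M] by blast
  moreover have "w c = v" using c chart_jac_id[OF M c v] by (simp add: w_def)
  ultimately show ?thesis by (rule that)
qed

lemma tangent_vector_eq_in_chart:
  assumes M: "smooth_atlas M" and v: "v \<in> tangent_space M p" and w: "w \<in> tangent_space M p"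
    and c: "c \<in> charts_at M p" and eq: "v c = w c"
  shows "v = w"
proof (rule tangent_vector_eqI[OF v w])
  fix d assume d: "d \<in> charts_at M p"
  have "v d = chart_jac c (\<lambda>p. p) d p (v c)" "w d = chart_jac c (\<lambda>p. p) d p (w c)"
    using v w c d unfolding tangent_space_iff[OF M] by blast+
  then show "v d = w d" using eq by simp
qed

text \<open>In these charts the projection is the linear map \<open>coord_block\<close>, hence its
  own derivative.\<close>

lemma chart_jac_pr:
  assumes X: "finite X" and M: "\<And>x. x \<in> X \<Longrightarrow> smooth_atlas (M x)" and x: "x \<in> X"
    and c: "c \<in> (\<Pi>\<^sub>E x\<in>X. atlas (M x))" and e: "coord_enum X c N e" and p: "p \<in> (\<Pi>\<^sub>E x\<in>X. cdom (c x))"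
  shows "chart_jac (prod_chart X c N e) (\<lambda>p. p x) (c x) p v = coord_block c N e x v"
proof -
  let ?d = "prod_chart X c N e"
  have cc: "corner_chart (mtop (M x)) (c x)" if "x \<in> X" for x
    using smooth_atlas_corner_chart[OF M[OF that] PiE_mem[OF c that]] .
  note cd = corner_chart_prod_chart[OF X e cc]
  have "chart_jac ?d (\<lambda>p. p x) (c x) p v = jac N (cdim (c x)) (coord_block c N e x) (cmap ?d p) v"
    unfolding chart_jac_def prod_chart_simps
  proof (rule jac_cong)
    show "quadrant_open N (cmap ?d ` (cdom ?d \<inter> cdom ?d))"
      using corner_chart_quadrant_open[OF cd corner_chart_openin[OF cd]] by simp
    show "cmap ?d p \<in> cmap ?d ` (cdom ?d \<inter> cdom ?d)" using p by simp
    fix z assume "z \<in> cmap ?d ` (cdom ?d \<inter> cdom ?d)"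
    then obtain r where r: "r \<in> cdom ?d" "z = cmap ?d r" by blast
    have "r x \<in> cdom (c x)" using r(1) x by auto
    then have "coord_block c N e x z = cmap (c x) (r x)"
      using coord_block_prod_chart[OF e x corner_chart_Euclidean[OF cc[OF x]]] r(2) by simp
    then show "loc_rep ?d (\<lambda>p. p x) (c x) z = coord_block c N e x z"
      using cinv_cmap[OF cd r(1)] r(2) by (simp add: loc_rep_def)
  qed
  also have "\<dots> = coord_block c N e x v"
  proof
    fix i
    show "jac N (cdim (c x)) (coord_block c N e x) (cmap ?d p) v i = coord_block c N e x v i"
    proof (cases "i < cdim (c x)")
      case True
      have "(\<lambda>y. coord_block c N e x y i) = (\<lambda>y. y (coord_index N e x i))"
        using True by (simp add: coord_block_def)
      moreover have "(\<Sum>k<N. (if k = coord_index N e x i then 1 else 0) * v k) = v (coord_index N e x i)"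
        using coord_index(1)[OF e x True] by (simp add: if_distrib[of "\<lambda>a. a * _"] cong: if_cong)
      ultimately show ?thesis using True by (simp add: jac_def right_deriv_coordinate coord_block_def)
    qed (simp add: jac_def coord_block_def)
  qed
  finally show ?thesis .
qed

lemma snd_tangent_map_pr:
  assumes X: "finite X" and M: "\<And>x. x \<in> X \<Longrightarrow> smooth_atlas (M x)" and x: "x \<in> X"
    and c: "c \<in> (\<Pi>\<^sub>E x\<in>X. atlas (M x))" and e: "coord_enum X c N e"
    and u: "u \<in> tangent_vectors (mfd_prod X M)" "fst u \<in> (\<Pi>\<^sub>E x\<in>X. cdom (c x))"
  shows "snd (tangent_map (mfd_prod X M) (M x) (\<lambda>p. p x) u) (c x) = coord_block c N e x (snd u (prod_chart X c N e))"
proof -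
  have P: "smooth_atlas (mfd_prod X M)" by (rule smooth_atlas_mfd_prod[OF X M])
  have pr: "smooth_map (mfd_prod X M) (M x) (\<lambda>p. p x)" by (rule smooth_map_pr[OF X M x])
  have "prod_chart X c N e \<in> charts_at (mfd_prod X M) (fst u)"
    using c e u(2) unfolding charts_at_iff atlas_mfd_prod prod_chart_simps by blast
  moreover have "c x \<in> charts_at (M x) (fst u x)"
    using PiE_mem[OF c x] PiE_mem[OF u(2) x] by (simp add: charts_at_iff)
  moreover have "snd u \<in> tangent_space (mfd_prod X M) (fst u)" using u(1) by (simp add: tangent_vectors_iff)
  ultimately have "snd (tangent_map (mfd_prod X M) (M x) (\<lambda>p. p x) (fst u, snd u)) (c x) =
      chart_jac (prod_chart X c N e) (\<lambda>p. p x) (c x) (fst u) (snd u (prod_chart X c N e))"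
    using snd_tangent_map[OF P M[OF x] pr] by blast
  then show ?thesis using chart_jac_pr[OF X M x c e u(2)] by simp
qed

lemma coord_block_inject:
  assumes e: "coord_enum X c N e" and "v \<in> topspace (\<E> N)" "w \<in> topspace (\<E> N)"
    and eq: "\<And>x. x \<in> X \<Longrightarrow> coord_block c N e x v = coord_block c N e x w"
  shows "v = w"
proof
  fix j
  show "v j = w j"
  proof (cases "j < N")
    case True
    note m = coord_enum_mem[OF e True]
    have "coord_block c N e (fst (e j)) v (snd (e j)) = coord_block c N e (fst (e j)) w (snd (e j))"
      using eq[OF m(1)] by simp
    then show ?thesis using m by (simp add: coord_block_def)
  qed (use assms(2,3) in \<open>simp add: topspace_Euclidean_space\<close>)
qed

text \<open>The map that \<open>prod_tangent\<close> inverts by \<open>inv_into\<close>.\<close>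

definition tangent_pr :: "'i set \<Rightarrow> ('i \<Rightarrow> 'p mfd) \<Rightarrow> ('i \<Rightarrow> 'p) tvec \<Rightarrow> 'i \<Rightarrow> 'p tvec" where
  "tangent_pr X M u = (\<lambda>x\<in>X. tangent_map (mfd_prod X M) (M x) (\<lambda>p. p x) u)"

text \<open>Base points are compared componentwise. For the fibres one product chart suffices, where
  the components of T of the projections are the blocks of the coordinate vector.\<close>

lemma inj_on_tangent_pr:
  assumes X: "finite X" and M: "\<And>x. x \<in> X \<Longrightarrow> smooth_atlas (M x)"
  shows "inj_on (tangent_pr X M) (tangent_vectors (mfd_prod X M))"
proof (rule inj_onI)
  have P: "smooth_atlas (mfd_prod X M)" by (rule smooth_atlas_mfd_prod[OF X M])
  fix u w assume u: "u \<in> tangent_vectors (mfd_prod X M)" and w: "w \<in> tangent_vectors (mfd_prod X M)"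
    and eq: "tangent_pr X M u = tangent_pr X M w"
  have eqx: "tangent_map (mfd_prod X M) (M x) (\<lambda>p. p x) u = tangent_map (mfd_prod X M) (M x) (\<lambda>p. p x) w" if "x \<in> X" for x
    using fun_cong[OF eq, of x] that by (simp add: tangent_pr_def)
  have fu: "fst u \<in> points (mfd_prod X M)" and fw: "fst w \<in> points (mfd_prod X M)"
    using u w by (auto simp: tangent_vectors_iff)
  have base: "fst u = fst w"
  proof (rule extensionalityI)
    show "fst u \<in> extensional X" "fst w \<in> extensional X" using fu fw by (auto simp: points_mfd_prod PiE_iff)
    show "fst u x = fst w x" if "x \<in> X" for x using arg_cong[OF eqx[OF that], of fst] by simp
  qed
  obtain c N e where c: "c \<in> (\<Pi>\<^sub>E x\<in>X. atlas (M x))" and e: "coord_enum X c N e" and pc: "fst u \<in> (\<Pi>\<^sub>E x\<in>X. cdom (c x))"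
    by (rule prod_chart_at[OF X M fu])
  let ?d = "prod_chart X c N e"
  have d: "?d \<in> charts_at (mfd_prod X M) (fst u)"
    using c e pc unfolding charts_at_iff atlas_mfd_prod prod_chart_simps by blast
  have su: "snd u \<in> tangent_space (mfd_prod X M) (fst u)" and sw: "snd w \<in> tangent_space (mfd_prod X M) (fst u)"
    using u w base by (auto simp: tangent_vectors_iff)
  have "snd u ?d = snd w ?d"
  proof (rule coord_block_inject[OF e])
    show "snd u ?d \<in> topspace (\<E> N)" "snd w ?d \<in> topspace (\<E> N)"
      using tangent_space_Euclidean[OF su d] tangent_space_Euclidean[OF sw d] by simp_all
    fix x assume x: "x \<in> X"
    show "coord_block c N e x (snd u ?d) = coord_block c N e x (snd w ?d)"
      using snd_tangent_map_pr[OF X M x c e u pc] snd_tangent_map_pr[OF X M x c e w] pc base eqx[OF x] by simp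
  qed
  then have "snd u = snd w"
    by (rule tangent_vector_eq_in_chart[OF P su sw d])
  with base show "u = w" by (rule prod_eqI)
qed

lemma tangent_pr_surj:
  assumes X: "finite X" and M: "\<And>x. x \<in> X \<Longrightarrow> smooth_atlas (M x)"
    and w: "w \<in> (\<Pi>\<^sub>E x\<in>X. tangent_vectors (M x))"
  obtains u where "u \<in> tangent_vectors (mfd_prod X M)" "tangent_pr X M u = w"
proof -
  have P: "smooth_atlas (mfd_prod X M)" by (rule smooth_atlas_mfd_prod[OF X M])
  have wx: "fst (w x) \<in> points (M x)" "snd (w x) \<in> tangent_space (M x) (fst (w x))" if "x \<in> X" for x
    using PiE_mem[OF w that] by (simp_all add: tangent_vectors_iff)
  define p where "p = (\<lambda>x\<in>X. fst (w x))"
  have p: "p \<in> points (mfd_prod X M)" using wx by (auto simp: p_def points_mfd_prod)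
  obtain c N e where c: "c \<in> (\<Pi>\<^sub>E x\<in>X. atlas (M x))" and e: "coord_enum X c N e" and pc: "p \<in> (\<Pi>\<^sub>E x\<in>X. cdom (c x))"
    by (rule prod_chart_at[OF X M p])
  let ?d = "prod_chart X c N e"
  have d: "?d \<in> charts_at (mfd_prod X M) p"
    using c e pc unfolding charts_at_iff atlas_mfd_prod prod_chart_simps by blast
  \<comment> \<open>The coordinate vectors of the factors in the charts \<open>c x\<close>,
    concatenated along \<open>e\<close>.\<close>
  define v where "v = (\<lambda>j. if j < N then snd (w (fst (e j))) (c (fst (e j))) (snd (e j)) else 0)"
  have "v \<in> topspace (\<E> (cdim ?d))" by (simp add: v_def topspace_Euclidean_space)
  from tangent_vector_from_chart[OF P d this]
  obtain s where s: "s \<in> tangent_space (mfd_prod X M) p" "s ?d = v" .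
  have u: "(p, s) \<in> tangent_vectors (mfd_prod X M)" using p s(1) by (simp add: tangent_vectors_iff)
  have "tangent_map (mfd_prod X M) (M x) (\<lambda>p. p x) (p, s) = w x" if x: "x \<in> X" for x
  proof (rule prod_eqI)
    have pr: "smooth_map (mfd_prod X M) (M x) (\<lambda>p. p x)" by (rule smooth_map_pr[OF X M x])
    have px: "p x = fst (w x)" using x by (simp add: p_def)
    then show "fst (tangent_map (mfd_prod X M) (M x) (\<lambda>p. p x) (p, s)) = fst (w x)" by simp
    have cx: "c x \<in> charts_at (M x) (fst (w x))"
      using PiE_mem[OF c x] PiE_mem[OF pc x] px by (simp add: charts_at_iff)
    have T: "snd (tangent_map (mfd_prod X M) (M x) (\<lambda>p. p x) (p, s)) \<in> tangent_space (M x) (fst (w x))"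
      using tangent_map_in_tangent_space[OF P M[OF x] pr p s(1)] px by simp
    show "snd (tangent_map (mfd_prod X M) (M x) (\<lambda>p. p x) (p, s)) = snd (w x)"
    proof (rule tangent_vector_eq_in_chart[OF M[OF x] T wx(2)[OF x] cx])
      have "snd (tangent_map (mfd_prod X M) (M x) (\<lambda>p. p x) (p, s)) (c x) = coord_block c N e x v"
        using snd_tangent_map_pr[OF X M x c e u] pc s(2) by simp
      also have "\<dots> = snd (w x) (c x)"
      proof
        fix i
        show "coord_block c N e x v i = snd (w x) (c x) i"
        proof (cases "i < cdim (c x)")
          case True
          then show ?thesis using coord_index[OF e x True] by (simp add: coord_block_def v_def)
        next
          case False
          then show ?thesis using tangent_space_Euclidean[OF wx(2)[OF x] cx]
            by (simp add: coord_block_def topspace_Euclidean_space)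
        qed
      qed
      finally show "snd (tangent_map (mfd_prod X M) (M x) (\<lambda>p. p x) (p, s)) (c x) = snd (w x) (c x)" .
    qed
  qed
  then have "tangent_pr X M (p, s) = w"
    using w by (auto simp: tangent_pr_def PiE_iff extensional_def fun_eq_iff)
  with u show ?thesis by (rule that)
qed

text \<open>Surjectivity of \<open>tangent_pr\<close> puts \<open>w\<close> into its image, where
  \<open>inv_into\<close> is a genuine right inverse.\<close>

lemma
  assumes X: "finite X" and M: "\<And>x. x \<in> X \<Longrightarrow> smooth_atlas (M x)"
    and w: "w \<in> (\<Pi>\<^sub>E x\<in>X. tangent_vectors (M x))"
  shows prod_tangent_in: "prod_tangent X M w \<in> tangent_vectors (mfd_prod X M)"
    and tangent_map_pr_prod_tangent: "x \<in> X \<Longrightarrow> tangent_map (mfd_prod X M) (M x) (\<lambda>p. p x) (prod_tangent X M w) = w x"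
proof -
  have eq: "prod_tangent X M = inv_into (tangent_vectors (mfd_prod X M)) (tangent_pr X M)"
    by (simp add: prod_tangent_def tangent_pr_def[abs_def] points_tangent_bundle[OF smooth_atlas_mfd_prod[OF X M]])
  obtain u where "u \<in> tangent_vectors (mfd_prod X M)" "tangent_pr X M u = w"
    by (rule tangent_pr_surj[OF X M w])
  then have mem: "w \<in> tangent_pr X M ` tangent_vectors (mfd_prod X M)" by blast
  show "prod_tangent X M w \<in> tangent_vectors (mfd_prod X M)"
    unfolding eq by (rule inv_into_into[OF mem])
  have "tangent_pr X M (prod_tangent X M w) = w"
    unfolding eq by (rule f_inv_into_f[OF mem])
  then have "tangent_pr X M (prod_tangent X M w) x = w x" by simp
  then show "tangent_map (mfd_prod X M) (M x) (\<lambda>p. p x) (prod_tangent X M w) = w x" if "x \<in> X"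
    using that by (simp add: tangent_pr_def)
qed

lemma fst_prod_tangent:
  assumes X: "finite X" and M: "\<And>x. x \<in> X \<Longrightarrow> smooth_atlas (M x)"
    and w: "w \<in> (\<Pi>\<^sub>E x\<in>X. tangent_vectors (M x))"
  shows "fst (prod_tangent X M w) = (\<lambda>x\<in>X. fst (w x))"
proof (rule extensionalityI)
  show "fst (prod_tangent X M w) \<in> extensional X"
    using prod_tangent_in[OF X M w] by (auto simp: tangent_vectors_iff points_mfd_prod PiE_iff)
  show "fst (prod_tangent X M w) x = (\<lambda>x\<in>X. fst (w x)) x" if "x \<in> X" for x
    using arg_cong[OF tangent_map_pr_prod_tangent[OF X M w that], of fst] that by simp
qed simp

text \<open>No formula for \<open>prod_tangent\<close> is required: in a product chart with
  \<open>e j = (x, i)\<close>, fibre coordinate \<open>j\<close> is fibre coordinate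
  \<open>i\<close> of factor \<open>x\<close>, as seen by applying T of the projection.\<close>

lemma smooth_map_prod_tangent:
  assumes X: "finite X" and M: "\<And>x. x \<in> X \<Longrightarrow> smooth_atlas (M x)" and A: "smooth_atlas A"
    and V: "\<And>x. x \<in> X \<Longrightarrow> smooth_map A (tangent_bundle (M x)) (V x)"
    and base: "\<And>x. x \<in> X \<Longrightarrow> smooth_map A (M x) (\<lambda>a. fst (V x a))"
  shows "smooth_map A (tangent_bundle (mfd_prod X M)) (\<lambda>a. prod_tangent X M (\<lambda>x\<in>X. V x a))"
    and "smooth_map A (mfd_prod X M) (\<lambda>a. fst (prod_tangent X M (\<lambda>x\<in>X. V x a)))"
proof -
  have P: "smooth_atlas (mfd_prod X M)" by (rule smooth_atlas_mfd_prod[OF X M])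
  have VT: "V x \<in> points A \<rightarrow> tangent_vectors (M x)" if "x \<in> X" for x
    by (rule smooth_map_tangent_vectors[OF M[OF that] V[OF that]])
  have w: "(\<lambda>x\<in>X. V x a) \<in> (\<Pi>\<^sub>E x\<in>X. tangent_vectors (M x))" if "a \<in> points A" for a
    using VT that by auto
  have fst_eq: "fst (prod_tangent X M (\<lambda>x\<in>X. V x a)) = (\<lambda>x\<in>X. fst (V x a))" if "a \<in> points A" for a
    using fst_prod_tangent[OF X M w[OF that]] by auto
  have "smooth_map A (mfd_prod X M) (\<lambda>a. \<lambda>x\<in>X. fst (V x a))"
    by (rule smooth_map_into_prod[OF X M A]) (use base in auto)
  then show b: "smooth_map A (mfd_prod X M) (\<lambda>a. fst (prod_tangent X M (\<lambda>x\<in>X. V x a)))"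
    by (rule smooth_map_cong[OF A, rotated]) (simp add: fst_eq)
  have T: "(\<lambda>a. prod_tangent X M (\<lambda>x\<in>X. V x a)) \<in> points A \<rightarrow> tangent_vectors (mfd_prod X M)"
    using prod_tangent_in[OF X M w] by blast
  show "smooth_map A (tangent_bundle (mfd_prod X M)) (\<lambda>a. prod_tangent X M (\<lambda>x\<in>X. V x a))"
    unfolding smooth_map_tangent_bundle_iff[OF A P b T]
  proof (intro ballI allI impI)
    fix c d j assume c: "c \<in> atlas A" and d: "d \<in> atlas (mfd_prod X M)" and j: "j < cdim d"
    note cc = smooth_atlas_corner_chart[OF A c]
    have cA: "cdom c \<subseteq> points A" using A c by (auto simp: smooth_atlas_def)
    obtain c' N e where d': "d = prod_chart X c' N e" and c': "c' \<in> (\<Pi>\<^sub>E x\<in>X. atlas (M x))" and e: "coord_enum X c' N e"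
      using d unfolding atlas_mfd_prod by blast
    have jN: "j < N" using j by (simp add: d')
    define x i where "x = fst (e j)" and "i = snd (e j)"
    have x: "x \<in> X" and i: "i < cdim (c' x)" and ix: "coord_index N e x i = j"
      using coord_enum_mem[OF e jN] by (simp_all add: x_def i_def)
    let ?G = "\<lambda>a. prod_tangent X M (\<lambda>x\<in>X. V x a)"
    let ?U = "{a \<in> cdom c. fst (?G a) \<in> cdom d}"
    have "chart_smooth c {a \<in> cdom c. fst (V x a) \<in> cdom (c' x)} (\<lambda>a. snd (V x a) (c' x) i)"
      using V[OF x] c PiE_mem[OF c' x] i unfolding smooth_map_tangent_bundle_iff[OF A M[OF x] base[OF x] VT[OF x]] by blast
    moreover have "?U \<subseteq> {a \<in> cdom c. fst (V x a) \<in> cdom (c' x)}"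
    proof
      fix a assume a: "a \<in> ?U"
      then have "fst (?G a) x \<in> cdom (c' x)" using x by (auto simp: d')
      then show "a \<in> {a \<in> cdom c. fst (V x a) \<in> cdom (c' x)}" using a cA fst_eq[of a] x by auto
    qed
    ultimately have "chart_smooth c ?U (\<lambda>a. snd (V x a) (c' x) i)" by (rule chart_smooth_subset)
    moreover have "snd (V x a) (c' x) i = snd (?G a) d j" if a: "a \<in> ?U" for a
    proof -
      have aA: "a \<in> points A" using a cA by blast
      have "snd (tangent_map (mfd_prod X M) (M x) (\<lambda>p. p x) (?G a)) (c' x) = coord_block c' N e x (snd (?G a) d)"
        unfolding d' by (rule snd_tangent_map_pr[OF X M x c' e]) (use a T aA in \<open>auto simp: d'\<close>)
      then show ?thesis
        using tangent_map_pr_prod_tangent[OF X M w[OF aA] x] x i ix by (simp add: coord_block_def)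
    qed
    moreover have "?U \<subseteq> cdom c" by auto
    ultimately show "chart_smooth c ?U (\<lambda>a. snd (?G a) d j)"
      using chart_smooth_cong[OF cc, of ?U "\<lambda>a. snd (V x a) (c' x) i" "\<lambda>a. snd (?G a) d j"] by blast
  qed
qed

section \<open>Networks\<close>

text \<open>A nodewise condition: finite products inherit it node by node, and it yields a smooth
  atlas on the coproduct.\<close>

definition smooth_hyph :: "('s, 'e, 'p) hyph \<Rightarrow> bool" where
  "smooth_hyph a \<longleftrightarrow> (\<forall>s\<in>Ob (base a). smooth_atlas (space a s))"

lemma smooth_hyph: "hybrid_phase_space a \<Longrightarrow> smooth_hyph a"
  by (simp add: smooth_hyph_def hybrid_phase_space_def manifold_imp_smooth_atlas)

lemma smooth_atlas_UU: "smooth_hyph a \<Longrightarrow> smooth_atlas (UU a)"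
  unfolding UU_def smooth_hyph_def by (intro smooth_atlas_mfd_sum) auto

lemma points_UU: "points (UU a) = Sigma (Ob (base a)) (\<lambda>s. points (space a s))"
  by (simp add: UU_def points_mfd_sum)

lemma smooth_hyph_prod:
  assumes X: "finite X" and a: "\<And>x. x \<in> X \<Longrightarrow> smooth_hyph (a x)"
  shows "smooth_hyph (hyph_prod X a)"
  unfolding smooth_hyph_def
proof
  fix s assume s: "s \<in> Ob (base (hyph_prod X a))"
  have "smooth_atlas (mfd_prod X (\<lambda>x. space (a x) (s x)))"
    by (rule smooth_atlas_mfd_prod[OF X]) (use a s in \<open>auto simp: hyph_prod_def cat_prod_def smooth_hyph_def\<close>)
  then show "smooth_atlas (space (hyph_prod X a) s)" by (simp add: hyph_prod_def)
qed

lemma UU_hyph_prod: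
  "UU (hyph_prod X a) = mfd_sum (\<Pi>\<^sub>E x\<in>X. Ob (base (a x))) (\<lambda>s. mfd_prod X (\<lambda>x. space (a x) (s x)))"
  by (simp add: UU_def hyph_prod_def cat_prod_def)

lemma smooth_map_UU_map:
  assumes a: "smooth_hyph a" and b: "smooth_hyph b" and f: "hyph_mor a b f"
  shows "smooth_map (UU a) (UU b) (UU_map f)"
  unfolding UU_def[of a]
proof (rule smooth_map_from_sum)
  fix s assume s: "s \<in> Ob (base a)"
  show as: "smooth_atlas (space a s)" using a s by (simp add: smooth_hyph_def)
  have t: "onob f s \<in> Ob (base b)" and fs: "smooth_map (space a s) (space b (onob f s)) (onpt f s)"
    using f s by (auto simp: hyph_mor_def is_functor_def)
  have bs: "smooth_atlas (space b t)" if "t \<in> Ob (base b)" for t using b that by (simp add: smooth_hyph_def)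
  have "smooth_map (space b (onob f s)) (UU b) (Pair (onob f s))"
    unfolding UU_def by (rule smooth_map_into_sum[where M="space b", OF t bs])
  from smooth_map_compose[OF as bs[OF t] fs this smooth_atlas_Euclidean_charts[OF smooth_atlas_UU[OF b]]]
  show "smooth_map (space a s) (UU b) (\<lambda>p. UU_map f (s, p))" by (simp add: UU_map_def)
qed (rule smooth_atlas_UU[OF b])

lemma UU_map_hyph_comp: "UU_map (hyph_comp g f) u = UU_map g (UU_map f u)"
  by (simp add: UU_map_def hyph_comp_def split_beta)

lemma UU_map_hyph_id: "UU_map hyph_id u = u"
  by (simp add: UU_map_def hyph_id_def split_beta)

lemma UU_map_cong: "hyph_eq a f g \<Longrightarrow> u \<in> points (UU a) \<Longrightarrow> UU_map f u = UU_map g u"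
  by (auto simp: hyph_eq_def points_UU UU_map_def)

text \<open>Functoriality turns a smooth inverse of \<open>f\<close> into an inverse of Tf. The
  third claim evaluates the \<open>inv_into\<close>s in \<open>dCrl_pullback\<close> and
  \<open>dCrl_prod\<close>.\<close>

lemma tangent_map_inv:
  assumes M: "smooth_atlas M" and N: "smooth_atlas N" and f: "smooth_map M N f" and g: "smooth_map N M g"
    and gf: "\<And>p. p \<in> points M \<Longrightarrow> g (f p) = p" and fg: "\<And>q. q \<in> points N \<Longrightarrow> f (g q) = q"
  shows "u \<in> tangent_vectors M \<Longrightarrow> tangent_map N M g (tangent_map M N f u) = u"
    and "w \<in> tangent_vectors N \<Longrightarrow> tangent_map M N f (tangent_map N M g w) = w"
    and "w \<in> tangent_vectors N \<Longrightarrow> inv_into (points (tangent_bundle M)) (tangent_map M N f) w = tangent_map N M g w"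
proof -
  show 1: "tangent_map N M g (tangent_map M N f u) = u" if u: "u \<in> tangent_vectors M" for u
  proof -
    have "smooth_map M M (\<lambda>p. g (f p))" by (rule smooth_map_compose[OF M N f g smooth_atlas_Euclidean_charts[OF M]])
    then have "tangent_map M M (\<lambda>p. g (f p)) u = tangent_map M M (\<lambda>p. p) u"
      by (rule tangent_map_cong[OF M M _ gf u])
    then show ?thesis by (simp only: tangent_map_compose[OF M N M f g u] tangent_map_id[OF M u])
  qed
  show 2: "tangent_map M N f (tangent_map N M g w) = w" if w: "w \<in> tangent_vectors N" for w
  proof -
    have "smooth_map N N (\<lambda>p. f (g p))" by (rule smooth_map_compose[OF N M g f smooth_atlas_Euclidean_charts[OF N]])
    then have "tangent_map N N (\<lambda>p. f (g p)) w = tangent_map N N (\<lambda>p. p) w"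
      by (rule tangent_map_cong[OF N N _ fg w])
    then show ?thesis by (simp only: tangent_map_compose[OF N M N g f w] tangent_map_id[OF N w])
  qed
  show "inv_into (points (tangent_bundle M)) (tangent_map M N f) w = tangent_map N M g w" if w: "w \<in> tangent_vectors N"
    unfolding points_tangent_bundle[OF M]
  proof (rule inv_into_f_eq)
    show "inj_on (tangent_map M N f) (tangent_vectors M)" by (rule inj_on_inverseI[where g="tangent_map N M g"]) (rule 1)
    show "tangent_map N M g w \<in> tangent_vectors M" by (rule tangent_map_in[OF N M g w])
  qed (rule 2[OF w])
qed

lemma canon_inv_canon: "s \<in> extensional X \<Longrightarrow> p \<in> extensional X \<Longrightarrow> canon_inv X (canon X (s, p)) = (s, p)"
  by (auto simp: canon_inv_def canon_def extensional_def fun_eq_iff)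

lemma canon_canon_inv: "q \<in> extensional X \<Longrightarrow> canon X (canon_inv X q) = q"
  by (auto simp: canon_inv_def canon_def extensional_def fun_eq_iff)

lemma hyph_iso_inverse:
  assumes "hyph_iso a b f"
  obtains g where "hyph_mor b a g" "\<forall>u\<in>points (UU a). UU_map g (UU_map f u) = u"
    "\<forall>v\<in>points (UU b). UU_map f (UU_map g v) = v"
proof -
  obtain g where g: "hyph_mor b a g" "hyph_eq a (hyph_comp g f) hyph_id" "hyph_eq b (hyph_comp f g) hyph_id"
    using assms by (auto simp: hyph_iso_def)
  show ?thesis
    by (rule that[OF g(1)]) (use UU_map_cong[OF g(2)] UU_map_cong[OF g(3)] in \<open>simp_all add: UU_map_hyph_comp UU_map_hyph_id\<close>)
qed

lemma dCrlD:
  assumes "c \<in> dCrl a"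
  shows "smooth_map (UU (tot a)) (tangent_bundle (UU (st a))) (fst c)"
    and "x \<in> points (UU (tot a)) \<Longrightarrow> fst (fst c x) = UU_map (prj a) x"
    and "x \<in> points (UU (tot a)) \<Longrightarrow> snd c x \<in> points (UU (st a))"
    and "x \<in> points (UU (tot a)) \<Longrightarrow> \<exists>g\<in>Ar (base (st a)).
           Src (base (st a)) g = fst (UU_map (prj a) x) \<and> Tgt (base (st a)) g = fst (snd c x) \<and>
           (snd (UU_map (prj a) x), snd (snd c x)) \<in> rel (st a) g"
  using assms by (auto simp: dCrl_def split_beta PiE_iff)

section \<open>The control induced by one network\<close>

locale hybrid_network =
  fixes X :: "'i set" and H :: "'i \<Rightarrow> ('s1, 'e1, 'p1, 't1, 'g1, 'q1) hss"
    and a :: "('s, 'e, 'p, 't, 'g, 'q) hss" and i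
  assumes network: "network X H a i"
begin

abbreviation "UTot \<equiv> UU (tot a)"
abbreviation "USt \<equiv> UU (st a)"
abbreviation "UTotProd \<equiv> UU (tot (hss_prod X H))"
abbreviation "UStProd \<equiv> UU (st (hss_prod X H))"
abbreviation "UStH x \<equiv> UU (st (H x))"
abbreviation "ProdUSt \<equiv> mfd_prod X UStH"
text \<open>\<open>pr_st x\<close> is the map \<open>q x\<close> of the overview, and
  \<open>pr_tot x\<close> its counterpart on total spaces.\<close>

abbreviation "pr_tot x u \<equiv> canon X (UU_map (mtot i) u) x"
abbreviation "pr_st x u \<equiv> canon X (UU_map (mst i) u) x"

lemma finite_X: "finite X"
  and H: "x \<in> X \<Longrightarrow> hybrid_surj_submersion (H x)"
  and a: "hybrid_surj_submersion a"
  and i: "hss_mor a (hss_prod X H) i" and iso: "hyph_iso (st a) (st (hss_prod X H)) (mst i)"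
  using network by (auto simp: network_def interconnection_def)

lemma smooth_hyphs:
  shows "smooth_hyph (tot a)" "smooth_hyph (st a)"
    and "x \<in> X \<Longrightarrow> smooth_hyph (tot (H x))" "x \<in> X \<Longrightarrow> smooth_hyph (st (H x))"
    and "smooth_hyph (tot (hss_prod X H))" "smooth_hyph (st (hss_prod X H))"
proof -
  show "smooth_hyph (tot a)" "smooth_hyph (st a)"
    using a by (simp_all add: hybrid_surj_submersion_def smooth_hyph)
  show 1: "smooth_hyph (tot (H x))" "smooth_hyph (st (H x))" if "x \<in> X" for x
    using H[OF that] by (simp_all add: hybrid_surj_submersion_def smooth_hyph)
  show "smooth_hyph (tot (hss_prod X H))" "smooth_hyph (st (hss_prod X H))"
    using smooth_hyph_prod[OF finite_X 1(1)] smooth_hyph_prod[OF finite_X 1(2)] by (simp_all add: hss_prod_def)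
qed

lemma atlases:
  shows "smooth_atlas UTot" "smooth_atlas USt"
    and "x \<in> X \<Longrightarrow> smooth_atlas (UU (tot (H x)))" "x \<in> X \<Longrightarrow> smooth_atlas (UStH x)"
    and "smooth_atlas UTotProd" "smooth_atlas UStProd" "smooth_atlas ProdUSt"
  using smooth_hyphs smooth_atlas_UU smooth_atlas_mfd_prod[OF finite_X, of UStH] by blast+

lemma smooth_interconnection:
  shows "smooth_map UTot UTotProd (UU_map (mtot i))" "smooth_map USt UStProd (UU_map (mst i))"
  using i smooth_map_UU_map smooth_hyphs unfolding hss_mor_def by blast+

lemma st_prod: "UStProd = mfd_sum (\<Pi>\<^sub>E x\<in>X. Ob (base (st (H x)))) (\<lambda>s. mfd_prod X (\<lambda>x. space (st (H x)) (s x)))"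
  and tot_prod: "UTotProd = mfd_sum (\<Pi>\<^sub>E x\<in>X. Ob (base (tot (H x)))) (\<lambda>s. mfd_prod X (\<lambda>x. space (tot (H x)) (s x)))"
  by (simp_all add: hss_prod_def UU_hyph_prod)

lemma smooth_canon:
  shows "smooth_map UStProd ProdUSt (canon X)" "smooth_map ProdUSt UStProd (canon_inv X)"
    and "smooth_map UTotProd (mfd_prod X (\<lambda>x. UU (tot (H x)))) (canon X)"
proof -
  have st: "smooth_atlas (space (st (H x)) s)" if "x \<in> X" "s \<in> Ob (base (st (H x)))" for x s
    using smooth_hyphs(4)[OF that(1)] that(2) by (simp add: smooth_hyph_def)
  have tot: "smooth_atlas (space (tot (H x)) s)" if "x \<in> X" "s \<in> Ob (base (tot (H x)))" for x s
    using smooth_hyphs(3)[OF that(1)] that(2) by (simp add: smooth_hyph_def)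
  show "smooth_map UStProd ProdUSt (canon X)" unfolding st_prod unfolding UU_def
    by (rule smooth_map_canon[OF finite_X st])
  show "smooth_map ProdUSt UStProd (canon_inv X)" unfolding st_prod unfolding UU_def
    by (rule smooth_map_canon_inv[OF finite_X st])
  show "smooth_map UTotProd (mfd_prod X (\<lambda>x. UU (tot (H x)))) (canon X)" unfolding tot_prod unfolding UU_def
    by (rule smooth_map_canon[OF finite_X tot])
qed

lemma canon_inverse:
  shows "p \<in> points UStProd \<Longrightarrow> canon_inv X (canon X p) = p"
    and "q \<in> points ProdUSt \<Longrightarrow> canon X (canon_inv X q) = q"
proof -
  show "canon_inv X (canon X p) = p" if p: "p \<in> points UStProd"
  proof -
    obtain s v where sv: "p = (s, v)" "s \<in> extensional X" "v \<in> extensional X"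
      using p by (auto simp: st_prod points_mfd_sum points_mfd_prod PiE_iff)
    then show ?thesis by (simp add: canon_inv_canon)
  qed
  show "canon X (canon_inv X q) = q" if q: "q \<in> points ProdUSt"
    by (rule canon_canon_inv) (use q in \<open>simp add: points_mfd_prod PiE_iff\<close>)
qed

lemma smooth_pr:
  assumes x: "x \<in> X"
  shows "smooth_map UTot (UU (tot (H x))) (pr_tot x)" "smooth_map USt (UStH x) (pr_st x)"
proof -
  have "smooth_map UTotProd (UU (tot (H x))) (\<lambda>u. canon X u x)"
    by (rule smooth_map_compose[OF atlases(5) smooth_atlas_mfd_prod[OF finite_X atlases(3)] smooth_canon(3)
          smooth_map_pr[OF finite_X atlases(3) x] smooth_atlas_Euclidean_charts[OF atlases(3)[OF x]]])
  from smooth_map_compose[OF atlases(1) atlases(5) smooth_interconnection(1) this smooth_atlas_Euclidean_charts[OF atlases(3)[OF x]]]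
  show "smooth_map UTot (UU (tot (H x))) (pr_tot x)" .
  have "smooth_map UStProd (UStH x) (\<lambda>u. canon X u x)"
    by (rule smooth_map_compose[OF atlases(6,7) smooth_canon(1)
          smooth_map_pr[OF finite_X atlases(4) x] smooth_atlas_Euclidean_charts[OF atlases(4)[OF x]]])
  from smooth_map_compose[OF atlases(2) atlases(6) smooth_interconnection(2) this smooth_atlas_Euclidean_charts[OF atlases(4)[OF x]]]
  show "smooth_map USt (UStH x) (pr_st x)" .
qed

text \<open>T of the composite is taken apart into its three stages, so that injectivity and
  cancellation of inverses can be applied to each.\<close>

lemma tangent_map_pr_st:
  assumes x: "x \<in> X" and u: "u \<in> tangent_vectors USt"
  shows "tangent_map USt (UStH x) (pr_st x) u =
    tangent_map ProdUSt (UStH x) (\<lambda>p. p x) (tangent_map UStProd ProdUSt (canon X) (tangent_map USt UStProd (UU_map (mst i)) u))"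
proof -
  note iu = tangent_map_in[OF atlases(2,6) smooth_interconnection(2) u]
  have pr: "smooth_map ProdUSt (UStH x) (\<lambda>p. p x)" by (rule smooth_map_pr[OF finite_X atlases(4) x])
  have cp: "smooth_map UStProd (UStH x) (\<lambda>u. canon X u x)"
    by (rule smooth_map_compose[OF atlases(6,7) smooth_canon(1) pr smooth_atlas_Euclidean_charts[OF atlases(4)[OF x]]])
  show ?thesis
    unfolding tangent_map_compose[OF atlases(6,7) atlases(4)[OF x] smooth_canon(1) pr iu]
    unfolding tangent_map_compose[OF atlases(2,6) atlases(4)[OF x] smooth_interconnection(2) cp u] ..
qed

text \<open>Besides its map on points the inverse morphism \<open>g\<close> itself is kept, since
  its action on edges is needed in \<open>control_in_dCrl\<close>.\<close>

lemma st_inverse: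
  obtains g where "hyph_mor (st (hss_prod X H)) (st a) g" "smooth_map UStProd USt (UU_map g)"
    "\<forall>u\<in>points USt. UU_map g (UU_map (mst i) u) = u"
    "\<forall>v\<in>points UStProd. UU_map (mst i) (UU_map g v) = v"
proof -
  obtain g where g: "hyph_mor (st (hss_prod X H)) (st a) g"
    "\<forall>u\<in>points USt. UU_map g (UU_map (mst i) u) = u"
    "\<forall>v\<in>points UStProd. UU_map (mst i) (UU_map g v) = v"
    by (rule hyph_iso_inverse[OF iso])
  show ?thesis by (rule that[OF g(1) smooth_map_UU_map[OF smooth_hyphs(6,2) g(1)] g(2,3)])
qed

text \<open>A tuple is determined by its components, and the two maps before the projections have
  left inverses on points.\<close>

lemma points_st_eqI:
  assumes r: "r \<in> points USt" "r' \<in> points USt" and eq: "\<And>x. x \<in> X \<Longrightarrow> pr_st x r = pr_st x r'"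
  shows "r = r'"
proof -
  obtain g where g0: "hyph_mor (st (hss_prod X H)) (st a) g" "smooth_map UStProd USt (UU_map g)"
    "\<forall>u\<in>points USt. UU_map g (UU_map (mst i) u) = u" "\<forall>v\<in>points UStProd. UU_map (mst i) (UU_map g v) = v"
    by (rule st_inverse)
  note g = g0(2-4)[rule_format]
  note ir = smooth_map_in_points[OF smooth_interconnection(2)]
  have "canon X (UU_map (mst i) r) = canon X (UU_map (mst i) r')"
    by (rule extensionalityI[of _ X]) (use eq in \<open>auto simp: canon_def split_beta\<close>)
  then have "UU_map (mst i) r = UU_map (mst i) r'"
    using canon_inverse(1)[OF ir[OF r(1)]] canon_inverse(1)[OF ir[OF r(2)]] by metis
  then show ?thesis using g(2)[OF r(1)] g(2)[OF r(2)] by metis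
qed

text \<open>The same cancellation one level up, with \<open>tangent_pr\<close> in place of the tuple
  of components.\<close>

lemma tangent_vectors_st_eqI:
  assumes u: "u \<in> tangent_vectors USt" "u' \<in> tangent_vectors USt"
    and eq: "\<And>x. x \<in> X \<Longrightarrow> tangent_map USt (UStH x) (pr_st x) u = tangent_map USt (UStH x) (pr_st x) u'"
  shows "u = u'"
proof -
  obtain g where g0: "hyph_mor (st (hss_prod X H)) (st a) g" "smooth_map UStProd USt (UU_map g)"
    "\<forall>u\<in>points USt. UU_map g (UU_map (mst i) u) = u" "\<forall>v\<in>points UStProd. UU_map (mst i) (UU_map g v) = v"
    by (rule st_inverse)
  note g = g0(2-4)[rule_format]
  let ?i = "tangent_map USt UStProd (UU_map (mst i))" and ?c = "tangent_map UStProd ProdUSt (canon X)"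
  note iu = tangent_map_in[OF atlases(2,6) smooth_interconnection(2)]
  note cu = tangent_map_in[OF atlases(6,7) smooth_canon(1)]
  have inj: "inj_on (tangent_pr X UStH) (tangent_vectors ProdUSt)"
    by (rule inj_on_tangent_pr[OF finite_X atlases(4)])
  have "tangent_pr X UStH (?c (?i u)) = tangent_pr X UStH (?c (?i u'))"
    using eq tangent_map_pr_st u by (auto simp: tangent_pr_def fun_eq_iff)
  then have "?c (?i u) = ?c (?i u')"
    by (rule inj_onD[OF inj]) (intro iu cu u)+
  then have "?i u = ?i u'"
    using tangent_map_inv(1)[OF atlases(6,7) smooth_canon(1,2) canon_inverse iu[OF u(1)]]
      tangent_map_inv(1)[OF atlases(6,7) smooth_canon(1,2) canon_inverse iu[OF u(2)]] by metis
  then show ?thesis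
    using tangent_map_inv(1)[OF atlases(2,6) smooth_interconnection(2) g u(1)]
      tangent_map_inv(1)[OF atlases(2,6) smooth_interconnection(2) g u(2)] by metis
qed

text \<open>The projection of the product is the product of the projections, read through
  \<open>canon X\<close>; the base points of a product control appear in this shape.\<close>

lemma prj_prod: "UU_map (prj (hss_prod X H)) v = canon_inv X (\<lambda>x\<in>X. UU_map (prj (H x)) (canon X v x))"
  by (simp add: hss_prod_def hyph_tuple_def hyph_comp_def hyph_pr_def UU_map_def canon_inv_def canon_def split_beta cong: restrict_cong)

lemma prj_interconnection:
  assumes "u \<in> points UTot"
  shows "UU_map (prj (hss_prod X H)) (UU_map (mtot i) u) = UU_map (mst i) (UU_map (prj a) u)"
  using UU_map_cong[OF _ assms, of "hyph_comp (prj (hss_prod X H)) (mtot i)" "hyph_comp (mst i) (prj a)"] i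
  by (simp add: hss_mor_def UU_map_hyph_comp)

lemma smooth_prj:
  shows "smooth_map UTot USt (UU_map (prj a))"
    and "x \<in> X \<Longrightarrow> smooth_map (UU (tot (H x))) (UStH x) (UU_map (prj (H x)))"
  using a H by (auto simp: hybrid_surj_submersion_def surj_submersion_def)

text \<open>Values of the product control in \<open>ProdUSt\<close>, before they are carried back
  along the inverses of \<open>canon X\<close> and \<open>UU_map (mst i)\<close>.\<close>

definition "control_vector w u = prod_tangent X UStH (\<lambda>x\<in>X. fst (w x) (pr_tot x u))"
definition "control_jump w u = (\<lambda>x\<in>X. snd (w x) (pr_tot x u))"

lemma
  assumes w: "w \<in> (\<Pi>\<^sub>E x\<in>X. dCrl (H x))" and u: "u \<in> points UTot"
  shows control_vector_in: "control_vector w u \<in> tangent_vectors ProdUSt"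
    and tangent_map_pr_control_vector:
      "x \<in> X \<Longrightarrow> tangent_map ProdUSt (UStH x) (\<lambda>p. p x) (control_vector w u) = fst (w x) (pr_tot x u)"
    and fst_control_vector: "fst (control_vector w u) = (\<lambda>x\<in>X. UU_map (prj (H x)) (pr_tot x u))"
    and control_jump_in: "control_jump w u \<in> points ProdUSt"
proof -
  have wx: "fst (w x) (pr_tot x u) \<in> tangent_vectors (UStH x)"
    "fst (fst (w x) (pr_tot x u)) = UU_map (prj (H x)) (pr_tot x u)"
    "snd (w x) (pr_tot x u) \<in> points (UStH x)" if x: "x \<in> X" for x
  proof -
    have p: "pr_tot x u \<in> points (UU (tot (H x)))" by (rule smooth_map_in_points[OF smooth_pr(1)[OF x] u])
    note c = dCrlD[OF PiE_mem[OF w x]]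
    from smooth_map_tangent_vectors[OF atlases(4)[OF x] c(1)] p
    show "fst (w x) (pr_tot x u) \<in> tangent_vectors (UStH x)" by blast
    show "fst (fst (w x) (pr_tot x u)) = UU_map (prj (H x)) (pr_tot x u)"
      "snd (w x) (pr_tot x u) \<in> points (UStH x)"
      using c(2,3)[OF p] by simp_all
  qed
  have f: "(\<lambda>x\<in>X. fst (w x) (pr_tot x u)) \<in> (\<Pi>\<^sub>E x\<in>X. tangent_vectors (UStH x))" using wx(1) by auto
  show "control_vector w u \<in> tangent_vectors ProdUSt"
    unfolding control_vector_def by (rule prod_tangent_in[OF finite_X atlases(4) f])
  show "tangent_map ProdUSt (UStH x) (\<lambda>p. p x) (control_vector w u) = fst (w x) (pr_tot x u)" if "x \<in> X"
    unfolding control_vector_def using tangent_map_pr_prod_tangent[OF finite_X atlases(4) f that] that by simp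
  show "fst (control_vector w u) = (\<lambda>x\<in>X. UU_map (prj (H x)) (pr_tot x u))"
    unfolding control_vector_def using fst_prod_tangent[OF finite_X atlases(4) f] wx(2) by (simp cong: restrict_cong)
  show "control_jump w u \<in> points ProdUSt"
    using wx(3) by (auto simp: control_jump_def points_mfd_prod)
qed

lemma smooth_control_vector:
  assumes w: "w \<in> (\<Pi>\<^sub>E x\<in>X. dCrl (H x))"
  shows "smooth_map UTot (tangent_bundle ProdUSt) (control_vector w)"
    and "smooth_map UTot ProdUSt (\<lambda>u. fst (control_vector w u))"
proof -
  have 1: "smooth_map UTot (tangent_bundle (UStH x)) (\<lambda>u. fst (w x) (pr_tot x u))"
    and 2: "smooth_map UTot (UStH x) (\<lambda>u. fst (fst (w x) (pr_tot x u)))" if x: "x \<in> X" for x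
  proof -
    note c = dCrlD[OF PiE_mem[OF w x]]
    show "smooth_map UTot (tangent_bundle (UStH x)) (\<lambda>u. fst (w x) (pr_tot x u))"
      by (rule smooth_map_compose[OF atlases(1) atlases(3)[OF x] smooth_pr(1)[OF x] c(1) Euclidean_charts_tangent_bundle[OF atlases(4)[OF x]]])
    have "smooth_map UTot (UStH x) (\<lambda>u. UU_map (prj (H x)) (pr_tot x u))"
      by (rule smooth_map_compose[OF atlases(1) atlases(3)[OF x] smooth_pr(1)[OF x] smooth_prj(2)[OF x] smooth_atlas_Euclidean_charts[OF atlases(4)[OF x]]])
    then show "smooth_map UTot (UStH x) (\<lambda>u. fst (fst (w x) (pr_tot x u)))"
    proof (rule smooth_map_cong[OF atlases(1), rotated])
      show "UU_map (prj (H x)) (pr_tot x u) = fst (fst (w x) (pr_tot x u))" if "u \<in> points UTot" for u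
        using c(2)[OF smooth_map_in_points[OF smooth_pr(1)[OF x] that]] by simp
    qed
  qed
  show "smooth_map UTot (tangent_bundle ProdUSt) (control_vector w)"
    "smooth_map UTot ProdUSt (\<lambda>u. fst (control_vector w u))"
    using smooth_map_prod_tangent[where V="\<lambda>x u. fst (w x) (pr_tot x u)", OF finite_X atlases(4) atlases(1) 1 2]
    by (simp_all add: control_vector_def[abs_def])
qed

abbreviation "control w \<equiv> (dCrl_pullback a (hss_prod X H) i \<circ> dCrl_prod X H) w"

text \<open>Replaces both layers of \<open>inv_into\<close> by the explicit inverses
  \<open>canon_inv X\<close> and \<open>UU_map g\<close> and their tangent maps, which are visibly
  smooth.\<close>

lemma control_eq:
  assumes g0: "smooth_map UStProd USt (UU_map g)"
    "\<forall>u\<in>points USt. UU_map g (UU_map (mst i) u) = u"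
    "\<forall>v\<in>points UStProd. UU_map (mst i) (UU_map g v) = v"
    and w: "w \<in> (\<Pi>\<^sub>E x\<in>X. dCrl (H x))"
  shows "control w = (\<lambda>u\<in>points UTot. tangent_map UStProd USt (UU_map g) (tangent_map ProdUSt UStProd (canon_inv X) (control_vector w u)),
     \<lambda>u\<in>points UTot. UU_map g (canon_inv X (control_jump w u)))"
proof -
  note g = g0[rule_format]
  have 1: "inv_into (points (tangent_bundle USt)) (tangent_map USt UStProd (UU_map (mst i))) (fst (dCrl_prod X H w) (UU_map (mtot i) u)) =
      tangent_map UStProd USt (UU_map g) (tangent_map ProdUSt UStProd (canon_inv X) (control_vector w u))" if u: "u \<in> points UTot" for u
  proof -
    note cv = control_vector_in[OF w u]
    have "fst (dCrl_prod X H w) (UU_map (mtot i) u) = inv_into (points (tangent_bundle UStProd)) (tangent_map UStProd ProdUSt (canon X)) (control_vector w u)"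
      using smooth_map_in_points[OF smooth_interconnection(1) u] by (simp add: dCrl_prod_def control_vector_def)
    also have "\<dots> = tangent_map ProdUSt UStProd (canon_inv X) (control_vector w u)"
      by (rule tangent_map_inv(3)[OF atlases(6,7) smooth_canon(1,2) canon_inverse cv])
    finally show ?thesis
      using tangent_map_inv(3)[OF atlases(2,6) smooth_interconnection(2) g tangent_map_in[OF atlases(7,6) smooth_canon(2) cv]] by simp
  qed
  have 2: "inv_into (points USt) (UU_map (mst i)) (snd (dCrl_prod X H w) (UU_map (mtot i) u)) = UU_map g (canon_inv X (control_jump w u))"
    if u: "u \<in> points UTot" for u
  proof -
    note cj = control_jump_in[OF w u]
    have inj1: "inj_on (canon X) (points UStProd)"
      by (rule inj_on_inverseI[where g="canon_inv X"]) (rule canon_inverse(1))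
    have inj2: "inj_on (UU_map (mst i)) (points USt)"
      by (rule inj_on_inverseI[where g="UU_map g"]) (rule g(2))
    have cp: "canon_inv X (control_jump w u) \<in> points UStProd" by (rule smooth_map_in_points[OF smooth_canon(2) cj])
    have "snd (dCrl_prod X H w) (UU_map (mtot i) u) = inv_into (points UStProd) (canon X) (control_jump w u)"
      using smooth_map_in_points[OF smooth_interconnection(1) u] by (simp add: dCrl_prod_def control_jump_def)
    also have "\<dots> = canon_inv X (control_jump w u)"
      by (rule inv_into_f_eq[OF inj1 cp canon_inverse(2)[OF cj]])
    finally show ?thesis
      using inv_into_f_eq[OF inj2 smooth_map_in_points[OF g(1) cp] g(3)[OF cp]] by simp
  qed
  show ?thesis
    using 1 2 by (simp add: dCrl_pullback_def split_beta cong: restrict_cong)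
qed

text \<open>Each inverse in \<open>control_eq\<close> meets the stage of \<open>pr_st x\<close> that
  it inverts, and only the projection to factor \<open>x\<close> remains.\<close>

lemma control_pr:
  assumes w: "w \<in> (\<Pi>\<^sub>E x\<in>X. dCrl (H x))" and u: "u \<in> points UTot" and x: "x \<in> X"
  shows "tangent_map USt (UStH x) (pr_st x) (fst (control w) u) = fst (w x) (pr_tot x u)"
    and "pr_st x (snd (control w) u) = snd (w x) (pr_tot x u)"
proof -
  obtain g where g0: "hyph_mor (st (hss_prod X H)) (st a) g" "smooth_map UStProd USt (UU_map g)"
    "\<forall>u\<in>points USt. UU_map g (UU_map (mst i) u) = u" "\<forall>v\<in>points UStProd. UU_map (mst i) (UU_map g v) = v"
    by (rule st_inverse)
  note g = g0(2-4)[rule_format]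
  have fst_control: "fst (control w) u = tangent_map UStProd USt (UU_map g) (tangent_map ProdUSt UStProd (canon_inv X) (control_vector w u))"
    and snd_control: "snd (control w) u = UU_map g (canon_inv X (control_jump w u))"
    unfolding control_eq[OF g0(2-4) w] using u by simp_all
  note cv = control_vector_in[OF w u]
  note cj = control_jump_in[OF w u]
  let ?v = "tangent_map ProdUSt UStProd (canon_inv X) (control_vector w u)"
  have v: "?v \<in> tangent_vectors UStProd" by (rule tangent_map_in[OF atlases(7,6) smooth_canon(2) cv])
  have "tangent_map USt (UStH x) (pr_st x) (tangent_map UStProd USt (UU_map g) ?v) =
     tangent_map ProdUSt (UStH x) (\<lambda>p. p x) (tangent_map UStProd ProdUSt (canon X)
       (tangent_map USt UStProd (UU_map (mst i)) (tangent_map UStProd USt (UU_map g) ?v)))"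
    by (rule tangent_map_pr_st[OF x tangent_map_in[OF atlases(6,2) g(1) v]])
  also have "tangent_map USt UStProd (UU_map (mst i)) (tangent_map UStProd USt (UU_map g) ?v) = ?v"
    by (rule tangent_map_inv(2)[OF atlases(2,6) smooth_interconnection(2) g v])
  also have "tangent_map UStProd ProdUSt (canon X) ?v = control_vector w u"
    by (rule tangent_map_inv(2)[OF atlases(6,7) smooth_canon(1,2) canon_inverse cv])
  finally show "tangent_map USt (UStH x) (pr_st x) (fst (control w) u) = fst (w x) (pr_tot x u)"
    unfolding fst_control tangent_map_pr_control_vector[OF w u x] .
  have cp: "canon_inv X (control_jump w u) \<in> points UStProd" by (rule smooth_map_in_points[OF smooth_canon(2) cj])
  have "canon X (UU_map (mst i) (UU_map g (canon_inv X (control_jump w u)))) = control_jump w u"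
    using g(3)[OF cp] canon_inverse(2)[OF cj] by simp
  then show "pr_st x (snd (control w) u) = snd (w x) (pr_tot x u)"
    unfolding snd_control using x by (simp add: control_jump_def)
qed

lemma control_in_dCrl:
  assumes w: "w \<in> (\<Pi>\<^sub>E x\<in>X. dCrl (H x))"
  shows "control w \<in> dCrl a"
proof -
  obtain g where g0: "hyph_mor (st (hss_prod X H)) (st a) g" "smooth_map UStProd USt (UU_map g)"
    "\<forall>u\<in>points USt. UU_map g (UU_map (mst i) u) = u" "\<forall>v\<in>points UStProd. UU_map (mst i) (UU_map g v) = v"
    by (rule st_inverse)
  note gm = g0(1) and g = g0(2-4)[rule_format]
  let ?C = "\<lambda>u. tangent_map ProdUSt UStProd (canon_inv X) (control_vector w u)"
  let ?V = "\<lambda>u. tangent_map UStProd USt (UU_map g) (?C u)"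
  let ?\<rho> = "\<lambda>u. UU_map g (canon_inv X (control_jump w u))"
  \<comment> \<open>That \<open>i\<close> commutes with the projections identifies the tuple of base
    points; applying \<open>UU_map g\<close> gives back the base point in \<open>a\<close>. This
    serves for the vector field and for the sources of the edges.\<close>
  have prj: "canon_inv X (\<lambda>x\<in>X. UU_map (prj (H x)) (pr_tot x u)) = UU_map (mst i) (UU_map (prj a) u)"
    if u: "u \<in> points UTot" for u
    using prj_prod[of "UU_map (mtot i) u"] prj_interconnection[OF u] by simp
  have C: "smooth_map UTot (tangent_bundle UStProd) ?C"
    by (rule smooth_map_tangent_map[OF atlases(1,7,6) smooth_canon(2) smooth_control_vector(2)[OF w] smooth_control_vector(1)[OF w]])
  have "smooth_map UTot UStProd (\<lambda>u. canon_inv X (fst (control_vector w u)))"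
    by (rule smooth_map_compose[OF atlases(1,7) smooth_control_vector(2)[OF w] smooth_canon(2) smooth_atlas_Euclidean_charts[OF atlases(6)]])
  then have fC: "smooth_map UTot UStProd (\<lambda>u. fst (?C u))" by simp
  have V: "smooth_map UTot (tangent_bundle USt) ?V"
    by (rule smooth_map_tangent_map[OF atlases(1,6,2) g(1) fC C])
  \<comment> \<open>Smoothness was obtained for \<open>?V\<close>, whereas elements of
    \<open>dCrl\<close> are extensional.\<close>
  have "smooth_map UTot (tangent_bundle USt) (restrict ?V (points UTot))"
    by (rule smooth_map_cong[OF atlases(1) _ V]) simp
  moreover have fV: "fst (?V u) = UU_map (prj a) u" if u: "u \<in> points UTot" for u
    using fst_control_vector[OF w u] prj[OF u] g(2)[OF smooth_map_in_points[OF smooth_prj(1) u]] by simp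
  moreover have "?\<rho> u \<in> points USt" if u: "u \<in> points UTot" for u
    by (rule smooth_map_in_points[OF g(1) smooth_map_in_points[OF smooth_canon(2) control_jump_in[OF w u]]])
  moreover have "\<exists>\<gamma>\<in>Ar (base (st a)). Src (base (st a)) \<gamma> = fst (UU_map (prj a) u) \<and> Tgt (base (st a)) \<gamma> = fst (?\<rho> u) \<and>
      (snd (UU_map (prj a) u), snd (?\<rho> u)) \<in> rel (st a) \<gamma>" if u: "u \<in> points UTot" for u
  proof -
    let ?B = "\<lambda>x. base (st (H x))"
    let ?p = "\<lambda>x. UU_map (prj (H x)) (pr_tot x u)" and ?r = "\<lambda>x. snd (w x) (pr_tot x u)"
    have "\<forall>x\<in>X. \<exists>\<gamma>. \<gamma> \<in> Ar (?B x) \<and> Src (?B x) \<gamma> = fst (?p x) \<and> Tgt (?B x) \<gamma> = fst (?r x) \<and> (snd (?p x), snd (?r x)) \<in> rel (st (H x)) \<gamma>"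
    proof
      fix x assume x: "x \<in> X"
      have "pr_tot x u \<in> points (UU (tot (H x)))" by (rule smooth_map_in_points[OF smooth_pr(1)[OF x] u])
      from dCrlD(4)[OF PiE_mem[OF w x] this]
      show "\<exists>\<gamma>. \<gamma> \<in> Ar (?B x) \<and> Src (?B x) \<gamma> = fst (?p x) \<and> Tgt (?B x) \<gamma> = fst (?r x) \<and> (snd (?p x), snd (?r x)) \<in> rel (st (H x)) \<gamma>"
        by blast
    qed
    from bchoice[OF this] obtain \<gamma> where \<gamma>: "\<forall>x\<in>X. \<gamma> x \<in> Ar (?B x) \<and> Src (?B x) (\<gamma> x) = fst (?p x) \<and> Tgt (?B x) (\<gamma> x) = fst (?r x)
      \<and> (snd (?p x), snd (?r x)) \<in> rel (st (H x)) (\<gamma> x)" ..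
    \<comment> \<open>The tuple of the chosen edges is an edge of the product, running between the
      tuples of nodes and relating the tuples of points.\<close>
    let ?\<gamma> = "restrict \<gamma> X" and ?P = "st (hss_prod X H)"
    have m: "?\<gamma> \<in> Ar (base ?P)" "Src (base ?P) ?\<gamma> = (\<lambda>x\<in>X. fst (?p x))" "Tgt (base ?P) ?\<gamma> = (\<lambda>x\<in>X. fst (?r x))"
      "(\<lambda>x\<in>X. snd (?p x), \<lambda>x\<in>X. snd (?r x)) \<in> rel ?P ?\<gamma>"
      using \<gamma> by (auto simp: hss_prod_def hyph_prod_def cat_prod_def cong: restrict_cong)
    have f: "is_functor (base ?P) (base (st a)) (onob g) (onar g)" using gm by (simp add: hyph_mor_def)
    have e: "onar g ?\<gamma> \<in> Ar (base (st a))" "Src (base (st a)) (onar g ?\<gamma>) = onob g (\<lambda>x\<in>X. fst (?p x))"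
      "Tgt (base (st a)) (onar g ?\<gamma>) = onob g (\<lambda>x\<in>X. fst (?r x))"
      using f m(1-3) by (auto simp: is_functor_def Pi_iff)
    have "(onpt g (Src (base ?P) ?\<gamma>) (\<lambda>x\<in>X. snd (?p x)), onpt g (Tgt (base ?P) ?\<gamma>) (\<lambda>x\<in>X. snd (?r x))) \<in> rel (st a) (onar g ?\<gamma>)"
      using gm m(1,4) unfolding hyph_mor_def by force
    then have rel: "(onpt g (\<lambda>x\<in>X. fst (?p x)) (\<lambda>x\<in>X. snd (?p x)), onpt g (\<lambda>x\<in>X. fst (?r x)) (\<lambda>x\<in>X. snd (?r x))) \<in> rel (st a) (onar g ?\<gamma>)"
      unfolding m(2,3) .
    \<comment> \<open>Source and target of the image edge are the base point and the jump, both
      expressed through \<open>g\<close>.\<close>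
    have "UU_map (prj a) u = UU_map g (canon_inv X (\<lambda>x\<in>X. ?p x))"
      using prj[OF u] g(2)[OF smooth_map_in_points[OF smooth_prj(1) u]] by simp
    then have p: "UU_map (prj a) u = (onob g (\<lambda>x\<in>X. fst (?p x)), onpt g (\<lambda>x\<in>X. fst (?p x)) (\<lambda>x\<in>X. snd (?p x)))"
      by (simp add: canon_inv_def UU_map_def cong: restrict_cong)
    have r: "?\<rho> u = (onob g (\<lambda>x\<in>X. fst (?r x)), onpt g (\<lambda>x\<in>X. fst (?r x)) (\<lambda>x\<in>X. snd (?r x)))"
      by (simp add: canon_inv_def UU_map_def control_jump_def cong: restrict_cong)
    show ?thesis unfolding p r using e rel by (intro bexI[of _ "onar g ?\<gamma>"]) simp_all
  qed
  ultimately show ?thesis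
    unfolding control_eq[OF g0(2-4) w] dCrl_def by simp
qed

end

section \<open>Morphisms of networks\<close>

lemma control_related:
  fixes X :: "'i set" and HX :: "'i \<Rightarrow> ('s1, 'e1, 'p1, 't1, 'g1, 'q1) hss"
    and Y :: "'j set" and HY :: "'j \<Rightarrow> ('s3, 'e3, 'p3, 't3, 'g3, 'q3) hss"
  assumes "network X HX a ia" and "network Y HY b ib" and mor: "network_mor X HX a ia Y HY b ib \<phi> \<Phi> z"
    and wv: "(w, v) \<in> dCrl_family_rel X HX Y HY \<phi> \<Phi>"
  shows "((dCrl_pullback b (hss_prod Y HY) ib \<circ> dCrl_prod Y HY) w,
    (dCrl_pullback a (hss_prod X HX) ia \<circ> dCrl_prod X HX) v) \<in> dCrl_rel b a z"
proof -
  interpret A: hybrid_network X HX a ia by unfold_locales (rule assms(1))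
  interpret B: hybrid_network Y HY b ib by unfold_locales (rule assms(2))
  have w: "w \<in> (\<Pi>\<^sub>E y\<in>Y. dCrl (HY y))" and v: "v \<in> (\<Pi>\<^sub>E x\<in>X. dCrl (HX x))"
    and rel: "\<And>x. x \<in> X \<Longrightarrow> (w (\<phi> x), v x) \<in> dCrl_rel (HY (\<phi> x)) (HX x) (\<Phi> x)"
    using wv by (auto simp: dCrl_family_rel_def)
  have \<phi>: "\<And>x. x \<in> X \<Longrightarrow> \<phi> x \<in> Y" and \<Phi>: "\<And>x. x \<in> X \<Longrightarrow> hss_mor (HY (\<phi> x)) (HX x) (\<Phi> x)"
    and z: "hss_mor b a z" and eq: "hss_eq b (hss_comp ia z) (hss_comp (hss_Pi X \<phi> \<Phi>) ib)"
    using mor by (auto simp: network_mor_def)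
  \<comment> \<open>Component \<open>x\<close> of the equation between \<open>ia\<close> after
    \<open>z\<close> and \<open>hss_Pi X \<phi> \<Phi>\<close> after \<open>ib\<close>; the
    projection to \<open>x\<close> turns \<open>hss_Pi\<close> into \<open>\<Phi> x\<close> after
    the projection to \<open>\<phi> x\<close>.\<close>
  have eq_tot: "A.pr_tot x (UU_map (mtot z) u) = UU_map (mtot (\<Phi> x)) (B.pr_tot (\<phi> x) u)"
    if "x \<in> X" "u \<in> points B.UTot" for x u
    using eq that \<phi>[OF that(1)]
    by (auto simp: hss_eq_def hyph_eq_def hss_comp_def hyph_comp_def hss_Pi_def hss_tuple_def hyph_tuple_def
        hss_pr_def hyph_pr_def points_UU UU_map_def canon_def)
  have eq_st: "A.pr_st x (UU_map (mst z) u) = UU_map (mst (\<Phi> x)) (B.pr_st (\<phi> x) u)"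
    if "x \<in> X" "u \<in> points B.USt" for x u
    using eq that \<phi>[OF that(1)]
    by (auto simp: hss_eq_def hyph_eq_def hss_comp_def hyph_comp_def hss_Pi_def hss_tuple_def hyph_tuple_def
        hss_pr_def hyph_pr_def points_UU UU_map_def canon_def)
  have z_tot: "smooth_map B.UTot A.UTot (UU_map (mtot z))"
    using z by (intro smooth_map_UU_map A.smooth_hyphs B.smooth_hyphs) (simp add: hss_mor_def)
  have z_st: "smooth_map B.USt A.USt (UU_map (mst z))"
    using z by (intro smooth_map_UU_map A.smooth_hyphs B.smooth_hyphs) (simp add: hss_mor_def)
  note cB = B.control_in_dCrl[OF w]
  note cA = A.control_in_dCrl[OF v]
  have VB: "smooth_map B.UTot (tangent_bundle B.USt) (fst (B.control w))" "snd (B.control w) \<in> points B.UTot \<rightarrow> points B.USt"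
    using dCrlD[OF cB] by auto
  have VA: "smooth_map A.UTot (tangent_bundle A.USt) (fst (A.control v))" "snd (A.control v) \<in> points A.UTot \<rightarrow> points A.USt"
    using dCrlD[OF cA] by auto
  have "tangent_map B.USt A.USt (UU_map (mst z)) (fst (B.control w) u) = fst (A.control v) (UU_map (mtot z) u) \<and>
      UU_map (mst z) (snd (B.control w) u) = snd (A.control v) (UU_map (mtot z) u)" if u: "u \<in> points B.UTot" for u
  proof
    note zu = smooth_map_in_points[OF z_tot u]
    have Vu: "fst (B.control w) u \<in> tangent_vectors B.USt"
      using smooth_map_tangent_vectors[OF B.atlases(2) VB(1)] u by blast
    have \<rho>u: "snd (B.control w) u \<in> points B.USt" using VB(2) u by blast
    have related: "tangent_map (UU (st (HY (\<phi> x)))) (UU (st (HX x))) (UU_map (mst (\<Phi> x))) (fst (w (\<phi> x)) (B.pr_tot (\<phi> x) u)) =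
        fst (v x) (UU_map (mtot (\<Phi> x)) (B.pr_tot (\<phi> x) u))"
      "UU_map (mst (\<Phi> x)) (snd (w (\<phi> x)) (B.pr_tot (\<phi> x) u)) = snd (v x) (UU_map (mtot (\<Phi> x)) (B.pr_tot (\<phi> x) u))"
      if x: "x \<in> X" for x
    proof -
      have "B.pr_tot (\<phi> x) u \<in> points (UU (tot (HY (\<phi> x))))"
        by (rule smooth_map_in_points[OF B.smooth_pr(1)[OF \<phi>[OF x]] u])
      then show "tangent_map (UU (st (HY (\<phi> x)))) (UU (st (HX x))) (UU_map (mst (\<Phi> x))) (fst (w (\<phi> x)) (B.pr_tot (\<phi> x) u)) =
        fst (v x) (UU_map (mtot (\<Phi> x)) (B.pr_tot (\<phi> x) u))"
        "UU_map (mst (\<Phi> x)) (snd (w (\<phi> x)) (B.pr_tot (\<phi> x) u)) = snd (v x) (UU_map (mtot (\<Phi> x)) (B.pr_tot (\<phi> x) u))"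
        using rel[OF x] unfolding dCrl_rel_def by (auto simp: split_beta)
    qed
    show "tangent_map B.USt A.USt (UU_map (mst z)) (fst (B.control w) u) = fst (A.control v) (UU_map (mtot z) u)"
    proof (rule A.tangent_vectors_st_eqI)
      show "tangent_map B.USt A.USt (UU_map (mst z)) (fst (B.control w) u) \<in> tangent_vectors A.USt"
        by (rule tangent_map_in[OF B.atlases(2) A.atlases(2) z_st Vu])
      show "fst (A.control v) (UU_map (mtot z) u) \<in> tangent_vectors A.USt"
        using smooth_map_tangent_vectors[OF A.atlases(2) VA(1)] zu by blast
      fix x assume x: "x \<in> X"
      have \<Phi>x: "smooth_map (B.UStH (\<phi> x)) (A.UStH x) (UU_map (mst (\<Phi> x)))"
        using \<Phi>[OF x] by (intro smooth_map_UU_map A.smooth_hyphs(4)[OF x] B.smooth_hyphs(4)[OF \<phi>[OF x]]) (simp add: hss_mor_def)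
      have "tangent_map A.USt (A.UStH x) (A.pr_st x) (tangent_map B.USt A.USt (UU_map (mst z)) (fst (B.control w) u)) =
          tangent_map B.USt (A.UStH x) (\<lambda>p. A.pr_st x (UU_map (mst z) p)) (fst (B.control w) u)"
        by (rule tangent_map_compose[OF B.atlases(2) A.atlases(2) A.atlases(4)[OF x] z_st A.smooth_pr(2)[OF x] Vu])
      \<comment> \<open>The two composites agree on the points of \<open>B.USt\<close> only, which
        is what \<open>tangent_map_cong\<close> asks for.\<close>
      also have "\<dots> = tangent_map B.USt (A.UStH x) (\<lambda>p. UU_map (mst (\<Phi> x)) (B.pr_st (\<phi> x) p)) (fst (B.control w) u)"
        by (rule tangent_map_cong[OF B.atlases(2) A.atlases(4)[OF x]
              smooth_map_compose[OF B.atlases(2) A.atlases(2) z_st A.smooth_pr(2)[OF x] smooth_atlas_Euclidean_charts[OF A.atlases(4)[OF x]]]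
              eq_st[OF x] Vu])
      also have "\<dots> = tangent_map (B.UStH (\<phi> x)) (A.UStH x) (UU_map (mst (\<Phi> x)))
          (tangent_map B.USt (B.UStH (\<phi> x)) (B.pr_st (\<phi> x)) (fst (B.control w) u))"
        by (rule tangent_map_compose[symmetric, OF B.atlases(2) B.atlases(4)[OF \<phi>[OF x]] A.atlases(4)[OF x] B.smooth_pr(2)[OF \<phi>[OF x]] \<Phi>x Vu])
      also have "\<dots> = fst (v x) (A.pr_tot x (UU_map (mtot z) u))"
        unfolding B.control_pr(1)[OF w u \<phi>[OF x]] related(1)[OF x] eq_tot[OF x u] ..
      also have "\<dots> = tangent_map A.USt (A.UStH x) (A.pr_st x) (fst (A.control v) (UU_map (mtot z) u))"
        by (rule A.control_pr(1)[OF v zu x, symmetric])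
      finally show "tangent_map A.USt (A.UStH x) (A.pr_st x) (tangent_map B.USt A.USt (UU_map (mst z)) (fst (B.control w) u)) =
          tangent_map A.USt (A.UStH x) (A.pr_st x) (fst (A.control v) (UU_map (mtot z) u))" .
    qed
    show "UU_map (mst z) (snd (B.control w) u) = snd (A.control v) (UU_map (mtot z) u)"
    proof (rule A.points_st_eqI)
      show "UU_map (mst z) (snd (B.control w) u) \<in> points A.USt" by (rule smooth_map_in_points[OF z_st \<rho>u])
      show "snd (A.control v) (UU_map (mtot z) u) \<in> points A.USt" using VA(2) zu by blast
      fix x assume x: "x \<in> X"
      show "A.pr_st x (UU_map (mst z) (snd (B.control w) u)) = A.pr_st x (snd (A.control v) (UU_map (mtot z) u))"
        unfolding eq_st[OF x \<rho>u] B.control_pr(2)[OF w u \<phi>[OF x]] related(2)[OF x] A.control_pr(2)[OF v zu x] eq_tot[OF x u] ..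
    qed
  qed
  then show ?thesis
    using cA cB unfolding dCrl_rel_def by (auto simp: split_beta)
qed

theorem theorem3p4p3:
  fixes X :: "'i set" and HX :: "'i \<Rightarrow> ('s1, 'e1, 'p1, 't1, 'g1, 'q1) hss"
    and a :: "('s2, 'e2, 'p2, 't2, 'g2, 'q2) hss"
    and Y :: "'j set" and HY :: "'j \<Rightarrow> ('s3, 'e3, 'p3, 't3, 'g3, 'q3) hss"
    and b :: "('s4, 'e4, 'p4, 't4, 'g4, 'q4) hss"
    and \<phi> :: "'i \<Rightarrow> 'j"
  assumes "network X HX a ia"
    and "network Y HY b ib"
    and "network_mor X HX a ia Y HY b ib \<phi> \<Phi> z"
  shows "set_square_mor
           (\<Pi>\<^sub>E y\<in>Y. dCrl (HY y)) (\<Pi>\<^sub>E x\<in>X. dCrl (HX x)) (dCrl_family_rel X HX Y HY \<phi> \<Phi>)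
           (dCrl b) (dCrl a) (dCrl_rel b a z)
           (dCrl_pullback b (hss_prod Y HY) ib \<circ> dCrl_prod Y HY)
           (dCrl_pullback a (hss_prod X HX) ia \<circ> dCrl_prod X HX)"
  unfolding set_square_mor_def
proof (intro conjI)
  show "dCrl_family_rel X HX Y HY \<phi> \<Phi> \<subseteq> (\<Pi>\<^sub>E y\<in>Y. dCrl (HY y)) \<times> (\<Pi>\<^sub>E x\<in>X. dCrl (HX x))"
    by (auto simp: dCrl_family_rel_def)
  show "dCrl_rel b a z \<subseteq> dCrl b \<times> dCrl a"
    by (auto simp: dCrl_rel_def)
  \<comment> \<open>Both vertical arrows are the same construction, once for each network.\<close>
  show "dCrl_pullback b (hss_prod Y HY) ib \<circ> dCrl_prod Y HY \<in> (\<Pi>\<^sub>E y\<in>Y. dCrl (HY y)) \<rightarrow> dCrl b"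
    using hybrid_network.control_in_dCrl[OF hybrid_network.intro[OF assms(2)]] by blast
  show "dCrl_pullback a (hss_prod X HX) ia \<circ> dCrl_prod X HX \<in> (\<Pi>\<^sub>E x\<in>X. dCrl (HX x)) \<rightarrow> dCrl a"
    using hybrid_network.control_in_dCrl[OF hybrid_network.intro[OF assms(1)]] by blast
  show "map_prod (dCrl_pullback b (hss_prod Y HY) ib \<circ> dCrl_prod Y HY) (dCrl_pullback a (hss_prod X HX) ia \<circ> dCrl_prod X HX)
      ` dCrl_family_rel X HX Y HY \<phi> \<Phi> \<subseteq> dCrl_rel b a z"
    using control_related[OF assms] by auto
qed

end
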